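(* Let $f$ be a Bernstein function satisfying (A1) and (A2), with Lévy tail $\bar\mu$ and positive Sonine pair $(\bar\mu,k)$, so that $\mathcal L(\bar\mu;\lambda)=f(\lambda)/\lambda$ and $\mathcal L(k;\lambda)=1/f(\lambda)$. Assume that $\limsup_{x\to0}\bar\mu(x)\int_0^xk(s)\,ds<1$. Let $T>0$. For any $\lambda>0$, $g\in C[0,T]$ and $x\in(0,T]$ one has $$\mathbb E^x\left[\int_0^{\tau_\infty}e^{-\lambda t}g(S^c_t)\,dt\right]=\sum_{n=0}^\infty(-\lambda)^n\big(I^f_{\mathrm{Ce}}\big)^{n+1}g(x).$$ In particular, $$\mathbb E^x\big[e^{-\lambda\tau_\infty}\big]=\sum_{n=0}^\infty(-\lambda)^n\big(I^f_{\mathrm{Ce}}\big)^n\mathbf 1(x),$$ where $\mathbf 1$ is the constant function $1$, and for every $n=0,1,2,\dots$ $$\big(I^f_{\mathrm{Ce}}\big)^{n+1}g(x)=\mathbb E^x\left[\int_0^{\tau_\infty}\frac{t^n}{n!}\,g(S^c_t)\,dt\right].$$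
   Context: A Bernstein function with triplet $(a,b,\mu)$ is a function $f(\lambda)=a+b\lambda+\int_{(0,\infty)}(1-e^{-\lambda t})\,\mu(dt)$, $\lambda>0$, with $a,b\ge0$ and $\mu$ a Borel measure on $(0,\infty)$ with $\int\min\{1,t\}\,\mu(dt)<\infty$. Assumptions: (A1) $f$ is a Bernstein function with $f(0+)=0$, $\lim_{x\to\infty}f(x)=\infty$, $\lim_{x\to0}f(x)/x=\infty$, $\lim_{x\to\infty}f(x)/x=0$ (hence the triplet is $(0,0,\mu)$); (A2) $f$ is a complete Bernstein function, i.e. $\mu$ has a completely monotone density with respect to Lebesgue measure. Put $\bar\mu(x)=\mu((x,\infty))$, $x>0$. The conjugate $f^*(x)=x/f(x)$ is again a complete Bernstein function; let $\mu^*$ be its Lévy measure and $k(x)=\mu^*((x,\infty))$, $x>0$. Then $\bar\mu,k$ are completely monotone, locally integrable on $[0,\infty)$, and $(\bar\mu,k)$ is a positive Sonine pair: $\int_0^x\bar\mu(x-t)k(t)\,dt=1$ for all $x>0$; here $\mathcal L(h;\lambda)=\int_0^\infty e^{-\lambda x}h(x)\,dx$. Analytic notation: $I^f_{\mathrm R}\phi(x)=\int_0^x\phi(x-z)k(z)\,dz$ for $x>0$, with value $0$ at $x=0$ for $\phi\in C[0,T]$. $\mathcal K\phi(x)=\int_0^x\bar\mu(r)k(x-r)\phi(r)\,dr$ for $x>0$, $\mathcal K\phi(0)=\phi(0)$; $\mathcal K^0$ is the identity. Censored integral: $I^f_{\mathrm{Ce}}g=\sum_{i=0}^\infty\mathcal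 K^i[I^f_{\mathrm R}g]$ for $g\in C[0,T]$; it maps $C[0,T]$ into $C[0,T]$, and powers denote iterates (zeroth power = identity). Censored process: let $S=(S_t)_{t\ge0}$ be the subordinator (increasing Lévy process, $S_0=0$) with $\mathbb E e^{-\lambda S_t}=e^{-tf(\lambda)}$, and $S^1,S^2,\dots$ independent copies of $S$ on a probability space $(\Omega,\mathscr A,\mathbb P)$. Put $E_n(y)=\inf\{t\ge0:S^n_t>y\}$. Given a starting point $x>0$, put $\tau_0=0$, $S^c_0=x$ and recursively for $n\ge1$: $\sigma_n=E_n(S^c_{\tau_{n-1}})$, $\tau_n=\tau_{n-1}+\sigma_n$, $S^c_t=S^c_{\tau_{n-1}}-S^n_{t-\tau_{n-1}}$ for $\tau_{n-1}\le t<\tau_n$, and $S^c_{\tau_n}:=S^c_{\tau_n-}$ (left limit). With $\tau_\infty=\sup_n\tau_n$, set $S^c_t=\partial$ (cemetery) for $t\ge\tau_\infty$; functions are extended by $g(\partial)=0$. $\mathbb E^x$ denotes expectation when $S^c$ starts at $x$. *)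

theory Defs
  imports "HOL-Probability.Probability"
begin

section \<open>Bernstein functions\<close>

text \<open>A measure on \<open>(0,\<infinity>)\<close> is represented by a Borel measure on the real line
  without mass on \<open>(-\<infinity>,0]\<close>.\<close>

definition levy_measure :: "real measure \<Rightarrow> bool" where
  "levy_measure \<mu> \<longleftrightarrow>
     sets \<mu> = sets borel \<and> emeasure \<mu> {..0} = 0 \<and> (\<integral>\<^sup>+t. ennreal (min 1 t) \<partial>\<mu>) < \<infinity>"

text \<open>Only the values of \<open>f\<close> on \<open>(0,\<infinity>)\<close> matter.\<close>

definition bernstein_triplet :: "(real \<Rightarrow> real) \<Rightarrow> real \<Rightarrow> real \<Rightarrow> real measure \<Rightarrow> bool" where
  "bernstein_triplet f a b \<mu> \<longleftrightarrow>
     0 \<le> a \<and> 0 \<le> b \<and> levy_measure \<mu> \<and>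
     (\<forall>l>0. f l = a + b * l + (LINT t|\<mu>. 1 - exp (- l * t)))"

definition completely_monotone :: "(real \<Rightarrow> real) \<Rightarrow> bool" where
  "completely_monotone m \<longleftrightarrow>
     (\<forall>n. \<forall>x>0. (deriv ^^ n) m differentiable (at x) \<and> 0 \<le> (-1) ^ n * (deriv ^^ n) m x)"

definition has_completely_monotone_density :: "real measure \<Rightarrow> bool" where
  "has_completely_monotone_density \<mu> \<longleftrightarrow>
     (\<exists>m. completely_monotone m \<and>
          \<mu> = density lborel (\<lambda>t. ennreal (m t) * indicator {0<..} t))"

definition levy_tail :: "real measure \<Rightarrow> real \<Rightarrow> real" where
  "levy_tail \<mu> x = measure \<mu> {x<..}"

section \<open>The censored integral\<close>

text \<open>In the following operators \<open>\<nu>\<close> stands for the tail of the Levy measure of \<open>f\<close> and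
  \<open>k\<close> for the tail of the Levy measure of the conjugate function \<open>x / f x\<close>. Their values at
  \<open>x \<in> [0,T]\<close> only depend on the restriction of the argument function to \<open>[0,T]\<close>.\<close>

definition riemann_liouville_integral :: "(real \<Rightarrow> real) \<Rightarrow> (real \<Rightarrow> real) \<Rightarrow> real \<Rightarrow> real" where
  "riemann_liouville_integral k \<phi> x =
     (if x = 0 then 0 else LINT z:{0<..<x}|lborel. \<phi> (x - z) * k z)"

definition sonine_kernel_op ::
  "(real \<Rightarrow> real) \<Rightarrow> (real \<Rightarrow> real) \<Rightarrow> (real \<Rightarrow> real) \<Rightarrow> real \<Rightarrow> real" where
  "sonine_kernel_op \<nu> k \<phi> x =
     (if x = 0 then \<phi> 0 else LINT r:{0<..<x}|lborel. \<nu> r * k (x - r) * \<phi> r)"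

definition censored_integral ::
  "(real \<Rightarrow> real) \<Rightarrow> (real \<Rightarrow> real) \<Rightarrow> (real \<Rightarrow> real) \<Rightarrow> real \<Rightarrow> real" where
  "censored_integral \<nu> k g x = (\<Sum>i. (sonine_kernel_op \<nu> k ^^ i) (riemann_liouville_integral k g) x)"

section \<open>Subordinators\<close>

text \<open>Left limits and stochastic continuity follow from monotonicity and right-continuity
  of the paths. Path properties are required for every \<open>\<omega>\<close>, so that path functionals are
  measurable without completing the probability space.\<close>

definition subordinator ::
  "'w measure \<Rightarrow> (real \<Rightarrow> real) \<Rightarrow> (real \<Rightarrow> 'w \<Rightarrow> real) \<Rightarrow> bool" where
  "subordinator M f S \<longleftrightarrow>
     prob_space M \<and>
     (\<forall>t\<ge>0. S t \<in> borel_measurable M) \<and>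
     (\<forall>\<omega>\<in>space M. S 0 \<omega> = 0 \<and> mono_on {0..} (\<lambda>t. S t \<omega>) \<and>
        (\<forall>t\<ge>0. continuous (at_right t) (\<lambda>s. S s \<omega>))) \<and>
     (\<forall>t n. 0 \<le> t 0 \<longrightarrow> incseq t \<longrightarrow>
        prob_space.indep_vars M (\<lambda>_. borel)
          (\<lambda>i \<omega>. S (t (Suc i)) \<omega> - S (t i) \<omega>) {..<n::nat}) \<and>
     (\<forall>s\<ge>0. \<forall>t\<ge>0. distr M borel (\<lambda>\<omega>. S (s + t) \<omega> - S s \<omega>) = distr M borel (S t)) \<and>
     (\<forall>t\<ge>0. \<forall>l>0. prob_space.expectation M (\<lambda>\<omega>. exp (- l * S t \<omega>)) = exp (- t * f l))"

text \<open>Independence of the processes is independence of the random paths, viewed as elements of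
  the product space indexed by \<open>[0,\<infinity>)\<close>.\<close>

definition independent_subordinators ::
  "'w measure \<Rightarrow> (real \<Rightarrow> real) \<Rightarrow> (nat \<Rightarrow> real \<Rightarrow> 'w \<Rightarrow> real) \<Rightarrow> bool" where
  "independent_subordinators M f S \<longleftrightarrow>
     (\<forall>n. subordinator M f (S n)) \<and>
     prob_space.indep_vars M (\<lambda>_. \<Pi>\<^sub>M t\<in>{0..}. borel) (\<lambda>n \<omega>. \<lambda>t\<in>{0..}. S n t \<omega>) UNIV"

section \<open>The censored process\<close>

definition first_passage :: "(real \<Rightarrow> 'w \<Rightarrow> real) \<Rightarrow> real \<Rightarrow> 'w \<Rightarrow> ereal" where
  "first_passage S y \<omega> = (INF t\<in>{t. 0 \<le> t \<and> y < S t \<omega>}. ereal t)"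

text \<open>The pair of the \<open>n\<close>-th censoring time and the position at that time. Here \<open>S n\<close> drives the
  process between the \<open>n\<close>-th and the \<open>n+1\<close>-st censoring time, i.e. the copies are numbered from
  \<open>0\<close>. If the waiting time is \<open>0\<close> or \<open>\<infinity>\<close> (a null event), the segment has no left limit at its
  end and the position is kept.\<close>

primrec censoring ::
  "(nat \<Rightarrow> real \<Rightarrow> 'w \<Rightarrow> real) \<Rightarrow> real \<Rightarrow> 'w \<Rightarrow> nat \<Rightarrow> ereal \<times> real" where
  "censoring S x \<omega> 0 = (0, x)"
| "censoring S x \<omega> (Suc n) =
     (let \<tau> = fst (censoring S x \<omega> n);
          y = snd (censoring S x \<omega> n);
          \<tau>' = \<tau> + first_passage (S n) y \<omega>
      in (\<tau>', if \<tau> < \<tau>' \<and> \<tau>' < \<infinity>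
              then Lim (at_left (real_of_ereal \<tau>')) (\<lambda>t. y - S n (t - real_of_ereal \<tau>) \<omega>)
              else y))"

definition censoring_time ::
  "(nat \<Rightarrow> real \<Rightarrow> 'w \<Rightarrow> real) \<Rightarrow> real \<Rightarrow> nat \<Rightarrow> 'w \<Rightarrow> ereal" where
  "censoring_time S x n \<omega> = fst (censoring S x \<omega> n)"

definition censoring_position ::
  "(nat \<Rightarrow> real \<Rightarrow> 'w \<Rightarrow> real) \<Rightarrow> real \<Rightarrow> nat \<Rightarrow> 'w \<Rightarrow> real" where
  "censoring_position S x n \<omega> = snd (censoring S x \<omega> n)"

definition lifetime :: "(nat \<Rightarrow> real \<Rightarrow> 'w \<Rightarrow> real) \<Rightarrow> real \<Rightarrow> 'w \<Rightarrow> ereal" where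
  "lifetime S x \<omega> = (SUP n. censoring_time S x n \<omega>)"

text \<open>The cemetery state is \<open>None\<close>.\<close>

definition censored_process ::
  "(nat \<Rightarrow> real \<Rightarrow> 'w \<Rightarrow> real) \<Rightarrow> real \<Rightarrow> real \<Rightarrow> 'w \<Rightarrow> real option" where
  "censored_process S x t \<omega> =
     (if ereal t < lifetime S x \<omega> then
        let n = (THE n. censoring_time S x n \<omega> \<le> ereal t \<and> ereal t < censoring_time S x (Suc n) \<omega>)
        in Some (censoring_position S x n \<omega>
                 - S n (t - real_of_ereal (censoring_time S x n \<omega>)) \<omega>)
      else None)"

definition extend_cemetery :: "(real \<Rightarrow> real) \<Rightarrow> real option \<Rightarrow> real" where
  "extend_cemetery g z = (case z of None \<Rightarrow> 0 | Some y \<Rightarrow> g y)"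

definition lifetime_interval :: "(nat \<Rightarrow> real \<Rightarrow> 'w \<Rightarrow> real) \<Rightarrow> real \<Rightarrow> 'w \<Rightarrow> real set" where
  "lifetime_interval S x \<omega> = {t. 0 \<le> t \<and> ereal t < lifetime S x \<omega>}"

text \<open>\<open>exp (- l * \<tau>)\<close> for \<open>l > 0\<close> and \<open>\<tau> \<in> [0,\<infinity>]\<close>.\<close>

definition discount :: "real \<Rightarrow> ereal \<Rightarrow> real" where
  "discount l \<tau> = (if \<tau> = \<infinity> then 0 else exp (- l * real_of_ereal \<tau>))"

end

theory Submission
  imports Defs "HOL-Real_Asymp.Real_Asymp"
begin

text \<open>For \<open>l \<ge> 0\<close> let \<open>k\<^sub>l\<close> be the density of the \<open>l\<close>-potential measure of the subordinator, i.e. the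
  function with Laplace transform \<open>1 / (l + f)\<close>; for \<open>l = 0\<close> it is \<open>k\<close>. A discretisation in time
  computes the joint law of the first passage time and the undershoot: discounted at rate \<open>l\<close>, the
  undershoot below level \<open>y\<close> has density \<open>k\<^sub>l z * \<nu> (y - z)\<close>. Hence between two consecutive censoring
  times the process is described by the operators \<open>R\<^sub>l \<phi> = k\<^sub>l * \<phi>\<close> (occupation) and
  \<open>P\<^sub>l \<phi> = k\<^sub>l * (\<nu> \<phi>)\<close> (jump), and by independence of the copies the discounted resolvent is
  \<open>G\<^sub>l = (\<Sum>n. P\<^sub>l ^ n R\<^sub>l)\<close>, which for \<open>l = 0\<close> is the censored integral.

  The convolution identity \<open>k = k\<^sub>l + l k\<^sub>l * k\<close> yields the resolvent equation
  \<open>G\<^sub>0 g = G\<^sub>l (g + l G\<^sub>0 g)\<close>, whose iteration telescopes to the expansion in powers of \<open>- l\<close>. The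
  remainder vanishes because the hypothesis on \<open>\<nu> y * \<integral>\<^sub>0\<^sup>y k\<close> provides, for every rate, a bounded
  supersolution \<open>C * (\<integral>\<^sub>0\<^sup>x k) * exp (c * x)\<close>, so the powers of \<open>G\<^sub>0\<close> decay faster than any geometric
  sequence. The expansion at \<open>g = 1\<close> gives the law of the lifetime, and the moment formula follows by
  letting \<open>l\<close> tend to \<open>0\<close> in the Taylor remainders.\<close>
section \<open>Uniqueness of Laplace transforms\<close>

text \<open>Kernels, operators and expectations are kept \<open>ennreal\<close>-valued, so that
  Tonelli and monotone convergence apply before anything is known to be finite; signs return only at
  the end, when \<open>g\<close> is written as a difference of two bounded nonnegative functions.
  The time grid makes independent stationary increments at deterministic times the only
  probabilistic input for a single segment. In the level variable, the discounted undershoot has the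
  transform \<open>f q / (l + f (p + q)) / q\<close>, the product of \<open>f q / q\<close> (from
  \<open>\<nu>\<close>) and \<open>1 / (l + f (p + q))\<close> (from
  \<open>exp (- p * z) * k\<^sub>l z\<close>). Laplace uniqueness settles almost every level only,
  whereas the starting point and the later positions are individual levels; monotonicity in the
  level closes this gap, and likewise for the Sonine identity. The resolvent equation comes from
  convolution identities alone and not from the process. Its uniqueness part is a vanishing
  remainder, obtained by comparing the iterates of \<open>P\<^sub>l\<close> with those of
  \<open>P\<^sub>0\<close>.\<close>

lemma finite_measure_eqI_exp_moments:
  fixes M N :: "real measure"
  assumes "finite_measure M" "finite_measure N"
    and sets[measurable_cong]: "sets M = sets borel" "sets N = sets borel"
    and null: "emeasure M {..<0} = 0" "emeasure N {..<0} = 0"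
    and eq: "\<And>n::nat. (LINT z|M. exp (- z) ^ n) = (LINT z|N. exp (- z) ^ n)"
  shows "M = N"
proof -
  interpret M: finite_measure M by fact
  interpret N: finite_measure N by fact
  have AEM: "AE z in M. 0 \<le> z"
    using null(1) by (intro AE_I[of _ _ "{..<0}"]) (auto simp: sets)
  have AEN: "AE z in N. 0 \<le> z"
    using null(2) by (intro AE_I[of _ _ "{..<0}"]) (auto simp: sets)
  \<comment> \<open>Under \<open>u = exp (- z)\<close> the half-line becomes \<open>(0,1]\<close>
    and the hypothesis says that all moments in \<open>u\<close> agree. Density of the polynomials
    in the continuous functions on \<open>[0,1]\<close> gives equality for every continuous function
    of \<open>u\<close>.\<close>
  have cont: "(LINT z|M. \<phi> (exp (- z))) = (LINT z|N. \<phi> (exp (- z)))"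
    and intM: "integrable M (\<lambda>z. \<phi> (exp (- z)))" and intN: "integrable N (\<lambda>z. \<phi> (exp (- z)))"
    if c: "continuous_on UNIV \<phi>" for \<phi> :: "real \<Rightarrow> real"
  proof -
    have [measurable]: "\<phi> \<in> borel_measurable borel"
      using c by (rule borel_measurable_continuous_onI)
    have gen: "integrable L (\<lambda>z. \<psi> (exp (- z)))"
      if "continuous_on UNIV \<psi>" "AE z in L. 0 \<le> z" "finite_measure L" "sets L = sets borel"
      for \<psi> :: "real \<Rightarrow> real" and L :: "real measure"
    proof -
      interpret L: finite_measure L by fact
      note [measurable_cong] = that(4)
      have [measurable]: "\<psi> \<in> borel_measurable borel"
        using that(1) by (rule borel_measurable_continuous_onI)
      have "compact (\<psi> ` {0..1})"
        by (intro compact_continuous_image continuous_on_subset[OF that(1)]) auto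
      then obtain B where B: "\<And>u. u \<in> {0..1} \<Longrightarrow> norm (\<psi> u) \<le> B"
        by (meson bounded_iff compact_imp_bounded image_eqI)
      show ?thesis
      proof (rule L.integrable_const_bound)
        show "AE z in L. norm (\<psi> (exp (- z))) \<le> B"
          using that(2) by eventually_elim (use B in auto)
      qed measurable
    qed
    show iM: "integrable M (\<lambda>z. \<phi> (exp (- z)))"
      by (intro gen c AEM M.finite_measure_axioms sets)
    show iN: "integrable N (\<lambda>z. \<phi> (exp (- z)))"
      by (intro gen c AEN N.finite_measure_axioms sets)
    let ?D = "\<bar>(LINT z|M. \<phi> (exp (- z))) - (LINT z|N. \<phi> (exp (- z)))\<bar>"
    let ?K = "measure M (space M) + measure N (space N)"
    have bound: "?D \<le> e * ?K" if e: "e > 0" for e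
    proof -
      obtain p where p: "real_polynomial_function p" and
        pe: "\<And>u. u \<in> {0..1} \<Longrightarrow> \<bar>\<phi> u - p u\<bar> < e"
        using Stone_Weierstrass_real_polynomial_function[of "{0..1}" \<phi> e] e
          continuous_on_subset[OF c] by auto
      have pc: "continuous_on UNIV p"
        using p by (simp add: continuous_on_polymonial_function real_polynomial_function_eq continuous_intros)
      obtain a n where pa: "p = (\<lambda>u. \<Sum>i\<le>n. a i * u ^ i)"
        using p real_polynomial_function_iff_sum by blast
      have pcont: "continuous_on UNIV (\<lambda>u::real. u ^ i)" for i
        by (intro continuous_intros)
      have peq: "(LINT z|M. p (exp (- z))) = (LINT z|N. p (exp (- z)))"
      proof -
        have "(LINT z|L. p (exp (- z))) = (\<Sum>i\<le>n. a i * (LINT z|L. exp (- z) ^ i))"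
          if "AE z in L. 0 \<le> z" "finite_measure L" "sets L = sets borel" for L
          unfolding pa
          by (subst Bochner_Integration.integral_sum)
             (auto intro!: integrable_mult_right gen[OF pcont that])
        from this[OF AEM M.finite_measure_axioms sets(1)] this[OF AEN N.finite_measure_axioms sets(2)]
        show ?thesis by (simp add: eq)
      qed
      have d: "\<bar>(LINT z|L. \<phi> (exp (- z))) - (LINT z|L. p (exp (- z)))\<bar> \<le> e * measure L (space L)"
        if L: "AE z in L. 0 \<le> z" "finite_measure L" "sets L = sets borel" for L
      proof -
        interpret L: finite_measure L by fact
        have i1: "integrable L (\<lambda>z. \<phi> (exp (- z)))" "integrable L (\<lambda>z. p (exp (- z)))"
          by (intro gen c pc L)+
        have "\<bar>LINT z|L. \<phi> (exp (- z)) - p (exp (- z))\<bar> \<le> (LINT z|L. \<bar>\<phi> (exp (- z)) - p (exp (- z))\<bar>)"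
          by (rule integral_abs_bound)
        also have "\<dots> \<le> (LINT z|L. e)"
          using L(1) by (intro integral_mono_AE) (auto intro!: i1 less_imp_le[OF pe] elim!: eventually_mono)
        finally show ?thesis using i1 by (simp add: mult.commute)
      qed
      show ?thesis
        using d[OF AEM M.finite_measure_axioms sets(1)] d[OF AEN N.finite_measure_axioms sets(2)] peq
        by (simp add: algebra_simps abs_if split: if_splits)
    qed
    define K where "K = ?K"
    have K0: "K \<ge> 0" by (simp add: K_def)
    have "?D \<le> 0"
    proof (rule field_le_epsilon)
      fix e :: real assume "0 < e"
      have "?D \<le> e / (K + 1) * K" using K0 \<open>0 < e\<close> unfolding K_def[symmetric]
        by (intro bound[folded K_def] divide_pos_pos) linarith+
      also have "\<dots> \<le> e" using K0 \<open>0 < e\<close> by (simp add: field_simps)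
      finally show "?D \<le> 0 + e" by simp
    qed
    then show "(LINT z|M. \<phi> (exp (- z))) = (LINT z|N. \<phi> (exp (- z)))" by simp
  qed
  show ?thesis
  proof (rule measure_eqI_lessThan)
    show "sets M = sets borel" "sets N = sets borel" by (fact sets)+
    show "emeasure M {x<..} < \<infinity>" for x
      by (simp add: M.emeasure_eq_measure)
    fix x :: real
    \<comment> \<open>Continuous ramps in \<open>u\<close> that converge to the indicator of
      \<open>u < exp (-x)\<close>, that is of \<open>z > x\<close>.\<close>
    define \<phi> where "\<phi> n u = max 0 (min 1 (real n * (exp (-x) - u)))" for n u
    have \<phi>c: "continuous_on UNIV (\<phi> n)" for n
      unfolding \<phi>_def by (intro continuous_intros)
    have lim: "(\<lambda>n. \<phi> n (exp (- z))) \<longlonglongrightarrow> indicator {x<..} z" for z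
    proof (cases "x < z")
      case True
      define d where "d = exp (-x) - exp (-z)"
      have d: "d > 0" using True by (simp add: d_def)
      have "eventually (\<lambda>n. \<phi> n (exp (- z)) = indicator {x<..} z) sequentially"
        using eventually_ge_at_top[of "nat \<lceil>1 / d\<rceil>"]
      proof eventually_elim
        case (elim n)
        then have "1 / d \<le> real n" by linarith
        then have "1 \<le> real n * d" using d by (simp add: field_simps)
        then show ?case using True by (simp add: \<phi>_def d_def)
      qed
      then show ?thesis by (rule tendsto_eventually)
    next
      case False
      then have "real n * (exp (-x) - exp (-z)) \<le> 0" for n
        by (intro mult_nonneg_nonpos) auto
      then have "\<phi> n (exp (- z)) = indicator {x<..} z" for n
        using False unfolding \<phi>_def by (simp add: max_absorb1 min.coboundedI2)
      then show ?thesis by simp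
    qed
    have L: "(\<lambda>n. LINT z|L. \<phi> n (exp (- z))) \<longlonglongrightarrow> measure L {x<..}"
      if "finite_measure L" and L[measurable_cong]: "sets L = sets borel" for L
    proof -
      interpret L: finite_measure L by fact
      have [measurable]: "\<phi> n \<in> borel_measurable borel" for n
        using \<phi>c by (rule borel_measurable_continuous_onI)
      have "(\<lambda>n. LINT z|L. \<phi> n (exp (- z))) \<longlonglongrightarrow> (LINT z|L. indicator {x<..} z)"
        by (rule integral_dominated_convergence[where w="\<lambda>_. 1"])
           (auto simp: lim, auto simp: \<phi>_def)
      moreover have "space L = UNIV" using sets_eq_imp_space_eq[OF L] by simp
      ultimately show ?thesis by simp
    qed
    have "measure M {x<..} = measure N {x<..}"
      using L[OF M.finite_measure_axioms sets(1)] L[OF N.finite_measure_axioms sets(2)] cont[OF \<phi>c]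
      by (auto intro: LIMSEQ_unique)
    then show "emeasure M {x<..} = emeasure N {x<..}"
      by (simp add: M.emeasure_eq_measure N.emeasure_eq_measure)
  qed
qed

text \<open>Tilting by \<open>exp (- z)\<close> makes both measures finite, and the transforms at
  \<open>q = n + 1\<close> become the moments of \<open>exp (- z)\<close> under the tilted measures.
  The density \<open>exp z\<close> undoes the tilt.\<close>

lemma measure_eqI_laplace:
  fixes M N :: "real measure"
  assumes sets[measurable_cong]: "sets M = sets borel" "sets N = sets borel"
    and null: "emeasure M {..<0} = 0" "emeasure N {..<0} = 0"
    and eq: "\<And>q. q > 0 \<Longrightarrow> (\<integral>\<^sup>+z. ennreal (exp (- q * z)) \<partial>M) = (\<integral>\<^sup>+z. ennreal (exp (- q * z)) \<partial>N)"
    and fin: "\<And>q. q > 0 \<Longrightarrow> (\<integral>\<^sup>+z. ennreal (exp (- q * z)) \<partial>M) < \<infinity>"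
  shows "M = N"
proof -
  define D where "D L = density L (\<lambda>z. ennreal (exp (- z)))" for L :: "real measure"
  have D: "finite_measure (D L)" "sets (D L) = sets borel" "emeasure (D L) {..<0} = 0"
      "(LINT z|D L. exp (- z) ^ n) = enn2real (\<integral>\<^sup>+z. ennreal (exp (- (real n + 1) * z)) \<partial>L)"
      "density (D L) (\<lambda>z. ennreal (exp z)) = L"
    if L[measurable_cong]: "sets L = sets borel" and n: "emeasure L {..<0} = 0"
      and f: "\<And>q. q > 0 \<Longrightarrow> (\<integral>\<^sup>+z. ennreal (exp (- q * z)) \<partial>L) < \<infinity>" for L n
  proof -
    have sp: "space L = UNIV" using sets_eq_imp_space_eq[OF L] by simp
    show "finite_measure (D L)"
      using f[of 1] by (intro finite_measureI) (auto simp: D_def emeasure_density sp top.not_eq_extremum)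
    show "sets (D L) = sets borel" by (simp add: D_def L)
    have "(\<integral>\<^sup>+z. ennreal (exp (- z)) * indicator {..<0} z \<partial>L) = 0"
      using n by (subst nn_integral_0_iff_AE) (auto simp: indicator_def intro!: AE_I[of _ _ "{..<0}"] L)
    then show "emeasure (D L) {..<0} = 0" by (simp add: D_def emeasure_density)
    show "density (D L) (\<lambda>z. ennreal (exp z)) = L"
      unfolding D_def
      by (subst density_density_eq) (auto simp: ennreal_mult[symmetric] exp_minus density_1)
    show "(LINT z|D L. exp (- z) ^ n) = enn2real (\<integral>\<^sup>+z. ennreal (exp (- (real n + 1) * z)) \<partial>L)"
      unfolding D_def
      by (subst integral_eq_nn_integral, simp, simp, subst nn_integral_density)
         (auto intro!: arg_cong[where f=enn2real] nn_integral_cong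
          simp: ennreal_mult[symmetric] exp_of_nat_mult[symmetric] exp_add[symmetric] algebra_simps)
  qed
  have fin_N: "(\<integral>\<^sup>+z. ennreal (exp (- q * z)) \<partial>N) < \<infinity>" if "q > 0" for q
    using fin[OF that] eq[OF that] by simp
  note DM = D[OF sets(1) null(1) fin, simplified] and DN = D[OF sets(2) null(2) fin_N, simplified]
  have "D M = D N"
  proof (intro finite_measure_eqI_exp_moments DM DN)
    fix n :: nat
    have "real n + 1 > 0" by simp
    then show "(LINT z|D M. exp (- z) ^ n) = (LINT z|D N. exp (- z) ^ n)"
      using eq[of "real n + 1"] by (simp add: DM(4) DN(4))
  qed
  then show ?thesis using DM(5) DN(5) by metis
qed

text \<open>Both functions are densities of one and the same measure, which fixes them only up to
  null sets. Every pointwise identity derived from this lemma takes an additional monotonicity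
  argument.\<close>

lemma AE_eq_laplace:
  fixes a b :: "real \<Rightarrow> ennreal"
  assumes [measurable]: "a \<in> borel_measurable borel" "b \<in> borel_measurable borel"
    and 0: "\<And>z. z < 0 \<Longrightarrow> a z = 0" "\<And>z. z < 0 \<Longrightarrow> b z = 0"
    and eq: "\<And>q. q > 0 \<Longrightarrow> (\<integral>\<^sup>+z. ennreal (exp (- q * z)) * a z \<partial>lborel) =
      (\<integral>\<^sup>+z. ennreal (exp (- q * z)) * b z \<partial>lborel)"
    and fin: "\<And>q. q > 0 \<Longrightarrow> (\<integral>\<^sup>+z. ennreal (exp (- q * z)) * a z \<partial>lborel) < \<infinity>"
  shows "AE z in lborel. a z = b z"
proof -
  have "density lborel a = density lborel b"
  proof (rule measure_eqI_laplace)
    have z: "(\<lambda>z. c z * indicator {..<0} z) = (\<lambda>_. 0)" if "\<And>z. z < 0 \<Longrightarrow> c z = 0" 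
      for c :: "real \<Rightarrow> ennreal"
      by (rule ext) (auto simp: indicator_def intro: that)
    show "emeasure (density lborel a) {..<0} = 0" "emeasure (density lborel b) {..<0} = 0"
      by (simp_all add: emeasure_density z 0)
  qed (use eq fin in \<open>simp_all add: nn_integral_density mult.commute\<close>)
  then show ?thesis
    by (subst sigma_finite_measure.density_unique_iff[OF sigma_finite_lborel, symmetric]) auto
qed

section \<open>Convolution on the half-line\<close>

text \<open>For functions vanishing on the negative half-line this is the usual convolution over
  \<open>(0,x)\<close>. With values in \<open>ennreal\<close>, associativity and the product rule
  for transforms hold without integrability conditions.\<close>

definition conv :: "(real \<Rightarrow> ennreal) \<Rightarrow> (real \<Rightarrow> ennreal) \<Rightarrow> real \<Rightarrow> ennreal" where
  "conv a b x = (\<integral>\<^sup>+z. a z * b (x - z) \<partial>lborel)"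

text \<open>The cut-off hides the values of a Levy tail at nonpositive arguments, where the mass may
  be infinite and \<open>measure\<close> would return 0.\<close>

definition halfline :: "(real \<Rightarrow> real) \<Rightarrow> real \<Rightarrow> ennreal" where
  "halfline h z = ennreal (h z) * indicator {0<..} z"

lemma borel_measurable_conv[measurable]:
  assumes [measurable]: "a \<in> borel_measurable borel" "b \<in> borel_measurable borel"
  shows "conv a b \<in> borel_measurable borel"
  unfolding conv_def by measurable

lemma conv_commute:
  assumes [measurable]: "a \<in> borel_measurable borel" "b \<in> borel_measurable borel"
  shows "conv a b = conv b a"
proof
  fix x
  show "conv a b x = conv b a x"
    unfolding conv_def by (subst nn_integral_real_affine[where c="-1" and t=x]) (simp_all add: mult.commute)
qed

lemma nn_integral_lborel_shift:
  fixes h :: "real \<Rightarrow> ennreal"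
  assumes [measurable]: "h \<in> borel_measurable borel"
  shows "(\<integral>\<^sup>+x. h (x - t) \<partial>lborel) = (\<integral>\<^sup>+x. h x \<partial>lborel)"
  by (subst (2) nn_integral_real_affine[where c=1 and t="-t"]) (simp_all add: algebra_simps)

lemma nn_integral_lborel_swap:
  fixes h :: "real \<Rightarrow> real \<Rightarrow> ennreal"
  assumes [measurable]: "case_prod h \<in> borel_measurable (borel \<Otimes>\<^sub>M borel)"
  shows "(\<integral>\<^sup>+x. \<integral>\<^sup>+y. h x y \<partial>lborel \<partial>lborel) = (\<integral>\<^sup>+y. \<integral>\<^sup>+x. h x y \<partial>lborel \<partial>lborel)"
  by (rule lborel_pair.Fubini'[symmetric]) simp

lemma conv_assoc:
  assumes [measurable]: "a \<in> borel_measurable borel" "b \<in> borel_measurable borel" "c \<in> borel_measurable borel"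
  shows "conv a (conv b c) = conv (conv a b) c"
proof
  fix x
  have "conv (conv a b) c x = (\<integral>\<^sup>+z. \<integral>\<^sup>+y. a y * b (z - y) * c (x - z) \<partial>lborel \<partial>lborel)"
    by (simp add: conv_def nn_integral_multc)
  also have "\<dots> = (\<integral>\<^sup>+y. \<integral>\<^sup>+z. a y * b (z - y) * c (x - z) \<partial>lborel \<partial>lborel)"
    by (rule nn_integral_lborel_swap) simp
  also have "\<dots> = (\<integral>\<^sup>+y. a y * (\<integral>\<^sup>+z. b (z - y) * c (x - y - (z - y)) \<partial>lborel) \<partial>lborel)"
    by (simp add: nn_integral_cmult[symmetric] mult.assoc)
  also have "\<dots> = (\<integral>\<^sup>+y. a y * (\<integral>\<^sup>+z. b z * c (x - y - z) \<partial>lborel) \<partial>lborel)"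
    by (subst nn_integral_lborel_shift[where h="\<lambda>z. b z * c (_ - z)"]) simp_all
  finally show "conv a (conv b c) x = conv (conv a b) c x" by (simp add: conv_def)
qed

lemma laplace_conv:
  assumes [measurable]: "a \<in> borel_measurable borel" "b \<in> borel_measurable borel"
  shows "(\<integral>\<^sup>+x. ennreal (exp (- q * x)) * conv a b x \<partial>lborel) =
    (\<integral>\<^sup>+x. ennreal (exp (- q * x)) * a x \<partial>lborel) * (\<integral>\<^sup>+x. ennreal (exp (- q * x)) * b x \<partial>lborel)"
proof -
  have e: "ennreal (exp (- q * x)) = ennreal (exp (- q * y)) * ennreal (exp (- q * (x - y)))" for x y
    by (simp add: ennreal_mult[symmetric] exp_add[symmetric] algebra_simps)
  have r: "ennreal (exp (- q * x)) * (a y * b (x - y)) =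
      ennreal (exp (- q * y)) * a y * (ennreal (exp (- q * (x - y))) * b (x - y))" for x y
    by (subst e[of x y]) (simp only: mult_ac)
  have "(\<integral>\<^sup>+x. ennreal (exp (- q * x)) * conv a b x \<partial>lborel) =
      (\<integral>\<^sup>+x. \<integral>\<^sup>+y. ennreal (exp (- q * y)) * a y * (ennreal (exp (- q * (x - y))) * b (x - y)) \<partial>lborel \<partial>lborel)"
    
    unfolding conv_def
    by (rule nn_integral_cong, subst nn_integral_cmult[symmetric], simp, rule nn_integral_cong, rule r)
  also have "\<dots> = (\<integral>\<^sup>+y. \<integral>\<^sup>+x. ennreal (exp (- q * y)) * a y * (ennreal (exp (- q * (x - y))) * b (x - y)) \<partial>lborel \<partial>lborel)"
    by (rule nn_integral_lborel_swap) simp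
  also have "\<dots> = (\<integral>\<^sup>+y. ennreal (exp (- q * y)) * a y * (\<integral>\<^sup>+x. ennreal (exp (- q * (x - y))) * b (x - y) \<partial>lborel) \<partial>lborel)"
    by (subst nn_integral_cmult) simp_all
  also have "\<dots> = (\<integral>\<^sup>+y. ennreal (exp (- q * y)) * a y * (\<integral>\<^sup>+x. ennreal (exp (- q * x)) * b x \<partial>lborel) \<partial>lborel)"
    by (subst nn_integral_lborel_shift[where h="\<lambda>z. ennreal (exp (- q * z)) * b z"]) simp_all
  finally show ?thesis by (simp add: nn_integral_multc)
qed

lemma conv_mono_left_AE:
  assumes "AE z in lborel. a z \<le> a' z"
  shows "conv a b x \<le> conv a' b x"
  unfolding conv_def
  by (rule nn_integral_mono_AE) (use assms in eventually_elim, simp add: mult_right_mono)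

lemma conv_cong_AE_left:
  assumes "AE z in lborel. a z = a' z"
  shows "conv a b x = conv a' b x"
  unfolding conv_def
  by (rule nn_integral_cong_AE) (use assms in eventually_elim, simp)

lemma conv_add_right:
  assumes [measurable]: "a \<in> borel_measurable borel" "b \<in> borel_measurable borel" "c \<in> borel_measurable borel"
  shows "conv a (\<lambda>z. b z + c z) x = conv a b x + conv a c x"
  unfolding conv_def by (simp add: distrib_left nn_integral_add)

lemma conv_add_left:
  assumes [measurable]: "a \<in> borel_measurable borel" "b \<in> borel_measurable borel" "c \<in> borel_measurable borel"
  shows "conv (\<lambda>z. a z + b z) c x = conv a c x + conv b c x"
  unfolding conv_def by (simp add: distrib_right nn_integral_add)

lemma conv_cmult_right:
  assumes [measurable]: "a \<in> borel_measurable borel" "b \<in> borel_measurable borel"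
  shows "conv a (\<lambda>z. r * b z) x = r * conv a b x"
  unfolding conv_def by (simp add: nn_integral_cmult[symmetric] mult_ac)

lemma conv_cmult_left:
  assumes [measurable]: "a \<in> borel_measurable borel" "b \<in> borel_measurable borel"
  shows "conv (\<lambda>z. r * a z) b x = r * conv a b x"
  unfolding conv_def by (simp add: nn_integral_cmult[symmetric] mult_ac)

lemma conv_nonpos:
  assumes "\<And>z. z \<le> 0 \<Longrightarrow> a z = 0" "\<And>z. z \<le> 0 \<Longrightarrow> b z = 0" "x \<le> 0"
  shows "conv a b x = 0"
proof -
  have "a z * b (x - z) = 0" for z
    using assms by (cases "z \<le> 0") auto
  then show ?thesis unfolding conv_def by (simp only: nn_integral_const mult_zero_left)
qed

lemma conv_mono_right:
  assumes "\<And>z. z \<le> 0 \<Longrightarrow> a z = 0" "\<And>z. z < x \<Longrightarrow> b z \<le> c z"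
  shows "conv a b x \<le> conv a c x"
  unfolding conv_def
proof (rule nn_integral_mono)
  fix z show "a z * b (x - z) \<le> a z * c (x - z)"
    using assms by (cases "z \<le> 0") (auto intro!: mult_left_mono)
qed

lemma halfline_nonpos[simp]: "z \<le> 0 \<Longrightarrow> halfline h z = 0"
  by (simp add: halfline_def)

text \<open>A nonempty open interval is not a null set. This supplies good points arbitrarily close
  to a given one when an almost everywhere identity is extended by monotonicity.\<close>

lemma AE_lborel_obtain:
  fixes u v :: real
  assumes "AE y in lborel. P y" "u < v"
  obtains y where "u < y" "y < v" "P y"
proof -
  have "\<not> (AE y in lborel. y \<notin> {u<..<v})"
    using assms(2) by (subst AE_iff_measurable[where N="{u<..<v}"]) auto
  with assms(1) show ?thesis using that
    by (metis (mono_tags, lifting) eventually_mono greaterThanLessThan_iff)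
qed

section \<open>Levy measures and Bernstein functions\<close>

context
  fixes \<mu> :: "real measure"
  assumes \<mu>: "levy_measure \<mu>"
begin

lemma levy_sets[measurable_cong]: "sets \<mu> = sets borel"
  using \<mu> by (simp add: levy_measure_def)

lemma levy_space: "space \<mu> = UNIV"
  using sets_eq_imp_space_eq[OF levy_sets] by simp

lemma levy_AE_pos: "AE t in \<mu>. 0 < t"
  using \<mu> by (intro AE_I[of _ _ "{..0}"]) (auto simp: levy_measure_def)

text \<open>Markov's inequality for the integrable function \<open>min 1 t\<close>.\<close>

lemma emeasure_levy_tail_finite:
  assumes "0 < x" shows "emeasure \<mu> {x<..} < \<infinity>"
proof -
  have "ennreal (min 1 x) * emeasure \<mu> {x<..} = (\<integral>\<^sup>+t. ennreal (min 1 x) * indicator {x<..} t \<partial>\<mu>)"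
    by (subst nn_integral_cmult_indicator) (auto simp: levy_sets)
  also have "\<dots> \<le> (\<integral>\<^sup>+t. ennreal (min 1 t) \<partial>\<mu>)"
    by (intro nn_integral_mono) (auto simp: indicator_def intro!: ennreal_leI)
  also have "\<dots> < \<infinity>" using \<mu> by (simp add: levy_measure_def)
  finally show ?thesis using assms
    by (auto simp: ennreal_mult_less_top)
qed

lemma emeasure_levy_tail: "0 < x \<Longrightarrow> emeasure \<mu> {x<..} = ennreal (levy_tail \<mu> x)"
  unfolding levy_tail_def using emeasure_levy_tail_finite[of x]
  by (simp add: emeasure_eq_ennreal_measure)

lemma levy_tail_antimono:
  assumes "0 < x" "x \<le> y" shows "levy_tail \<mu> y \<le> levy_tail \<mu> x"
proof -
  have "emeasure \<mu> {y<..} \<le> emeasure \<mu> {x<..}"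
    using assms by (intro emeasure_mono) (auto simp: levy_sets)
  then show ?thesis using assms
    by (simp add: emeasure_levy_tail levy_tail_def)
qed

text \<open>The half-lines beyond \<open>1 / n\<close> have finite mass and exhaust the positive
  numbers; the rest is null. This permits exchanging integrals with \<open>lborel\<close>.\<close>

lemma levy_sigma_finite: "sigma_finite_measure \<mu>"
proof
  let ?A = "insert {..0} ((\<lambda>n::nat. {1 / real (Suc n)<..}) ` UNIV)"
  have "\<Union>?A = UNIV"
  proof (intro equalityI subsetI)
    fix t :: real
    show "t \<in> \<Union>?A"
    proof (cases "t \<le> 0")
      case False
      then obtain n where "1 / real (Suc n) < t"
        using nat_approx_posE[of t] by auto
      then show ?thesis by auto
    qed auto
  qed auto
  then show "\<exists>A. countable A \<and> A \<subseteq> sets \<mu> \<and> \<Union>A = space \<mu> \<and> (\<forall>a\<in>A. emeasure \<mu> a \<noteq> \<infinity>)"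
    using \<mu> emeasure_levy_tail_finite
    by (intro exI[of _ ?A]) (auto simp: levy_space levy_sets levy_measure_def less_top)
qed

lemma borel_measurable_halfline_levy_tail[measurable]:
  "halfline (levy_tail \<mu>) \<in> borel_measurable borel"
proof -
  have "mono_on {0<..} (\<lambda>x. - levy_tail \<mu> x)"
    by (auto simp: mono_on_def intro!: levy_tail_antimono)
  then have "(\<lambda>x. - levy_tail \<mu> x) \<in> borel_measurable (restrict_space borel {0<..})"
    by (rule borel_measurable_mono_on_fnc)
  then have "levy_tail \<mu> \<in> borel_measurable (restrict_space borel {0<..})"
    by simp
  then have "(\<lambda>x. ennreal (levy_tail \<mu> x)) \<in> borel_measurable (restrict_space borel {0<..})"
    by simp
  then have "(\<lambda>x. ennreal (levy_tail \<mu> x) * indicator {0<..} x) \<in> borel_measurable borel"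
    by (subst (asm) borel_measurable_restrict_space_iff_ennreal) auto
  then show ?thesis by (simp add: halfline_def[abs_def])
qed

lemma halfline_levy_tail_antimono:
  "0 < x \<Longrightarrow> x \<le> y \<Longrightarrow> halfline (levy_tail \<mu>) y \<le> halfline (levy_tail \<mu>) x"
  by (auto simp: halfline_def intro!: ennreal_leI levy_tail_antimono)

text \<open>The tail is the \<mu>-integral over \<open>t\<close> of the indicator of
  \<open>x < t\<close>. After exchanging the integrals, the inner one is that of
  \<open>exp (- q * x)\<close> over \<open>(0,t)\<close>, with value
  \<open>(1 - exp (- q * t)) / q\<close>.\<close>

lemma laplace_levy_tail:
  assumes q: "0 < q"
  shows "integrable \<mu> (\<lambda>t. 1 - exp (- q * t))"
    and "(\<integral>\<^sup>+x. ennreal (exp (- q * x)) * halfline (levy_tail \<mu>) x \<partial>lborel) =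
      ennreal ((LINT t|\<mu>. 1 - exp (- q * t)) / q)"
    and "0 \<le> (LINT t|\<mu>. 1 - exp (- q * t))"
proof -
  interpret sigma_finite_measure \<mu> by (rule levy_sigma_finite)
  interpret pair_sigma_finite "lborel :: real measure" \<mu> ..
  \<comment> \<open>The factor \<open>q\<close> serves \<open>t \<le> 1\<close> and the factor 1
    serves \<open>t > 1\<close>, matching the two regimes of the Levy integrability
    condition.\<close>
  have bound: "1 - exp (- q * t) \<le> max 1 q * min 1 t" if "0 < t" for t
  proof (cases "t \<le> 1")
    case True
    have "1 - exp (- q * t) \<le> q * t" using exp_ge_add_one_self[of "- q * t"] by simp
    also have "\<dots> \<le> max 1 q * t" using that by (intro mult_right_mono) auto
    finally show ?thesis using True by simp
  next
    case False
    then show ?thesis by (simp add: le_max_iff_disj add_increasing2)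
  qed
  show i: "integrable \<mu> (\<lambda>t. 1 - exp (- q * t))"
  proof (rule Bochner_Integration.integrable_bound)
    have "(\<integral>\<^sup>+t. norm (min 1 t) \<partial>\<mu>) = (\<integral>\<^sup>+t. ennreal (min 1 t) \<partial>\<mu>)"
      by (rule nn_integral_cong_AE) (use levy_AE_pos in eventually_elim, simp)
    then have "integrable \<mu> (\<lambda>t. min 1 t)"
      using \<mu> by (intro integrableI_bounded) (auto simp: levy_measure_def)
    then show "integrable \<mu> (\<lambda>t. max 1 q * min 1 t)" by simp
    show "AE t in \<mu>. norm (1 - exp (- q * t)) \<le> norm (max 1 q * min 1 t)"
      using levy_AE_pos by eventually_elim (use bound q in auto)
  qed simp
  show "0 \<le> (LINT t|\<mu>. 1 - exp (- q * t))"
    by (rule integral_nonneg_AE) (use levy_AE_pos in eventually_elim, use q in auto)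
  have "(\<integral>\<^sup>+x. ennreal (exp (- q * x)) * halfline (levy_tail \<mu>) x \<partial>lborel) =
      (\<integral>\<^sup>+x. \<integral>\<^sup>+t. ennreal (exp (- q * x)) * indicator {0<..} x * indicator {0<..} (t - x) \<partial>\<mu> \<partial>lborel)"
  proof (rule nn_integral_cong)
    fix x :: real
    have "(\<integral>\<^sup>+t. indicator {0<..} (t - x) \<partial>\<mu>) = emeasure \<mu> {x<..}"
    proof -
      have "(\<lambda>t. indicator {0<..} (t - x)) = (indicator {x<..} :: real \<Rightarrow> ennreal)"
        by (auto simp: indicator_def)
      then show ?thesis by (simp add: levy_sets)
    qed
    then show "ennreal (exp (- q * x)) * halfline (levy_tail \<mu>) x =
        (\<integral>\<^sup>+t. ennreal (exp (- q * x)) * indicator {0<..} x * indicator {0<..} (t - x) \<partial>\<mu>)"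
      by (simp add: nn_integral_cmult) (simp add: halfline_def indicator_def emeasure_levy_tail)
  qed
  also have "\<dots> = (\<integral>\<^sup>+t. \<integral>\<^sup>+x. ennreal (exp (- q * x)) * indicator {0<..} x * indicator {0<..} (t - x) \<partial>lborel \<partial>\<mu>)"
    by (rule Fubini'[symmetric]) simp
  also have "\<dots> = (\<integral>\<^sup>+t. ennreal ((1 - exp (- q * t)) / q) \<partial>\<mu>)"
  proof (rule nn_integral_cong_AE)
    show "AE t in \<mu>. (\<integral>\<^sup>+x. ennreal (exp (- q * x)) * indicator {0<..} x * indicator {0<..} (t - x) \<partial>lborel) =
        ennreal ((1 - exp (- q * t)) / q)"
      using levy_AE_pos
    proof eventually_elim
      case (elim t)
      have "(\<integral>\<^sup>+x. ennreal (exp (- q * x)) * indicator {0<..} x * indicator {0<..} (t - x) \<partial>lborel) =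
          (\<integral>\<^sup>+x. ennreal (exp (- q * x)) * indicator {0..t} x \<partial>lborel)"
        by (intro nn_integral_cong_AE, use AE_lborel_singleton[of 0] AE_lborel_singleton[of t] in eventually_elim)
           (auto simp: indicator_def)
      also have "\<dots> = ennreal (- exp (- q * t) / q - - exp (- q * 0) / q)"
        using q elim
        by (intro nn_integral_FTC_Icc) (auto intro!: derivative_eq_intros)
      finally show ?case by (simp add: diff_divide_distrib)
    qed
  qed
  also have "\<dots> = ennreal (LINT t|\<mu>. (1 - exp (- q * t)) / q)"
    using i by (intro nn_integral_eq_integral)
      (auto intro: eventually_mono[OF levy_AE_pos] simp: q less_imp_le)
  finally show "(\<integral>\<^sup>+x. ennreal (exp (- q * x)) * halfline (levy_tail \<mu>) x \<partial>lborel) =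
      ennreal ((LINT t|\<mu>. 1 - exp (- q * t)) / q)" by simp
qed

end

text \<open>The integral term is nonnegative, so \<open>a\<close> is a lower bound of
  \<open>f q\<close> and \<open>b\<close> one of \<open>f q / q\<close>; the two limits force both
  constants to vanish.\<close>

lemma bernstein_drift_zero:
  assumes B: "bernstein_triplet f a b \<mu>"
    and 0: "(f \<longlongrightarrow> 0) (at_right 0)" and 1: "((\<lambda>y. f y / y) \<longlongrightarrow> 0) at_top"
  shows "a = 0" "b = 0" "\<And>q. 0 < q \<Longrightarrow> f q = (LINT t|\<mu>. 1 - exp (- q * t))"
proof -
  have L: "levy_measure \<mu>" and ab: "0 \<le> a" "0 \<le> b"
    and f: "\<And>q. 0 < q \<Longrightarrow> f q = a + b * q + (LINT t|\<mu>. 1 - exp (- q * t))"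
    using B by (auto simp: bernstein_triplet_def)
  have "a \<le> 0"
  proof (rule tendsto_lowerbound[OF 0])
    show "\<forall>\<^sub>F q in at_right 0. a \<le> f q"
      using eventually_at_right_less[of 0]
      by eventually_elim (use f ab laplace_levy_tail(3)[OF L] in \<open>auto intro!: add_nonneg_nonneg\<close>)
  qed simp
  then show a: "a = 0" using ab by simp
  have "b \<le> 0"
  proof (rule tendsto_lowerbound[OF 1])
    show "\<forall>\<^sub>F q in at_top. b \<le> f q / q"
      using eventually_gt_at_top[of 0]
      by eventually_elim (use f ab laplace_levy_tail(3)[OF L] in \<open>auto simp: field_simps intro!: add_nonneg_nonneg\<close>)
  qed simp
  then show "b = 0" using ab by simp
  with a f show "\<And>q. 0 < q \<Longrightarrow> f q = (LINT t|\<mu>. 1 - exp (- q * t))" by simp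
qed

lemma nn_integral_exp_Ioi:
  assumes q: "0 < q"
  shows "(\<integral>\<^sup>+x. indicator {0<..} x * ennreal (exp (- q * x)) \<partial>lborel) = ennreal (1 / q)"
proof -
  have "(\<integral>\<^sup>+x. indicator {0<..} x * ennreal (exp (- q * x)) \<partial>lborel) =
      (\<integral>\<^sup>+x. ennreal (exp (- q * x)) * indicator {0..} x \<partial>lborel)"
    by (intro nn_integral_cong_AE, use AE_lborel_singleton[of 0] in eventually_elim)
       (auto simp: indicator_def)
  also have "\<dots> = ennreal (0 - - exp (- q * 0) / q)"
  proof (rule nn_integral_FTC_atLeast)
    show "((\<lambda>a. - exp (- q * a) / q) \<longlongrightarrow> 0) at_top"
      using q by real_asymp
  qed (use q in \<open>auto intro!: derivative_eq_intros\<close>)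
  finally show ?thesis by simp
qed

text \<open>The product of the transforms is the transform of the indicator of the positive
  half-line, which gives the value 1 almost everywhere. The convolution of two antitone functions at
  \<open>z\<close> is at most \<open>z / y\<close> times its value at \<open>y \<le> z\<close>;
  comparison with good points on either side of \<open>x\<close> removes the exceptional
  set.\<close>

lemma sonine_conv:
  fixes v k :: "real \<Rightarrow> ennreal"
  assumes [measurable]: "v \<in> borel_measurable borel" "k \<in> borel_measurable borel"
    and 0: "\<And>z. z \<le> 0 \<Longrightarrow> v z = 0" "\<And>z. z \<le> 0 \<Longrightarrow> k z = 0"
    and anti: "\<And>x y. 0 < x \<Longrightarrow> x \<le> y \<Longrightarrow> v y \<le> v x" "\<And>x y. 0 < x \<Longrightarrow> x \<le> y \<Longrightarrow> k y \<le> k x"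
    and L: "\<And>q. 0 < q \<Longrightarrow> (\<integral>\<^sup>+x. ennreal (exp (- q * x)) * v x \<partial>lborel) *
        (\<integral>\<^sup>+x. ennreal (exp (- q * x)) * k x \<partial>lborel) = ennreal (1 / q)"
    and x: "0 < x"
  shows "conv v k x = 1"
proof -
  have one: "(\<integral>\<^sup>+x. ennreal (exp (- q * x)) * indicator {0<..} x \<partial>lborel) = ennreal (1 / q)" if q: "0 < q" for q :: real
    using nn_integral_exp_Ioi[OF q] by (simp only: mult.commute)
  have AE: "AE z in lborel. conv v k z = indicator {0<..} z"
  proof (rule AE_eq_laplace)
    show "conv v k z = 0" if "z < 0" for z using that by (intro conv_nonpos 0) auto
  qed (simp_all only: laplace_conv[OF assms(1,2)] one L, auto)
  \<comment> \<open>Stretching the integration variable by \<open>\<rho> = z / y \<ge> 1\<close>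
    costs the factor \<open>\<rho>\<close> and only lowers the two antitone factors.\<close>
  have scale: "conv v k z \<le> ennreal (z / y) * conv v k y" if "0 < y" "y \<le> z" for y z
  proof -
    define \<rho> where "\<rho> = z / y"
    have \<rho>: "1 \<le> \<rho>" "z = \<rho> * y" using that by (auto simp: \<rho>_def)
    have le: "h (\<rho> * u) \<le> h u" if "\<And>z. z \<le> 0 \<Longrightarrow> h z = 0" "\<And>x y. 0 < x \<Longrightarrow> x \<le> y \<Longrightarrow> h y \<le> h x"
      for h :: "real \<Rightarrow> ennreal" and u
    proof (cases "u \<le> 0")
      case True
      then have "\<rho> * u \<le> 0" using \<rho> by (simp add: mult_nonneg_nonpos)
      then show ?thesis using that True by simp
    next
      case False
      then show ?thesis using \<rho> by (intro that(2)) auto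
    qed
    have "conv v k z = ennreal \<rho> * (\<integral>\<^sup>+u. v (\<rho> * u) * k (\<rho> * (y - u)) \<partial>lborel)"
      unfolding conv_def using \<rho>
      by (subst nn_integral_real_affine[where c=\<rho> and t=0]) (auto simp: algebra_simps)
    also have "\<dots> \<le> ennreal \<rho> * (\<integral>\<^sup>+u. v u * k (y - u) \<partial>lborel)"
      by (intro mult_left_mono nn_integral_mono mult_mono le 0 anti) auto
    finally show ?thesis by (simp add: conv_def \<rho>_def)
  qed
  show ?thesis
  proof (rule antisym)
    show "conv v k x \<le> 1"
    proof (rule ennreal_le_epsilon)
      fix e :: real assume e: "0 < e"
      \<comment> \<open>Every good \<open>y\<close> between these bounds satisfies
        \<open>x / y \<le> 1 + e\<close>.\<close>
      have "x / (1 + e) < x" using x e by (simp add: field_simps)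
      from AE_lborel_obtain[OF AE this] obtain y where y: "x / (1 + e) < y" "y < x" "conv v k y = indicator {0<..} y"
        by metis
      have y0: "0 < y" using y x e by (smt (verit) divide_pos_pos)
      have "conv v k x \<le> ennreal (x / y) * 1" using scale[of y x] y y0 by simp
      also have "\<dots> \<le> ennreal (1 + e)" using y y0 e x by (simp add: ennreal_leI field_simps del: ennreal_plus)
      also have "\<dots> = 1 + ennreal e" using e by simp
      finally show "conv v k x \<le> 1 + ennreal e" .
    qed
    show "1 \<le> conv v k x"
    proof (rule ennreal_le_epsilon)
      fix e :: real assume e: "0 < e" and fin: "conv v k x < top"
      \<comment> \<open>Makes \<open>e'\<close> times the finite value \<open>conv v k x\<close> at
        most \<open>e\<close>; the summand 1 avoids division by 0.\<close>
      define e' where "e' = e / (enn2real (conv v k x) + 1)"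
      have e': "0 < e'" using e by (simp add: e'_def add_nonneg_pos)
      have "x < x * (1 + e')" using x e' by (simp add: field_simps)
      from AE_lborel_obtain[OF AE this] obtain y where y: "x < y" "y < x * (1 + e')" "conv v k y = indicator {0<..} y"
        by metis
      have "1 \<le> ennreal (y / x) * conv v k x" using scale[of x y] y x by simp
      also have "\<dots> \<le> ennreal (1 + e') * conv v k x" using y x
        by (intro mult_right_mono ennreal_leI) (auto simp: field_simps)
      also have "\<dots> = conv v k x + ennreal e' * conv v k x" using e' by (simp add: distrib_right)
      also have "ennreal e' * conv v k x \<le> ennreal e"
      proof -
        have "conv v k x = ennreal (enn2real (conv v k x))" using fin by simp
        moreover have "e' * enn2real (conv v k x) \<le> e"
        proof -
          have "e / (c + 1) * c \<le> e" if "0 \<le> c" for c :: real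
            using e that by (simp add: field_simps)
          then show ?thesis by (simp add: e'_def)
        qed
        ultimately show ?thesis using e'
          by (metis ennreal_leI ennreal_mult enn2real_nonneg less_imp_le)
      qed
      finally show "1 \<le> conv v k x + ennreal e" by (simp add: add_left_mono)
    qed
  qed
qed

section \<open>Functionals of nondecreasing right-continuous paths\<close>

text \<open>The deterministic part of \<open>subordinator\<close>, so that the functionals can be
  analysed for one fixed path without reference to a probability space.\<close>

definition subordinator_path :: "(real \<Rightarrow> real) \<Rightarrow> bool" where
  "subordinator_path w \<longleftrightarrow> w 0 = 0 \<and> mono_on {0..} w \<and> (\<forall>t\<ge>0. (w \<longlongrightarrow> w t) (at_right t))"

text \<open>The functionals below only use the countably many coordinates in \<open>\<rat> \<inter> {0..}\<close>, which makes
  them measurable on the product space.\<close>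

definition passage :: "(real \<Rightarrow> real) \<Rightarrow> real \<Rightarrow> ereal" where
  "passage w y = (INF q\<in>\<rat> \<inter> {0..}. if y < w q then ereal q else \<infinity>)"

definition undershoot :: "(real \<Rightarrow> real) \<Rightarrow> real \<Rightarrow> real" where
  "undershoot w y =
     enn2real (SUP q\<in>\<rat> \<inter> {0..}. if ereal q < passage w y then ennreal (w q) else 0)"

definition eval_path :: "real \<Rightarrow> (real \<Rightarrow> real) \<Rightarrow> real" where
  "eval_path t w = enn2real (INF q\<in>\<rat> \<inter> {0..}. if t < q then ennreal (w q) else \<infinity>)"

abbreviation path_space :: "(real \<Rightarrow> real) measure" where
  "path_space \<equiv> \<Pi>\<^sub>M t\<in>{0..}. borel"

lemma countable_nonneg_rats: "countable (\<rat> \<inter> {0::real..})"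
  using countable_rat by (rule countable_subset[rotated]) auto

lemma measurable_path_component:
  fixes q :: real
  assumes "q \<in> \<rat> \<inter> {0..}" "w \<in> N \<rightarrow>\<^sub>M path_space"
  shows "(\<lambda>x. w x q) \<in> borel_measurable N"
  by (rule measurable_compose[OF assms(2) measurable_component_singleton]) (use assms in auto)

lemma measurable_passage[measurable (raw)]:
  assumes w: "w \<in> N \<rightarrow>\<^sub>M path_space" and [measurable]: "y \<in> borel_measurable N"
  shows "(\<lambda>x. passage (w x) (y x)) \<in> borel_measurable N"
  unfolding passage_def
proof (rule borel_measurable_INF[OF countable_nonneg_rats])
  fix q :: real assume "q \<in> \<rat> \<inter> {0..}"
  from measurable_path_component[OF this w] have [measurable]: "(\<lambda>x. w x q) \<in> borel_measurable N" .
  show "(\<lambda>x. if y x < w x q then ereal q else \<infinity>) \<in> borel_measurable N" by measurable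
qed

lemma measurable_undershoot[measurable (raw)]:
  assumes w[measurable]: "w \<in> N \<rightarrow>\<^sub>M path_space" and [measurable]: "y \<in> borel_measurable N"
  shows "(\<lambda>x. undershoot (w x) (y x)) \<in> borel_measurable N"
proof -
  have "(\<lambda>x. SUP q\<in>\<rat> \<inter> {0..}. if ereal q < passage (w x) (y x) then ennreal (w x q) else 0) \<in> borel_measurable N"
  proof (rule borel_measurable_SUP[OF countable_nonneg_rats])
    fix q :: real assume "q \<in> \<rat> \<inter> {0..}"
    from measurable_path_component[OF this w] have [measurable]: "(\<lambda>x. w x q) \<in> borel_measurable N" .
    show "(\<lambda>x. if ereal q < passage (w x) (y x) then ennreal (w x q) else 0) \<in> borel_measurable N" by measurable
  qed
  then show ?thesis unfolding undershoot_def by measurable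
qed

lemma measurable_eval_path[measurable (raw)]:
  assumes w[measurable]: "w \<in> N \<rightarrow>\<^sub>M path_space" and [measurable]: "t \<in> borel_measurable N"
  shows "(\<lambda>x. eval_path (t x) (w x)) \<in> borel_measurable N"
proof -
  have "(\<lambda>x. INF q\<in>\<rat> \<inter> {0..}. if t x < q then ennreal (w x q) else \<infinity>) \<in> borel_measurable N"
  proof (rule borel_measurable_INF[OF countable_nonneg_rats])
    fix q :: real assume "q \<in> \<rat> \<inter> {0..}"
    from measurable_path_component[OF this w] have [measurable]: "(\<lambda>x. w x q) \<in> borel_measurable N" .
    show "(\<lambda>x. if t x < q then ennreal (w x q) else \<infinity>) \<in> borel_measurable N" by measurable
  qed
  then show ?thesis unfolding eval_path_def by measurable
qed

lemma Rats_between_ereal: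
  fixes t :: real
  assumes "0 \<le> t" "ereal t < a"
  obtains q where "q \<in> \<rat> \<inter> {0..}" "t < q" "ereal q < a"
proof -
  obtain r :: real where r: "t < r" "ereal r \<le> a"
    using assms by (cases a) (auto intro: that[of "t + 1"])
  obtain q where q: "q \<in> \<rat>" "t < q" "q < r"
    using Rats_dense_in_real[OF r(1)] by auto
  have "ereal q < a" using q r by (meson ereal_less_eq(3) less_le_trans less_ereal.simps(1))
  then show ?thesis using that[of q] q assms by auto
qed

lemma passage_nonneg: "0 \<le> passage w y"
  unfolding passage_def by (intro INF_greatest) auto

lemma passage_mono:
  assumes "y \<le> y'" shows "passage w y \<le> passage w y'"
  unfolding passage_def
proof (rule INF_mono)
  fix q :: real assume q: "q \<in> \<rat> \<inter> {0..}"
  show "\<exists>q'\<in>\<rat> \<inter> {0..}. (if y < w q' then ereal q' else \<infinity>) \<le> (if y' < w q then ereal q else \<infinity>)"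
    using assms q by (intro bexI[of _ q]) auto
qed

context
  fixes w :: "real \<Rightarrow> real"
  assumes w: "subordinator_path w"
begin

lemma path_mono: "0 \<le> s \<Longrightarrow> s \<le> t \<Longrightarrow> w s \<le> w t"
  using w by (auto simp: subordinator_path_def mono_on_def)

lemma path_nonneg: "0 \<le> t \<Longrightarrow> 0 \<le> w t"
  using path_mono[of 0 t] w by (simp add: subordinator_path_def)

lemma path_le_before_passage:
  assumes "0 \<le> t" "ereal t < passage w y"
  shows "w t \<le> y"
proof (rule ccontr)
  assume "\<not> w t \<le> y"
  obtain q where q: "q \<in> \<rat> \<inter> {0..}" "t < q" "ereal q < passage w y"
    using Rats_between_ereal[OF assms] .
  then have "y < w q" using path_mono[of t q] \<open>\<not> w t \<le> y\<close> assms by auto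
  then have "passage w y \<le> ereal q"
    unfolding passage_def using q by (intro INF_lower2[of q]) auto
  with q show False by simp
qed

lemma path_greater_after_passage:
  assumes "passage w y < ereal t"
  shows "y < w t"
proof -
  obtain q where q: "q \<in> \<rat> \<inter> {0..}" "(if y < w q then ereal q else \<infinity>) < ereal t"
    using assms unfolding passage_def INF_less_iff by auto
  then have "y < w q" "q < t" by (auto split: if_splits)
  then show ?thesis using path_mono[of q t] q by auto
qed

text \<open>By monotonicity a level exceeded at some time is exceeded at every later rational time,
  so the infimum over rational times is not larger.\<close>

lemma first_passage_eq_passage: "(INF t\<in>{t. 0 \<le> t \<and> y < w t}. ereal t) = passage w y"
proof (rule antisym)
  show "(INF t\<in>{t. 0 \<le> t \<and> y < w t}. ereal t) \<le> passage w y"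
    unfolding passage_def by (intro INF_greatest) (auto intro: INF_lower)
  show "passage w y \<le> (INF t\<in>{t. 0 \<le> t \<and> y < w t}. ereal t)"
  proof (intro INF_greatest)
    fix t assume t: "t \<in> {t. 0 \<le> t \<and> y < w t}"
    then show "passage w y \<le> ereal t"
      using path_le_before_passage[of t y] by (auto simp: not_less[symmetric])
  qed
qed

text \<open>Right-continuity at 0, where the path vanishes, keeps it below the level for a positive
  time.\<close>

lemma passage_pos:
  assumes "0 < y" shows "0 < passage w y"
proof -
  have "(w \<longlongrightarrow> 0) (at_right 0)" using w by (auto simp: subordinator_path_def)
  then have "\<forall>\<^sub>F t in at_right 0. w t < y"
    using assms by (rule order_tendstoD)
  then obtain b where b: "0 < b" "\<And>t. 0 < t \<Longrightarrow> t < b \<Longrightarrow> w t < y"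
    by (auto simp: eventually_at_right_field)
  have "ereal (b / 2) \<le> passage w y"
    using b(2)[of "b / 2"] b(1) path_greater_after_passage[of y "b / 2"] by (force simp: not_less[symmetric])
  then show ?thesis using b(1)
    by (metis ereal_less(2) half_gt_zero less_le_trans)
qed

text \<open>Only a weak inequality: the path may equal the level at time \<open>s\<close> and exceed
  it only afterwards. This is why grid values equal to the level are excluded later.\<close>

lemma path_at_passage_ge:
  assumes "passage w y = ereal s" shows "y \<le> w s"
proof -
  have s: "0 \<le> s" using passage_nonneg[of w y] assms by simp
  have "(w \<longlongrightarrow> w s) (at_right s)" using w s by (auto simp: subordinator_path_def)
  then show ?thesis
  proof (rule tendsto_lowerbound)
    show "\<forall>\<^sub>F t in at_right s. y \<le> w t"
      using eventually_at_right_less[of s]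
      by eventually_elim (use path_greater_after_passage[of y] assms in \<open>auto intro: less_imp_le\<close>)
  qed simp
qed

lemma undershoot_SUP:
  assumes "0 \<le> y"
  shows "ennreal (undershoot w y) = (SUP q\<in>\<rat> \<inter> {0..}. if ereal q < passage w y then ennreal (w q) else 0)"
    and "undershoot w y \<le> y"
proof -
  have le: "(SUP q\<in>\<rat> \<inter> {0..}. if ereal q < passage w y then ennreal (w q) else 0) \<le> ennreal y"
    by (intro SUP_least) (auto intro!: ennreal_leI path_le_before_passage)
  then show e: "ennreal (undershoot w y) = (SUP q\<in>\<rat> \<inter> {0..}. if ereal q < passage w y then ennreal (w q) else 0)"
    unfolding undershoot_def by (intro ennreal_enn2real le_less_trans[OF le]) simp
  show "undershoot w y \<le> y" using le assms unfolding e[symmetric] by simp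
qed

lemma undershoot_nonneg: "0 \<le> undershoot w y"
  by (simp add: undershoot_def)

lemma path_le_undershoot:
  assumes "0 \<le> y" "0 \<le> t" "ereal t < passage w y"
  shows "w t \<le> undershoot w y"
proof -
  obtain q where q: "q \<in> \<rat> \<inter> {0..}" "t < q" "ereal q < passage w y"
    using Rats_between_ereal[OF assms(2,3)] .
  have "ennreal (w q) \<le> ennreal (undershoot w y)"
    unfolding undershoot_SUP[OF assms(1)] using q by (intro SUP_upper2[of q]) auto
  then have "w q \<le> undershoot w y" by (simp add: undershoot_nonneg)
  then show ?thesis using path_mono[of t q] q assms by simp
qed

lemma undershoot_mono:
  assumes "0 \<le> y" "y \<le> y'" shows "undershoot w y \<le> undershoot w y'"
proof -
  have y': "0 \<le> y'" using assms by simp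
  have "ennreal (undershoot w y) \<le> ennreal (undershoot w y')"
    unfolding undershoot_SUP[OF assms(1)] undershoot_SUP[OF y']
  proof (rule SUP_mono)
    fix q :: real assume q: "q \<in> \<rat> \<inter> {0..}"
    show "\<exists>q'\<in>\<rat> \<inter> {0..}. (if ereal q < passage w y then ennreal (w q) else 0) \<le>
        (if ereal q' < passage w y' then ennreal (w q') else 0)"
      using q passage_mono[OF assms(2), of w] by (intro bexI[of _ q]) (auto dest: order.strict_trans2)
  qed
  then show ?thesis by (simp add: undershoot_nonneg)
qed

text \<open>Identifies the supremum over rational times before passage with the left limit that
  occurs in the recursion for the censored process.\<close>

lemma tendsto_undershoot:
  assumes "0 \<le> y" "passage w y = ereal s" "0 < s"
  shows "(w \<longlongrightarrow> undershoot w y) (at_left s)"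
proof (rule order_tendstoI)
  fix a assume a: "undershoot w y < a"
  have "\<forall>\<^sub>F t in at_left s. 0 < t \<and> t < s"
    using assms(3) by (auto simp: eventually_at_left_field)
  then show "\<forall>\<^sub>F t in at_left s. w t < a"
    
  proof eventually_elim
    case (elim t)
    then show ?case using path_le_undershoot[of y t] a assms by simp
  qed
next
  fix a assume a: "a < undershoot w y"
  show "\<forall>\<^sub>F t in at_left s. a < w t"
  proof (cases "a < 0")
    case True
    have "\<forall>\<^sub>F t in at_left s. 0 < t \<and> t < s"
      using assms(3) by (auto simp: eventually_at_left_field)
    then show ?thesis
    proof eventually_elim
      case (elim t)
      then show ?case using path_nonneg[of t] True by simp
    qed
  next
    case False
    then have "ennreal a < ennreal (undershoot w y)" using a by (simp add: ennreal_lessI)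
    then obtain q where q: "q \<in> \<rat> \<inter> {0..}" "ennreal a < (if ereal q < passage w y then ennreal (w q) else 0)"
      unfolding undershoot_SUP[OF assms(1)] less_SUP_iff by auto
    then have q': "q < s" "a < w q" "0 \<le> q"
      using False assms by (auto split: if_splits simp: ennreal_less_iff)
    have "\<forall>\<^sub>F t in at_left s. q < t \<and> t < s"
      using q'(1) by (auto simp: eventually_at_left_field)
    then show ?thesis
    proof eventually_elim
      case (elim t)
      then show ?case using path_mono[of q t] q' by simp
    qed
  qed
qed

text \<open>By right-continuity the infimum over later rational times is the value itself. In
  contrast to a coordinate map, this form is jointly measurable in time and path.\<close>

lemma eval_path_eq:
  assumes "0 \<le> t" shows "eval_path t w = w t"
proof -
  have "(INF q\<in>\<rat> \<inter> {0..}. if t < q then ennreal (w q) else \<infinity>) = ennreal (w t)"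
  proof (rule antisym)
    show "ennreal (w t) \<le> (INF q\<in>\<rat> \<inter> {0..}. if t < q then ennreal (w q) else \<infinity>)"
      using assms by (intro INF_greatest) (auto intro!: ennreal_leI path_mono)
    show "(INF q\<in>\<rat> \<inter> {0..}. if t < q then ennreal (w q) else \<infinity>) \<le> ennreal (w t)"
    proof (rule ennreal_le_epsilon)
      fix e :: real assume e: "0 < e"
      have "(w \<longlongrightarrow> w t) (at_right t)" using w assms by (auto simp: subordinator_path_def)
      then have "\<forall>\<^sub>F s in at_right t. w s < w t + e"
        using e by (intro order_tendstoD) auto
      then obtain b where b: "t < b" "\<And>s. t < s \<Longrightarrow> s < b \<Longrightarrow> w s < w t + e"
        by (auto simp: eventually_at_right_field)
      obtain q where q: "q \<in> \<rat> \<inter> {0..}" "t < q" "ereal q < ereal b"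
        using Rats_between_ereal[of t "ereal b"] assms b(1) by auto
      have "(INF q\<in>\<rat> \<inter> {0..}. if t < q then ennreal (w q) else \<infinity>) \<le> ennreal (w q)"
        using q by (intro INF_lower2[of q]) auto
      also have "\<dots> \<le> ennreal (w t + e)" using b(2)[of q] q by (intro ennreal_leI) auto
      also have "\<dots> = ennreal (w t) + ennreal e" using e path_nonneg[OF assms] by simp
      finally show "(INF q\<in>\<rat> \<inter> {0..}. if t < q then ennreal (w q) else \<infinity>) \<le> ennreal (w t) + ennreal e" .
    qed
  qed
  then show ?thesis using path_nonneg[OF assms] by (simp add: eval_path_def)
qed

text \<open>\<open>j\<close> is the index of the last grid point strictly before the passage time
  \<open>s\<close>. If the path took the value \<open>y\<close> at a grid point, for instance at
  \<open>s\<close> itself, the cell in which \<open>y\<close> is crossed could be a later one;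
  \<open>avoid\<close> rules this out.\<close>

lemma grid_index_before_passage:
  fixes h :: real
  assumes y: "0 < y" and s: "passage w y = ereal s" and h: "0 < h"
    and avoid: "\<And>i::nat. w (real i * h) \<noteq> y"
  defines "j \<equiv> nat (\<lceil>s / h\<rceil> - 1)"
  shows "real j * h < s" "s \<le> real (Suc j) * h"
    "w (real i * h) \<le> y \<and> y < w (real (Suc i) * h) \<longleftrightarrow> i = j"
proof -
  have s0: "0 < s" using passage_pos[OF y] s by simp
  have "0 < s / h" using s0 h by simp
  then have j: "real j = of_int \<lceil>s / h\<rceil> - 1" unfolding j_def by simp
  have "real j < s / h" "s / h \<le> real (Suc j)" using j by linarith+
  then show j1: "real j * h < s" and j2: "s \<le> real (Suc j) * h"
    using h by (simp_all add: field_simps)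
  show "w (real i * h) \<le> y \<and> y < w (real (Suc i) * h) \<longleftrightarrow> i = j"
  proof
    assume "i = j"
    have "w (real j * h) \<le> y" using path_le_before_passage[of "real j * h" y] j1 h s by simp
    moreover have "y \<le> w (real (Suc j) * h)"
      using path_at_passage_ge[OF s] path_mono[of s "real (Suc j) * h"] s0 j2 by simp
    ultimately show "w (real i * h) \<le> y \<and> y < w (real (Suc i) * h)"
      using avoid[of "Suc j"] \<open>i = j\<close> by (auto simp: less_le)
  next
    assume i: "w (real i * h) \<le> y \<and> y < w (real (Suc i) * h)"
    have "real i * h < s"
    proof (rule ccontr)
      assume "\<not> real i * h < s"
      then have "y \<le> w (real i * h)"
        using path_at_passage_ge[OF s] path_mono[of s "real i * h"] s0 by simp
      with i avoid[of i] show False by auto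
    qed
    moreover have "s \<le> real (Suc i) * h"
    proof (rule ccontr)
      assume "\<not> s \<le> real (Suc i) * h"
      then have "w (real (Suc i) * h) \<le> y"
        using path_le_before_passage[of "real (Suc i) * h" y] h s by simp
      with i show False by simp
    qed
    ultimately have "real i < s / h" "s / h \<le> real i + 1" using h by (simp_all add: field_simps)
    then have "\<lceil>s / h\<rceil> = int i + 1" by (intro ceiling_unique) auto
    then show "i = j" by (simp add: j_def)
  qed
qed

text \<open>The last grid points before \<open>s\<close> approach it strictly from the left, so the
  path along them converges to the left limit at \<open>s\<close> and not to
  \<open>w s\<close>.\<close>

lemma tendsto_grid_before_passage:
  assumes y: "0 < y" and s: "passage w y = ereal s"
  shows "(\<lambda>n. real (nat (\<lceil>s / (1 / real (Suc n))\<rceil> - 1)) * (1 / real (Suc n))) \<longlonglongrightarrow> s" (is "?t \<longlonglongrightarrow> s")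
    and "(\<lambda>n. w (real (nat (\<lceil>s / (1 / real (Suc n))\<rceil> - 1)) * (1 / real (Suc n)))) \<longlonglongrightarrow> undershoot w y"
proof -
  have s0: "0 < s" using passage_pos[OF y] s by simp
  have b: "?t n < s" "s - 1 / real (Suc n) \<le> ?t n" for n
  proof -
    have "0 < s / (1 / real (Suc n))" using s0 by simp
    then have j: "real (nat (\<lceil>s / (1 / real (Suc n))\<rceil> - 1)) = of_int \<lceil>s / (1 / real (Suc n))\<rceil> - 1"
      by simp
    define J where "J = real (nat (\<lceil>s / (1 / real (Suc n))\<rceil> - 1))"
    have "J < s * real (Suc n)" "s * real (Suc n) - 1 \<le> J"
      unfolding J_def j by (simp_all del: of_nat_Suc) linarith+
    moreover have "s - 1 / real (Suc n) = (s * real (Suc n) - 1) * (1 / real (Suc n))"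
      by (simp add: field_simps)
    ultimately have "J * (1 / real (Suc n)) < s" "s - 1 / real (Suc n) \<le> J * (1 / real (Suc n))"
      by (simp_all add: pos_divide_less_eq divide_right_mono del: of_nat_Suc)
    then show "?t n < s" "s - 1 / real (Suc n) \<le> ?t n"
      by (simp_all only: J_def)
  qed
  have "(\<lambda>n. s - 1 / real (Suc n)) \<longlonglongrightarrow> s - 0"
    by (intro tendsto_intros LIMSEQ_Suc[OF lim_1_over_n])
  then show t: "?t \<longlonglongrightarrow> s"
    by (intro tendsto_sandwich[OF _ _ _ tendsto_const, of _ ?t]) (use b in \<open>auto intro!: always_eventually less_imp_le simp del: of_nat_Suc\<close>)
  have "filterlim ?t (at_left s) sequentially"
    unfolding filterlim_at using b(1) t by (auto intro!: always_eventually simp: less_le)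
  from filterlim_compose[OF tendsto_undershoot[OF less_imp_le[OF y] s s0] this]
  show "(\<lambda>n. w (?t n)) \<longlonglongrightarrow> undershoot w y" .
qed

end

section \<open>Limits and integrals for grids of vanishing mesh\<close>

lemma tendsto_exp_ratio:
  fixes A B :: real
  assumes "0 < A" "0 < B"
  shows "(\<lambda>n. (1 - exp (- (1 / real (Suc n)) * A)) / (1 - exp (- (1 / real (Suc n)) * B))) \<longlonglongrightarrow> A / B"
proof -
  have *: "(\<lambda>n. (1 - exp (- (1 / real (Suc n)) * C)) * real (Suc n)) \<longlonglongrightarrow> C" if "0 < C" for C
    using that by real_asymp
  have "(\<lambda>n. ((1 - exp (- (1 / real (Suc n)) * A)) * real (Suc n)) /
      ((1 - exp (- (1 / real (Suc n)) * B)) * real (Suc n))) \<longlonglongrightarrow> A / B"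
    using assms by (intro tendsto_divide *) auto
  then show ?thesis by (simp del: of_nat_Suc)
qed

lemma nn_integral_exp_Ico:
  assumes q: "0 < q" and "0 \<le> u" "u \<le> r"
  shows "(\<integral>\<^sup>+x. indicator {0<..} x * ennreal (exp (- q * x)) * indicator {u..<r} x \<partial>lborel) =
    ennreal ((exp (- q * u) - exp (- q * r)) / q)"
proof -
  have "(\<integral>\<^sup>+x. indicator {0<..} x * ennreal (exp (- q * x)) * indicator {u..<r} x \<partial>lborel) =
      (\<integral>\<^sup>+x. ennreal (exp (- q * x)) * indicator {u..r} x \<partial>lborel)"
    by (intro nn_integral_cong_AE, use AE_lborel_singleton[of 0] AE_lborel_singleton[of r] in eventually_elim)
       (use assms in \<open>auto simp: indicator_def\<close>)
  also have "\<dots> = ennreal (- exp (- q * r) / q - - exp (- q * u) / q)"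
    using assms by (intro nn_integral_FTC_Icc) (auto intro!: derivative_eq_intros)
  finally show ?thesis by (simp add: diff_divide_distrib)
qed

section \<open>The potential measure of a subordinator\<close>

locale subordinator_process = prob_space M for M :: "'w measure" +
  fixes f :: "real \<Rightarrow> real" and S :: "real \<Rightarrow> 'w \<Rightarrow> real"
  assumes subordinator: "subordinator M f S"
    and f_pos: "\<And>q. 0 < q \<Longrightarrow> 0 < f q"
begin

definition path :: "'w \<Rightarrow> real \<Rightarrow> real" where
  "path \<omega> = (\<lambda>t\<in>{0..}. S t \<omega>)"

lemma measurable_S: "0 \<le> t \<Longrightarrow> S t \<in> borel_measurable M"
  using subordinator by (auto simp: subordinator_def)

lemma measurable_path[measurable]: "path \<in> M \<rightarrow>\<^sub>M path_space"
  unfolding path_def by (rule measurable_restrict) (auto intro: measurable_S)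

lemma subordinator_path_path:
  assumes "\<omega> \<in> space M" shows "subordinator_path (path \<omega>)"
  unfolding subordinator_path_def
proof (intro conjI allI impI)
  note S = subordinator[unfolded subordinator_def]
  show "path \<omega> 0 = 0" using S assms by (simp add: path_def)
  show "mono_on {0..} (path \<omega>)"
    using S assms by (auto simp: path_def mono_on_def)
  fix t :: real assume t: "0 \<le> t"
  then have "((\<lambda>s. S s \<omega>) \<longlongrightarrow> S t \<omega>) (at_right t)"
    using S assms by (auto simp: continuous_within)
  moreover have "\<forall>\<^sub>F s in at_right t. S s \<omega> = path \<omega> s"
    using eventually_at_right_less[of t] by eventually_elim (use t in \<open>simp add: path_def\<close>)
  ultimately show "(path \<omega> \<longlongrightarrow> path \<omega> t) (at_right t)"
    using t by (subst tendsto_cong[symmetric]) (auto simp: path_def)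
qed

lemma eval_path_path: "\<omega> \<in> space M \<Longrightarrow> 0 \<le> t \<Longrightarrow> eval_path t (path \<omega>) = S t \<omega>"
  using eval_path_eq[OF subordinator_path_path, of \<omega> t] by (simp add: path_def)

lemma S_nonneg: "\<omega> \<in> space M \<Longrightarrow> 0 \<le> t \<Longrightarrow> 0 \<le> S t \<omega>"
  using path_nonneg[OF subordinator_path_path, of \<omega> t] by (simp add: path_def)

lemma S_mono: "\<omega> \<in> space M \<Longrightarrow> 0 \<le> s \<Longrightarrow> s \<le> t \<Longrightarrow> S s \<omega> \<le> S t \<omega>"
  using path_mono[OF subordinator_path_path, of \<omega> s t] by (simp add: path_def)

lemma integrable_exp_S:
  assumes "0 \<le> t" "0 \<le> q" shows "integrable M (\<lambda>\<omega>. exp (- q * S t \<omega>))"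
proof (rule integrable_const_bound[where B=1])
  note [measurable] = measurable_S[OF assms(1)]
  show "(\<lambda>\<omega>. exp (- q * S t \<omega>)) \<in> borel_measurable M" by measurable
  show "AE \<omega> in M. norm (exp (- q * S t \<omega>)) \<le> 1"
    using S_nonneg assms by (auto intro!: AE_I2)
qed

lemma expectation_exp_S:
  assumes "0 \<le> t" "0 < q" shows "expectation (\<lambda>\<omega>. exp (- q * S t \<omega>)) = exp (- t * f q)"
  using subordinator assms by (auto simp: subordinator_def)

lemma nn_integral_exp_S:
  assumes "0 \<le> t" "0 < q" shows "(\<integral>\<^sup>+\<omega>. ennreal (exp (- q * S t \<omega>)) \<partial>M) = ennreal (exp (- t * f q))"
  using integrable_exp_S[of t q] expectation_exp_S[of t q] assms
  by (subst nn_integral_eq_integral) auto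

text \<open>If the level \<open>m\<close> is never exceeded, then \<open>S n \<le> m\<close> for
  every \<open>n\<close>, which by Markov's inequality has probability at most
  \<open>exp m * exp (- n * f 1)\<close>; let \<open>n\<close> tend to infinity. Integer levels
  suffice by monotonicity and produce one null set for all levels.\<close>

lemma AE_passage_finite: "AE \<omega> in M. \<forall>y. passage (path \<omega>) y < \<infinity>"
proof -
  have *: "AE \<omega> in M. passage (path \<omega>) (real m) < \<infinity>" for m
  proof -
    have "emeasure M {\<omega> \<in> space M. passage (path \<omega>) (real m) = \<infinity>} \<le> ennreal (exp (real m)) * ennreal (exp (- real n * f 1))" for n
    proof -
      note [measurable] = measurable_S[of "real n"]
      have "emeasure M {\<omega> \<in> space M. passage (path \<omega>) (real m) = \<infinity>} =
          (\<integral>\<^sup>+\<omega>. indicator {\<omega> \<in> space M. passage (path \<omega>) (real m) = \<infinity>} \<omega> \<partial>M)"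
        by (rule nn_integral_indicator[symmetric]) measurable
      also have "\<dots> \<le> (\<integral>\<^sup>+\<omega>. ennreal (exp (real m)) * ennreal (exp (- 1 * S (real n) \<omega>)) \<partial>M)"
      proof (rule nn_integral_mono)
        fix \<omega> assume \<omega>: "\<omega> \<in> space M"
        show "indicator {\<omega> \<in> space M. passage (path \<omega>) (real m) = \<infinity>} \<omega> \<le>
            ennreal (exp (real m)) * ennreal (exp (- 1 * S (real n) \<omega>))"
        proof (cases "passage (path \<omega>) (real m) = \<infinity>")
          case True
          then have "path \<omega> (real n) \<le> real m"
            by (intro path_le_before_passage[OF subordinator_path_path[OF \<omega>]]) auto
          then have "S (real n) \<omega> \<le> real m" by (simp add: path_def)
          then have "1 \<le> ennreal (exp (real m) * exp (- 1 * S (real n) \<omega>))"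
            by (simp add: exp_add[symmetric])
          then show ?thesis using True \<omega> by (simp add: ennreal_mult)
        qed simp
      qed
      also have "\<dots> = ennreal (exp (real m)) * ennreal (exp (- real n * f 1))"
        by (subst nn_integral_cmult) (simp_all only: nn_integral_exp_S, measurable)
      finally show ?thesis .
    qed
    moreover have "(\<lambda>n. ennreal (exp (real m)) * ennreal (exp (- real n * f 1))) \<longlonglongrightarrow> ennreal 0"
      unfolding ennreal_mult[symmetric, OF exp_ge_zero exp_ge_zero]
      using f_pos[of 1] by (intro tendsto_ennrealI) real_asymp
    ultimately have "emeasure M {\<omega> \<in> space M. passage (path \<omega>) (real m) = \<infinity>} \<le> ennreal 0"
      by (intro LIMSEQ_le_const) auto
    then show ?thesis
      by (intro AE_I[of _ _ "{\<omega> \<in> space M. passage (path \<omega>) (real m) = \<infinity>}"]) auto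
  qed
  have "AE \<omega> in M. \<forall>m. passage (path \<omega>) (real m) < \<infinity>"
    unfolding AE_all_countable using * by blast
  then show ?thesis
  proof eventually_elim
    case (elim \<omega>)
    show ?case
    proof
      fix y
      obtain m where "y \<le> real m" using real_arch_simple by blast
      then show "passage (path \<omega>) y < \<infinity>"
        using passage_mono[of y "real m" "path \<omega>"] elim le_less_trans by blast
    qed
  qed
qed

text \<open>The image under the subordinator of \<open>exp (- l * t) dt\<close> times the
  probability measure. \<open>eval_path\<close> stands in for \<open>S t\<close> because it is
  jointly measurable in time and \<omega>.\<close>

definition potential :: "real \<Rightarrow> real measure" where
  "potential l = distr (density (lborel \<Otimes>\<^sub>M M) (\<lambda>(t, \<omega>). indicator {0<..} t * ennreal (exp (- l * t)))) borel
     (\<lambda>(t, \<omega>). eval_path t (path \<omega>))"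

lemma nn_integral_potential:
  assumes [measurable]: "\<phi> \<in> borel_measurable borel"
  shows "(\<integral>\<^sup>+z. \<phi> z \<partial>potential l) =
    (\<integral>\<^sup>+t. \<integral>\<^sup>+\<omega>. indicator {0<..} t * ennreal (exp (- l * t)) * \<phi> (eval_path t (path \<omega>)) \<partial>M \<partial>lborel)"
proof -
  have 1: "fst \<in> borel_measurable (lborel \<Otimes>\<^sub>M M)"
    using measurable_fst[of "lborel :: real measure" M] by simp
  have [measurable]: "(\<lambda>x. eval_path (fst x) (path (snd x))) \<in> borel_measurable (lborel \<Otimes>\<^sub>M M)"
    by (rule measurable_eval_path[OF measurable_compose[OF measurable_snd measurable_path] 1])
  let ?d = "\<lambda>x. indicator {0<..} (fst x) * ennreal (exp (- l * fst x))"
  have [measurable]: "fst \<in> borel_measurable (lborel \<Otimes>\<^sub>M M)" by (rule 1)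
  have d: "?d \<in> borel_measurable (lborel \<Otimes>\<^sub>M M)" by measurable
  have "(\<integral>\<^sup>+z. \<phi> z \<partial>potential l) =
      (\<integral>\<^sup>+x. \<phi> (eval_path (fst x) (path (snd x))) \<partial>density (lborel \<Otimes>\<^sub>M M) ?d)"
    unfolding potential_def split_beta' by (rule nn_integral_distr) simp_all
  also have "\<dots> = (\<integral>\<^sup>+x. ?d x * \<phi> (eval_path (fst x) (path (snd x))) \<partial>(lborel \<Otimes>\<^sub>M M))"
    by (rule nn_integral_density[OF d]) measurable
  also have "\<dots> = (\<integral>\<^sup>+t. \<integral>\<^sup>+\<omega>. ?d (t, \<omega>) * \<phi> (eval_path (fst (t, \<omega>)) (path (snd (t, \<omega>)))) \<partial>M \<partial>lborel)"
    by (rule nn_integral_fst[symmetric]) measurable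
  finally show ?thesis by simp
qed

lemma laplace_potential:
  assumes l: "0 \<le> l" and q: "0 < q"
  shows "(\<integral>\<^sup>+z. ennreal (exp (- q * z)) \<partial>potential l) = ennreal (1 / (l + f q))"
proof -
  have "(\<integral>\<^sup>+z. ennreal (exp (- q * z)) \<partial>potential l) =
      (\<integral>\<^sup>+t. indicator {0<..} t * ennreal (exp (- (l + f q) * t)) \<partial>lborel)"
  proof (subst nn_integral_potential, simp, rule nn_integral_cong)
    fix t :: real
    show "(\<integral>\<^sup>+\<omega>. indicator {0<..} t * ennreal (exp (- l * t)) * ennreal (exp (- q * eval_path t (path \<omega>))) \<partial>M) =
        indicator {0<..} t * ennreal (exp (- (l + f q) * t))"
    proof (cases "0 < t")
      case True
      have "(\<integral>\<^sup>+\<omega>. indicator {0<..} t * ennreal (exp (- l * t)) * ennreal (exp (- q * eval_path t (path \<omega>))) \<partial>M) =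
          indicator {0<..} t * ennreal (exp (- l * t)) * (\<integral>\<^sup>+\<omega>. ennreal (exp (- q * eval_path t (path \<omega>))) \<partial>M)"
        by (rule nn_integral_cmult) measurable
      also have "(\<integral>\<^sup>+\<omega>. ennreal (exp (- q * eval_path t (path \<omega>))) \<partial>M) = (\<integral>\<^sup>+\<omega>. ennreal (exp (- q * S t \<omega>)) \<partial>M)"
        using True by (intro nn_integral_cong) (simp add: eval_path_path)
      also have "\<dots> = ennreal (exp (- t * f q))" using True q by (intro nn_integral_exp_S) auto
      finally show ?thesis using True
        by (simp add: ennreal_mult[symmetric] exp_add[symmetric] algebra_simps)
    qed simp
  qed
  also have "\<dots> = ennreal (1 / (l + f q))"
    using l f_pos[OF q] by (intro nn_integral_exp_Ioi) auto
  finally show ?thesis .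
qed

lemma sets_potential[measurable_cong, simp]: "sets (potential l) = sets borel"
  by (simp add: potential_def)

lemma emeasure_potential:
  assumes "A \<in> sets borel"
  shows "emeasure (potential l) A =
    (\<integral>\<^sup>+t. \<integral>\<^sup>+\<omega>. indicator {0<..} t * ennreal (exp (- l * t)) * indicator A (eval_path t (path \<omega>)) \<partial>M \<partial>lborel)"
  using assms nn_integral_potential[of "indicator A" l] by simp

lemma eval_path_nonneg: "0 \<le> eval_path t w"
  by (simp add: eval_path_def)

lemma emeasure_potential_neg: "emeasure (potential l) {..<0} = 0"
proof -
  have "indicator {..<0} (eval_path t w) = (0 :: ennreal)" for t w
    using eval_path_nonneg[of t w] by (simp add: indicator_def)
  then show ?thesis by (simp add: emeasure_potential)
qed

text \<open>Discounting only lowers the weight. Through this domination all potential measures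
  inherit absolute continuity from the one of rate 0.\<close>

lemma potential_le:
  assumes "0 \<le> l" "A \<in> sets borel" shows "emeasure (potential l) A \<le> emeasure (potential 0) A"
  unfolding emeasure_potential[OF assms(2)]
  by (intro nn_integral_mono mult_right_mono) (use assms in \<open>auto simp: indicator_def\<close>)

end

section \<open>Resolvent kernels\<close>

text \<open>\<open>v\<close> and \<open>k\<close> stand for the tails of the Levy measures of
  \<open>f\<close> and of its conjugate, extended by 0. \<open>v_SUP\<close> is right-continuity of
  the antitone \<open>v\<close>, and \<open>sonine\<close> is assumed at every point because single
  levels matter later.\<close>

locale sonine_kernels =
  fixes f :: "real \<Rightarrow> real" and v k :: "real \<Rightarrow> ennreal"
  assumes f_pos': "\<And>q. 0 < q \<Longrightarrow> 0 < f q"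
    and measurable_v[measurable]: "v \<in> borel_measurable borel"
    and measurable_k[measurable]: "k \<in> borel_measurable borel"
    and v_nonpos: "\<And>z. z \<le> 0 \<Longrightarrow> v z = 0" and k_nonpos: "\<And>z. z \<le> 0 \<Longrightarrow> k z = 0"
    and v_antimono: "\<And>x y. 0 < x \<Longrightarrow> x \<le> y \<Longrightarrow> v y \<le> v x"
    and v_SUP: "\<And>x. 0 < x \<Longrightarrow> v x = (SUP n. v (x + 1 / real (Suc n)))"
    and v_finite: "\<And>z. v z < \<infinity>"
    and k_finite: "\<And>z. k z < \<infinity>"
    and laplace_v: "\<And>q. 0 < q \<Longrightarrow> (\<integral>\<^sup>+x. ennreal (exp (- q * x)) * v x \<partial>lborel) = ennreal (f q / q)"
    and laplace_k: "\<And>q. 0 < q \<Longrightarrow> (\<integral>\<^sup>+x. ennreal (exp (- q * x)) * k x \<partial>lborel) = ennreal (1 / f q)"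
    and sonine: "\<And>x. 0 < x \<Longrightarrow> conv v k x = 1"

locale resolvent_kernel = sonine_kernels +
  fixes l :: real and kl :: "real \<Rightarrow> ennreal"
  assumes l_nonneg: "0 \<le> l"
    and measurable_kl[measurable]: "kl \<in> borel_measurable borel"
    and kl_nonpos: "\<And>z. z \<le> 0 \<Longrightarrow> kl z = 0"
    and laplace_kl: "\<And>q. 0 < q \<Longrightarrow> (\<integral>\<^sup>+x. ennreal (exp (- q * x)) * kl x \<partial>lborel) = ennreal (1 / (l + f q))"
begin

text \<open>On the transform side this is \<open>1 / f = 1 / (l + f) + l / ((l + f) * f)\<close>.
  All terms being nonnegative, it also yields \<open>kl \<le> k\<close> almost everywhere.\<close>

lemma resolvent_identity_AE: "AE z in lborel. k z = kl z + ennreal l * conv kl k z"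
proof (rule AE_eq_laplace)
  fix q :: real assume q: "0 < q"
  have "(\<integral>\<^sup>+z. ennreal (exp (- q * z)) * (kl z + ennreal l * conv kl k z) \<partial>lborel) =
      (\<integral>\<^sup>+z. ennreal (exp (- q * z)) * kl z \<partial>lborel) + ennreal l * (\<integral>\<^sup>+z. ennreal (exp (- q * z)) * conv kl k z \<partial>lborel)"
    by (simp add: distrib_left nn_integral_add nn_integral_cmult[symmetric] mult_ac)
  also have "\<dots> = ennreal (1 / (l + f q)) + ennreal l * (ennreal (1 / (l + f q)) * ennreal (1 / f q))"
    by (simp only: laplace_conv[OF measurable_kl measurable_k] laplace_kl[OF q] laplace_k[OF q])
  also have "\<dots> = ennreal (1 / (l + f q) + l * (1 / (l + f q) * (1 / f q)))"
    using l_nonneg f_pos'[OF q] by (simp add: ennreal_mult[symmetric] ennreal_plus[symmetric] del: ennreal_plus)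
  also have "1 / (l + f q) + l * (1 / (l + f q) * (1 / f q)) = 1 / f q"
    using l_nonneg f_pos'[OF q] by (simp add: divide_simps add_nonneg_pos)
  finally show "(\<integral>\<^sup>+z. ennreal (exp (- q * z)) * k z \<partial>lborel) =
      (\<integral>\<^sup>+z. ennreal (exp (- q * z)) * (kl z + ennreal l * conv kl k z) \<partial>lborel)"
    using laplace_k[OF q] by simp
  show "(\<integral>\<^sup>+z. ennreal (exp (- q * z)) * k z \<partial>lborel) < \<infinity>"
    by (simp only: laplace_k[OF q]) simp
qed (simp_all add: k_nonpos kl_nonpos conv_nonpos)

lemma kl_le_k: "AE z in lborel. kl z \<le> k z"
  using resolvent_identity_AE by eventually_elim simp

lemma conv_resolvent:
  assumes [measurable]: "\<psi> \<in> borel_measurable borel"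
  shows "conv k \<psi> x = conv kl \<psi> x + ennreal l * conv kl (conv k \<psi>) x"
proof -
  have "conv k \<psi> x = conv (\<lambda>z. kl z + ennreal l * conv kl k z) \<psi> x"
    by (rule conv_cong_AE_left[OF resolvent_identity_AE])
  also have "\<dots> = conv kl \<psi> x + ennreal l * conv (conv kl k) \<psi> x"
    by (subst conv_add_left) (simp_all add: conv_cmult_left)
  finally show ?thesis by (simp add: conv_assoc)
qed

end

lemma (in sonine_kernels) resolvent_kernel_zero: "resolvent_kernel f v k 0 k"
  by unfold_locales (simp_all add: k_nonpos laplace_k[unfolded mult_minus_left])

text \<open>The kernel is a density of the \<open>l\<close>-potential measure. That measure is
  dominated by the potential of rate 0, which has density \<open>k\<close> by uniqueness of Laplace
  transforms, so Radon-Nikodym applies.\<close>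

lemma (in sonine_kernels) resolvent_kernel_exists:
  assumes "subordinator_process M f S" and l: "0 \<le> l"
  obtains kl where "resolvent_kernel f v k l kl"
proof -
  interpret S: subordinator_process M f S by fact
  have U0: "S.potential 0 = density lborel k"
  proof (rule measure_eqI_laplace)
    show "emeasure (density lborel k) {..<0} = 0"
      using k_nonpos by (auto simp: emeasure_density indicator_def intro!: nn_integral_0_iff_AE[THEN iffD2] AE_I2)
    fix q :: real assume q: "0 < q"
    have "(\<integral>\<^sup>+z. ennreal (exp (- q * z)) \<partial>density lborel k) = (\<integral>\<^sup>+z. ennreal (exp (- q * z)) * k z \<partial>lborel)"
      by (subst nn_integral_density, simp_all) (simp only: mult.commute)
    then show "(\<integral>\<^sup>+z. ennreal (exp (- q * z)) \<partial>S.potential 0) = (\<integral>\<^sup>+z. ennreal (exp (- q * z)) \<partial>density lborel k)"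
      by (simp only: laplace_k[OF q] S.laplace_potential[OF order_refl q]) simp
    show "(\<integral>\<^sup>+z. ennreal (exp (- q * z)) \<partial>S.potential 0) < \<infinity>"
      by (simp only: S.laplace_potential[OF order_refl q]) simp
  next
    show "sets (S.potential 0) = sets borel" by (rule S.sets_potential)
    show "sets (density lborel k) = sets borel" by simp
    show "emeasure (S.potential 0) {..<0} = 0" by (rule S.emeasure_potential_neg)
  qed
  have ac: "absolutely_continuous lborel (S.potential l)"
    unfolding absolutely_continuous_def
  proof
    fix N assume N: "N \<in> null_sets (lborel :: real measure)"
    then have "N \<in> null_sets (density lborel k)"
      using absolutely_continuousI_density[of k lborel] by (auto simp: absolutely_continuous_def)
    then have "emeasure (S.potential 0) N = 0" by (simp add: U0 null_setsD1)
    then have "emeasure (S.potential l) N = 0"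
      using S.potential_le[OF l, of N] N by (simp add: null_sets_def)
    then show "N \<in> null_sets (S.potential l)" using N by (auto simp: null_sets_def)
  qed
  obtain h where h[measurable]: "h \<in> borel_measurable borel" and U: "density lborel h = S.potential l"
    using sigma_finite_measure.Radon_Nikodym[OF sigma_finite_lborel ac] by auto
  have "emeasure (S.potential l) {..0} \<le> emeasure (density lborel k) {..0}"
    using S.potential_le[OF l, of "{..0}"] by (simp add: U0)
  also have "\<dots> = 0"
    using k_nonpos by (auto simp: emeasure_density indicator_def intro!: nn_integral_0_iff_AE[THEN iffD2] AE_I2)
  finally have pos: "AE z in S.potential l. 0 < z"
    by (intro AE_I[of _ _ "{..0}"]) auto
  \<comment> \<open>The density is determined up to null sets only. The cut-off makes it vanish at
    every nonpositive argument, where the potential measure has no mass.\<close>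
  have "resolvent_kernel f v k l (\<lambda>z. h z * indicator {0<..} z)"
  proof (intro resolvent_kernel.intro resolvent_kernel_axioms.intro sonine_kernels_axioms l)
    fix q :: real assume q: "0 < q"
    have "(\<integral>\<^sup>+x. ennreal (exp (- q * x)) * (h x * indicator {0<..} x) \<partial>lborel) =
        (\<integral>\<^sup>+x. ennreal (exp (- q * x)) * indicator {0<..} x \<partial>density lborel h)"
      by (subst nn_integral_density) (simp_all add: mult_ac)
    also have "\<dots> = (\<integral>\<^sup>+x. ennreal (exp (- q * x)) \<partial>S.potential l)"
      unfolding U by (rule nn_integral_cong_AE) (use pos in eventually_elim, simp)
    finally show "(\<integral>\<^sup>+x. ennreal (exp (- q * x)) * (h x * indicator {0<..} x) \<partial>lborel) = ennreal (1 / (l + f q))"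
      using S.laplace_potential[OF l q] by simp
  qed simp_all
  then show thesis by (rule that)
qed

section \<open>Discount factors and occupation integrals\<close>

lemma discount_nonneg: "0 \<le> discount l \<tau>"
  by (simp add: discount_def)

lemma discount_le_1: "0 \<le> l \<Longrightarrow> 0 \<le> \<tau> \<Longrightarrow> discount l \<tau> \<le> 1"
  by (cases \<tau>) (auto simp: discount_def)

lemma discount_antimono:
  assumes "0 \<le> l" "0 \<le> \<tau>" "\<tau> \<le> \<tau>'"
  shows "discount l \<tau>' \<le> discount l \<tau>"
  using assms by (cases \<tau>; cases \<tau>') (auto simp: discount_def intro!: mult_left_mono)

lemma borel_measurable_discount[measurable]: "discount l \<in> borel_measurable borel"
  unfolding discount_def[abs_def] by measurable

text \<open>Discounted time integral of \<phi> along one segment of the censored process, started at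
  \<open>y\<close>, until the moment at which it would jump below 0.\<close>

definition occupation :: "real \<Rightarrow> (real \<Rightarrow> ennreal) \<Rightarrow> (real \<Rightarrow> real) \<Rightarrow> real \<Rightarrow> ennreal" where
  "occupation l \<phi> w y = (\<integral>\<^sup>+t. indicator {0..} t * indicator {..<passage w y} (ereal t) *
     ennreal (exp (- l * t)) * \<phi> (y - eval_path t w) \<partial>lborel)"

lemma measurable_occupation[measurable (raw)]:
  assumes w[measurable]: "w \<in> N \<rightarrow>\<^sub>M path_space" and [measurable]: "y \<in> borel_measurable N"
    and [measurable]: "\<phi> \<in> borel_measurable borel"
  shows "(\<lambda>x. occupation l \<phi> (w x) (y x)) \<in> borel_measurable N"
  unfolding occupation_def
proof (rule sigma_finite_measure.borel_measurable_nn_integral[OF sigma_finite_lborel])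
  have 2[measurable]: "snd \<in> borel_measurable (N \<Otimes>\<^sub>M lborel)"
    using measurable_snd[of N "lborel :: real measure"] by simp
  have 1: "(\<lambda>z. w (fst z)) \<in> N \<Otimes>\<^sub>M lborel \<rightarrow>\<^sub>M path_space" 
    by (rule measurable_compose[OF measurable_fst w])
  have [measurable]: "(\<lambda>z. eval_path (snd z) (w (fst z))) \<in> borel_measurable (N \<Otimes>\<^sub>M lborel)"
    by (rule measurable_eval_path[OF 1 2])
  have [measurable]: "(\<lambda>z. passage (w (fst z)) (y (fst z))) \<in> borel_measurable (N \<Otimes>\<^sub>M lborel)"
    by (rule measurable_passage[OF 1]) measurable
  have "(\<lambda>z. indicator {0..} (snd z) * (if ereal (snd z) < passage (w (fst z)) (y (fst z)) then 1 else 0) *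
      ennreal (exp (- l * snd z)) * \<phi> (y (fst z) - eval_path (snd z) (w (fst z)))) \<in> borel_measurable (N \<Otimes>\<^sub>M lborel)"
    by measurable
  then show "(\<lambda>(x, t). indicator {0..} t * indicator {..<passage (w x) (y x)} (ereal t) *
      ennreal (exp (- l * t)) * \<phi> (y x - eval_path t (w x))) \<in> borel_measurable (N \<Otimes>\<^sub>M lborel)"
    by (simp add: split_beta' indicator_def of_bool_def)
qed

locale resolvent_subordinator = resolvent_kernel f v k l kl + subordinator_process M f S
  for f v k l kl and M :: "'w measure" and S
begin

lemma density_k_neg: "emeasure (density lborel kl) {..<0} = 0"
  using kl_nonpos by (auto simp: emeasure_density indicator_def intro!: nn_integral_0_iff_AE[THEN iffD2] AE_I2)

lemma potential_eq_density: "potential l = density lborel kl"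
proof (rule measure_eqI_laplace)
  show "emeasure (density lborel kl) {..<0} = 0" by (rule density_k_neg)
  fix q :: real assume q: "0 < q"
  have "(\<integral>\<^sup>+z. ennreal (exp (- q * z)) \<partial>density lborel kl) = (\<integral>\<^sup>+z. ennreal (exp (- q * z)) * kl z \<partial>lborel)"
    by (subst nn_integral_density, simp_all) (simp only: mult.commute)
  then show "(\<integral>\<^sup>+z. ennreal (exp (- q * z)) \<partial>potential l) = (\<integral>\<^sup>+z. ennreal (exp (- q * z)) \<partial>density lborel kl)"
    by (simp only: laplace_kl[OF q] laplace_potential[OF l_nonneg q])
  show "(\<integral>\<^sup>+z. ennreal (exp (- q * z)) \<partial>potential l) < \<infinity>"
    by (simp only: laplace_potential[OF l_nonneg q]) simp
next
  show "sets (potential l) = sets borel" by (rule sets_potential)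
  show "sets (density lborel kl) = sets borel" by simp
  show "emeasure (potential l) {..<0} = 0" by (rule emeasure_potential_neg)
qed

text \<open>Up to the single instant of passage, being before the passage over \<open>y\<close>
  means that the subordinator is at most \<open>y\<close>. The expected occupation is thus an
  integral against the potential measure, whose density is \<open>kl\<close>.\<close>

lemma nn_integral_occupation:
  assumes [measurable]: "\<phi> \<in> borel_measurable borel"
  shows "(\<integral>\<^sup>+\<omega>. occupation l \<phi> (path \<omega>) y \<partial>M) = conv kl (\<lambda>z. \<phi> z * indicator {0<..} z) y"
proof -
  interpret P: pair_sigma_finite "lborel :: real measure" M ..
  define \<psi> where "\<psi> z = \<phi> (y - z) * indicator {..y} z" for z
  have \<psi>[measurable]: "\<psi> \<in> borel_measurable borel" unfolding \<psi>_def by measurable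
  have "(\<integral>\<^sup>+\<omega>. occupation l \<phi> (path \<omega>) y \<partial>M) =
      (\<integral>\<^sup>+\<omega>. \<integral>\<^sup>+t. indicator {0<..} t * ennreal (exp (- l * t)) * \<psi> (eval_path t (path \<omega>)) \<partial>lborel \<partial>M)"
    unfolding occupation_def
  proof (rule nn_integral_cong, rule nn_integral_cong_AE)
    fix \<omega> assume \<omega>: "\<omega> \<in> space M"
    note P = subordinator_path_path[OF \<omega>]
    show "AE t in lborel. indicator {0..} t * indicator {..<passage (path \<omega>) y} (ereal t) * ennreal (exp (- l * t)) *
        \<phi> (y - eval_path t (path \<omega>)) = indicator {0<..} t * ennreal (exp (- l * t)) * \<psi> (eval_path t (path \<omega>))"
      using AE_lborel_singleton[of 0] AE_lborel_singleton[of "real_of_ereal (passage (path \<omega>) y)"]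
    proof eventually_elim
      case (elim t)
      show ?case
      proof (cases "0 < t")
        case True
        have "ereal t < passage (path \<omega>) y \<longleftrightarrow> path \<omega> t \<le> y"
          using True path_le_before_passage[OF P, of t y] path_greater_after_passage[OF P, of y t] elim
          by (metis less_imp_le not_less_iff_gr_or_eq order.strict_trans2 real_of_ereal.simps(1))
        then show ?thesis using True
          by (simp add: eval_path_eq[OF P] \<psi>_def indicator_def)
      qed (use elim in \<open>auto simp: indicator_def\<close>)
    qed
  qed
  also have "\<dots> = (\<integral>\<^sup>+t. \<integral>\<^sup>+\<omega>. indicator {0<..} t * ennreal (exp (- l * t)) * \<psi> (eval_path t (path \<omega>)) \<partial>M \<partial>lborel)"
  proof (rule P.Fubini')
    have 1[measurable]: "fst \<in> borel_measurable (lborel \<Otimes>\<^sub>M M)"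
      using measurable_fst[of "lborel :: real measure" M] by simp
    have [measurable]: "(\<lambda>x. eval_path (fst x) (path (snd x))) \<in> borel_measurable (lborel \<Otimes>\<^sub>M M)"
      by (rule measurable_eval_path[OF measurable_compose[OF measurable_snd measurable_path] 1])
    show "(\<lambda>(t, \<omega>). indicator {0<..} t * ennreal (exp (- l * t)) * \<psi> (eval_path t (path \<omega>))) \<in> borel_measurable (lborel \<Otimes>\<^sub>M M)"
      unfolding split_beta' by measurable
  qed
  also have "\<dots> = (\<integral>\<^sup>+z. \<psi> z \<partial>potential l)" by (rule nn_integral_potential[symmetric]) measurable
  also have "\<dots> = (\<integral>\<^sup>+z. kl z * \<psi> z \<partial>lborel)"
    unfolding potential_eq_density by (rule nn_integral_density) simp_all
  also have "\<dots> = conv kl (\<lambda>z. \<phi> z * indicator {0<..} z) y"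
    unfolding conv_def
    by (rule nn_integral_cong_AE, use AE_lborel_singleton[of y] in eventually_elim)
       (auto simp: \<psi>_def indicator_def)
  finally show ?thesis .
qed

text \<open>Discretisation of \<open>exp (- l * passage - p * undershoot)\<close> at level
  \<open>x\<close>: the indicators select the last grid time before the passage over
  \<open>x\<close>, and both time and position are read off there.\<close>

definition grid_sum :: "real \<Rightarrow> real \<Rightarrow> 'w \<Rightarrow> real \<Rightarrow> ennreal" where
  "grid_sum p h \<omega> x = (\<Sum>i. ennreal (exp (- l * (real i * h) - p * S (real i * h) \<omega>)) *
     indicator {S (real i * h) \<omega>..<S (real (Suc i) * h) \<omega>} x)"

lemma expectation_exp_increment:
  assumes h: "0 < h" and p: "0 < p" and q: "0 < q"
  shows "integrable M (\<lambda>\<omega>. exp (- p * S (real i * h) \<omega>) * exp (- q * (S (real (Suc i) * h) \<omega> - S (real i * h) \<omega>)))"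
    "expectation (\<lambda>\<omega>. exp (- p * S (real i * h) \<omega>) * exp (- q * (S (real (Suc i) * h) \<omega> - S (real i * h) \<omega>))) =
       exp (- (real i * h) * f p) * exp (- h * f q)"
proof -
  \<comment> \<open>Constant from index 2 on, so that the first two increments along this sequence
    are the value at \<open>i * h\<close> and the increment over the next cell.\<close>
  define t where "t j = (if j = 0 then 0 else if j = Suc 0 then real i * h else real (Suc i) * h)" for j :: nat
  define X where "X j \<omega> = S (t (Suc j)) \<omega> - S (t j) \<omega>" for j \<omega>
  have "incseq t"
    using h by (intro incseq_SucI) (auto simp: t_def intro!: mult_right_mono)
  moreover have "0 \<le> t 0" by (simp add: t_def)
  moreover have "indep_vars (\<lambda>_. borel) (\<lambda>i \<omega>. S (r (Suc i)) \<omega> - S (r i) \<omega>) {..<n}"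
    if "0 \<le> r 0" "incseq r" for r :: "nat \<Rightarrow> real" and n
    using subordinator that unfolding subordinator_def by blast
  ultimately have "indep_vars (\<lambda>_. borel) X {..<2}"
    unfolding X_def[abs_def] by blast
  then have ind: "indep_vars (\<lambda>_. borel) (\<lambda>j \<omega>. exp (- (if j = 0 then p else q) * X j \<omega>)) {..<2}"
    by (rule indep_vars_compose2[where Y="\<lambda>j x. exp (- (if j = 0 then p else q) * x)"]) simp
  have X0: "X 0 \<omega> = S (real i * h) \<omega>" if "\<omega> \<in> space M" for \<omega>
    using that subordinator by (simp add: X_def t_def subordinator_def)
  have X1: "X 1 \<omega> = S (real (Suc i) * h) \<omega> - S (real i * h) \<omega>" for \<omega>
    by (simp add: X_def t_def)
  have two: "{..<2} = {0, 1::nat}" by auto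
  have ih: "0 \<le> real i * h" "0 \<le> real (Suc i) * h" "0 \<le> h" using h by auto
  note [measurable] = measurable_S[OF ih(1)] measurable_S[OF ih(2)] measurable_S[OF ih(3)]
  have d: "distr M borel (X 1) = distr M borel (S h)"
  proof -
    have "real (Suc i) * h = real i * h + h" by (simp add: algebra_simps)
    then show ?thesis using subordinator ih unfolding subordinator_def X1[abs_def] by metis
  qed
  have [measurable]: "X 1 \<in> borel_measurable M" unfolding X1[abs_def] by measurable
  have E1: "expectation (\<lambda>\<omega>. exp (- q * X 1 \<omega>)) = exp (- h * f q)"
  proof -
    have "expectation (\<lambda>\<omega>. exp (- q * X 1 \<omega>)) = (LINT x|distr M borel (X 1). exp (- q * x))"
      by (rule integral_distr[symmetric]) measurable
    also have "\<dots> = expectation (\<lambda>\<omega>. exp (- q * S h \<omega>))"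
      unfolding d by (rule integral_distr) measurable
    finally show ?thesis using expectation_exp_S[of h q] h q by simp
  qed
  have i: "integrable M (\<lambda>\<omega>. exp (- (if j = 0 then p else q) * X j \<omega>))" if "j \<in> {..<2}" for j
  proof -
    from that consider "j = 0" | "j = 1" unfolding two by auto
    then show ?thesis
    proof cases
      case 1
      show ?thesis
        by (rule Bochner_Integration.integrable_cong[THEN iffD1, OF refl _ integrable_exp_S[of "real i * h" p]])
           (use 1 X0 ih p in auto)
    next
      case 2
      have "AE \<omega> in M. norm (exp (- q * X 1 \<omega>)) \<le> 1"
        using S_mono[of _ "real i * h" "real (Suc i) * h"] ih q h
        by (intro AE_I2) (auto simp: X1[unfolded One_nat_def])
      then have "integrable M (\<lambda>\<omega>. exp (- q * X 1 \<omega>))"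
        by (rule integrable_const_bound) measurable
      then show ?thesis using 2 by simp
    qed
  qed
  have prodeq: "(\<Prod>j\<in>{..<2}. exp (- (if j = 0 then p else q) * X j \<omega>)) =
      exp (- p * S (real i * h) \<omega>) * exp (- q * (S (real (Suc i) * h) \<omega> - S (real i * h) \<omega>))" if "\<omega> \<in> space M" for \<omega>
    unfolding two using X0[OF that] X1 by simp
  show "integrable M (\<lambda>\<omega>. exp (- p * S (real i * h) \<omega>) * exp (- q * (S (real (Suc i) * h) \<omega> - S (real i * h) \<omega>)))"
    using indep_vars_integrable[OF _ ind i] Bochner_Integration.integrable_cong[OF refl[of M] prodeq] by simp
  have "expectation (\<lambda>\<omega>. exp (- p * S (real i * h) \<omega>) * exp (- q * (S (real (Suc i) * h) \<omega> - S (real i * h) \<omega>))) =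
      expectation (\<lambda>\<omega>. \<Prod>j\<in>{..<2}. exp (- (if j = 0 then p else q) * X j \<omega>))"
    by (rule Bochner_Integration.integral_cong[OF refl prodeq[symmetric]])
  also have "\<dots> = (\<Prod>j\<in>{..<2}. expectation (\<lambda>\<omega>. exp (- (if j = 0 then p else q) * X j \<omega>)))"
    by (rule indep_vars_lebesgue_integral[OF _ ind i]) auto
  also have "\<dots> = expectation (\<lambda>\<omega>. exp (- p * S (real i * h) \<omega>)) * expectation (\<lambda>\<omega>. exp (- q * X 1 \<omega>))"
    unfolding two by (simp add: X0 cong: Bochner_Integration.integral_cong)
  finally show "expectation (\<lambda>\<omega>. exp (- p * S (real i * h) \<omega>) * exp (- q * (S (real (Suc i) * h) \<omega> - S (real i * h) \<omega>))) =
       exp (- (real i * h) * f p) * exp (- h * f q)"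
    using E1 expectation_exp_S[OF ih(1) p] by simp
qed

text \<open>Integrating the level over the \<open>i\<close>-th cell and using independence of the
  next increment turns the \<open>i\<close>-th summand into \<open>(1 - exp (- h * f q)) / q\<close>
  times the \<open>i\<close>-th power of \<open>exp (- h * (l + f (p + q)))\<close>, so the sum is a
  geometric series.\<close>

lemma laplace_grid_sum:
  assumes h: "0 < h" and p: "0 \<le> p" and q: "0 < q"
  shows "(\<integral>\<^sup>+\<omega>. \<integral>\<^sup>+x. indicator {0<..} x * ennreal (exp (- q * x)) * grid_sum p h \<omega> x \<partial>lborel \<partial>M) =
    ennreal ((1 - exp (- h * f q)) / (1 - exp (- h * (l + f (p + q)))) / q)"
proof -
  define c where "c i = exp (- l * (real i * h)) / q" for i
  define A where "A i \<omega> = exp (- (p + q) * S (real i * h) \<omega>)" for i \<omega>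
  define B where "B i \<omega> = exp (- q * (S (real (Suc i) * h) \<omega> - S (real i * h) \<omega>))" for i \<omega>
  have ih: "0 \<le> real i * h" for i using h by simp
  have e: "exp (- l * u - p * r) * ((exp (- q * r) - exp (- q * s)) / q) =
      exp (- l * u) / q * (exp (- (p + q) * r) - exp (- (p + q) * r) * exp (- q * (s - r)))" for u r s :: real
  proof -
    have "exp (- (p + q) * r) * exp (- q * (s - r)) = exp (- p * r) * exp (- q * s)"
      "exp (- (p + q) * r) = exp (- p * r) * exp (- q * r)"
      "exp (- l * u - p * r) = exp (- l * u) * exp (- p * r)"
      by (simp_all add: exp_add[symmetric] algebra_simps)
    then show ?thesis by (simp only:) (simp add: right_diff_distrib diff_divide_distrib mult_ac)
  qed
  have inner: "(\<integral>\<^sup>+x. indicator {0<..} x * ennreal (exp (- q * x)) * grid_sum p h \<omega> x \<partial>lborel) =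
      (\<Sum>i. ennreal (c i * (A i \<omega> - A i \<omega> * B i \<omega>)))" if \<omega>: "\<omega> \<in> space M" for \<omega>
  proof -
    have "(\<integral>\<^sup>+x. indicator {0<..} x * ennreal (exp (- q * x)) * grid_sum p h \<omega> x \<partial>lborel) =
        (\<integral>\<^sup>+x. (\<Sum>i. ennreal (exp (- l * (real i * h) - p * S (real i * h) \<omega>)) * (indicator {0<..} x * ennreal (exp (- q * x)) *
           indicator {S (real i * h) \<omega>..<S (real (Suc i) * h) \<omega>} x)) \<partial>lborel)"
      by (intro nn_integral_cong, unfold grid_sum_def, subst ennreal_suminf_cmult[symmetric])
         (intro arg_cong[where f=suminf] ext, simp only: mult_ac)
    also have "\<dots> = (\<Sum>i. \<integral>\<^sup>+x. ennreal (exp (- l * (real i * h) - p * S (real i * h) \<omega>)) * (indicator {0<..} x * ennreal (exp (- q * x)) *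
           indicator {S (real i * h) \<omega>..<S (real (Suc i) * h) \<omega>} x) \<partial>lborel)"
      by (rule nn_integral_suminf) simp
    also have "\<dots> = (\<Sum>i. ennreal (c i * (A i \<omega> - A i \<omega> * B i \<omega>)))"
    proof (intro arg_cong[where f=suminf] ext)
      fix i
      have le: "S (real i * h) \<omega> \<le> S (real (Suc i) * h) \<omega>"
        using h by (intro S_mono[OF \<omega> ih] mult_right_mono) auto
      have "(\<integral>\<^sup>+x. ennreal (exp (- l * (real i * h) - p * S (real i * h) \<omega>)) * (indicator {0<..} x * ennreal (exp (- q * x)) *
           indicator {S (real i * h) \<omega>..<S (real (Suc i) * h) \<omega>} x) \<partial>lborel) =
         ennreal (exp (- l * (real i * h) - p * S (real i * h) \<omega>)) * (\<integral>\<^sup>+x. indicator {0<..} x * ennreal (exp (- q * x)) *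
           indicator {S (real i * h) \<omega>..<S (real (Suc i) * h) \<omega>} x \<partial>lborel)"
        by (rule nn_integral_cmult) simp
      also have "\<dots> = ennreal (exp (- l * (real i * h) - p * S (real i * h) \<omega>)) *
          ennreal ((exp (- q * S (real i * h) \<omega>) - exp (- q * S (real (Suc i) * h) \<omega>)) / q)"
        using le q S_nonneg[OF \<omega> ih] by (subst nn_integral_exp_Ico) auto
      also have "\<dots> = ennreal (c i * (A i \<omega> - A i \<omega> * B i \<omega>))"
      proof -
        have "exp (- l * (real i * h) - p * S (real i * h) \<omega>) * ((exp (- q * S (real i * h) \<omega>) - exp (- q * S (real (Suc i) * h) \<omega>)) / q)
            = c i * (A i \<omega> - A i \<omega> * B i \<omega>)"
          unfolding c_def A_def B_def by (rule e)
        then show ?thesis using le q by (subst ennreal_mult[symmetric]) auto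
      qed
      finally show "(\<integral>\<^sup>+x. ennreal (exp (- l * (real i * h) - p * S (real i * h) \<omega>)) * (indicator {0<..} x * ennreal (exp (- q * x)) *
           indicator {S (real i * h) \<omega>..<S (real (Suc i) * h) \<omega>} x) \<partial>lborel) = ennreal (c i * (A i \<omega> - A i \<omega> * B i \<omega>))" .
    qed
    finally show ?thesis .
  qed
  have [measurable]: "A i \<in> borel_measurable M" "B i \<in> borel_measurable M" for i
    using measurable_S[OF ih[of i]] measurable_S[OF ih[of "Suc i"]] unfolding A_def[abs_def] B_def[abs_def] by measurable
  have pq: "0 < p + q" using p q by simp
  have iA: "integrable M (A i)" for i
    unfolding A_def[abs_def] using integrable_exp_S[OF ih, of "p + q"] pq by simp
  have AB: "integrable M (\<lambda>\<omega>. A i \<omega> * B i \<omega>)"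
      "expectation (\<lambda>\<omega>. A i \<omega> * B i \<omega>) = exp (- (real i * h) * f (p + q)) * exp (- h * f q)" for i
    using expectation_exp_increment[OF h pq q, of i] unfolding A_def B_def by simp_all
  have F: "0 < l + f (p + q)" using l_nonneg f_pos[OF pq] by simp
  define x where "x = exp (- h * (l + f (p + q)))"
  have x: "0 < x" "x < 1" using h F by (simp_all add: x_def)
  have trm: "(\<integral>\<^sup>+\<omega>. ennreal (c i * (A i \<omega> - A i \<omega> * B i \<omega>)) \<partial>M) = ennreal ((1 - exp (- h * f q)) / q * x ^ i)" for i
  proof -
    have "A i \<omega> * B i \<omega> \<le> A i \<omega>" if "\<omega> \<in> space M" for \<omega>
    proof -
      have "S (real i * h) \<omega> \<le> S (real (Suc i) * h) \<omega>"
        using h by (intro S_mono[OF that ih] mult_right_mono) auto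
      then show ?thesis using q by (simp add: A_def B_def mult_left_le)
    qed
    then have "(\<integral>\<^sup>+\<omega>. ennreal (c i * (A i \<omega> - A i \<omega> * B i \<omega>)) \<partial>M) = ennreal (expectation (\<lambda>\<omega>. c i * (A i \<omega> - A i \<omega> * B i \<omega>)))"
      using q by (intro nn_integral_eq_integral Bochner_Integration.integrable_diff integrable_mult_right iA AB AE_I2) (auto simp: c_def)
    also have "expectation (\<lambda>\<omega>. c i * (A i \<omega> - A i \<omega> * B i \<omega>)) = c i * (exp (- (real i * h) * f (p + q)) - exp (- (real i * h) * f (p + q)) * exp (- h * f q))"
    proof -
      have "expectation (A i) = exp (- (real i * h) * f (p + q))"
        unfolding A_def[abs_def] by (rule expectation_exp_S[OF ih pq])
      then show ?thesis using iA AB by simp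
    qed
    also have "\<dots> = (1 - exp (- h * f q)) / q * x ^ i"
      by (simp add: c_def x_def exp_of_nat_mult[symmetric] exp_add[symmetric] right_diff_distrib left_diff_distrib diff_divide_distrib algebra_simps)
    finally show ?thesis .
  qed
  have "(\<integral>\<^sup>+\<omega>. \<integral>\<^sup>+x. indicator {0<..} x * ennreal (exp (- q * x)) * grid_sum p h \<omega> x \<partial>lborel \<partial>M) =
      (\<integral>\<^sup>+\<omega>. (\<Sum>i. ennreal (c i * (A i \<omega> - A i \<omega> * B i \<omega>))) \<partial>M)"
    by (rule nn_integral_cong[OF inner])
  also have "\<dots> = (\<Sum>i. \<integral>\<^sup>+\<omega>. ennreal (c i * (A i \<omega> - A i \<omega> * B i \<omega>)) \<partial>M)"
    by (rule nn_integral_suminf) measurable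
  also have "\<dots> = (\<Sum>i. ennreal ((1 - exp (- h * f q)) / q * x ^ i))" by (simp only: trm)
  also have "\<dots> = ennreal ((1 - exp (- h * f q)) / q * (1 / (1 - x)))"
    using x q h f_pos[OF q] by (intro suminf_ennreal_eq sums_mult geometric_sums) auto
  finally show ?thesis by (simp add: x_def field_simps)
qed

text \<open>The exceptional levels are the values of the path on all grids, a countable set. At
  every other level exactly one summand survives, the one at the last grid time before passage, and
  it is at most 1.\<close>

lemma tendsto_grid_sum:
  assumes \<omega>: "\<omega> \<in> space M" and fin: "\<And>y. passage (path \<omega>) y < \<infinity>"
  shows "AE x in lborel. 0 < x \<longrightarrow>
    (\<lambda>n. grid_sum p (1 / real (Suc n)) \<omega> x) \<longlonglongrightarrow>
      ennreal (discount l (passage (path \<omega>) x) * exp (- p * undershoot (path \<omega>) x))"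
    and "AE x in lborel. 0 < x \<longrightarrow> 0 \<le> p \<longrightarrow> (\<forall>n. grid_sum p (1 / real (Suc n)) \<omega> x \<le> 1)"
proof -
  note P = subordinator_path_path[OF \<omega>]
  define C where "C = (\<Union>n. range (\<lambda>i. S (real i * (1 / real (Suc n))) \<omega>))"
  have C: "AE x in lborel. x \<notin> C"
    by (intro AE_not_in countable_imp_null_set_lborel) (auto simp: C_def)
  define j where "j s n = nat (\<lceil>s / (1 / real (Suc n))\<rceil> - 1)" for s n
  have pS: "path \<omega> (real i * (1 / real (Suc n))) = S (real i * (1 / real (Suc n))) \<omega>" for i n
    by (simp add: path_def)
  have *: "grid_sum p (1 / real (Suc n)) \<omega> x =
      ennreal (exp (- l * (real (j s n) * (1 / real (Suc n))) - p * path \<omega> (real (j s n) * (1 / real (Suc n)))))"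
    if x: "0 < x" "x \<notin> C" and s: "passage (path \<omega>) x = ereal s" for x n s
  proof -
    let ?h = "1 / real (Suc n)"
    have "path \<omega> (real i * ?h) \<noteq> x" for i using x(2) unfolding pS by (auto simp: C_def)
    note g = grid_index_before_passage(3)[OF P x(1) s _ this, folded j_def]
    define a where "a i = ennreal (exp (- l * (real i * ?h) - p * S (real i * ?h) \<omega>))" for i
    have ind: "indicator {S (real i * ?h) \<omega>..<S (real (Suc i) * ?h) \<omega>} x = (if i = j s n then 1 else (0 :: ennreal))" for i
      using g[of i, unfolded pS]
      by (simp only: indicator_def of_bool_def atLeastLessThan_iff zero_less_divide_1_iff of_nat_0_less_iff zero_less_Suc)
    have "grid_sum p ?h \<omega> x = (\<Sum>i. a i * (if i = j s n then 1 else 0))"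
      unfolding grid_sum_def ind a_def ..
    also have "\<dots> = (\<Sum>i\<in>{j s n}. a i * (if i = j s n then 1 else 0))"
      by (rule suminf_finite) auto
    finally show ?thesis by (simp add: a_def pS del: of_nat_Suc times_divide_eq_right)
  qed
  show "AE x in lborel. 0 < x \<longrightarrow>
    (\<lambda>n. grid_sum p (1 / real (Suc n)) \<omega> x) \<longlonglongrightarrow>
      ennreal (discount l (passage (path \<omega>) x) * exp (- p * undershoot (path \<omega>) x))"
    using C
  proof (eventually_elim, safe)
    fix x :: real assume x: "x \<notin> C" "0 < x"
    obtain s where s: "passage (path \<omega>) x = ereal s"
      using fin[of x] passage_nonneg[of "path \<omega>" x] by (cases "passage (path \<omega>) x") auto
    show "(\<lambda>n. grid_sum p (1 / real (Suc n)) \<omega> x) \<longlonglongrightarrow>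
      ennreal (discount l (passage (path \<omega>) x) * exp (- p * undershoot (path \<omega>) x))"
    proof -
      note t = tendsto_grid_before_passage[OF P x(2) s, folded j_def]
      have "(\<lambda>n. ennreal (exp (- l * (real (j s n) * (1 / real (Suc n))) - p * path \<omega> (real (j s n) * (1 / real (Suc n))))))
          \<longlonglongrightarrow> ennreal (exp (- l * s - p * undershoot (path \<omega>) x))"
        by (intro tendsto_ennrealI tendsto_exp tendsto_diff tendsto_mult tendsto_const t)
      moreover have "exp (- l * s - p * undershoot (path \<omega>) x) =
          discount l (passage (path \<omega>) x) * exp (- p * undershoot (path \<omega>) x)"
        by (simp add: s discount_def exp_add[symmetric])
      ultimately show ?thesis unfolding *[OF x(2,1) s] by simp
    qed
  qed
  show "AE x in lborel. 0 < x \<longrightarrow> 0 \<le> p \<longrightarrow> (\<forall>n. grid_sum p (1 / real (Suc n)) \<omega> x \<le> 1)"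
    using C
  proof (eventually_elim, safe)
    fix x :: real and n assume x: "x \<notin> C" "0 < x" and p: "0 \<le> p"
    obtain s where s: "passage (path \<omega>) x = ereal s"
      using fin[of x] passage_nonneg[of "path \<omega>" x] by (cases "passage (path \<omega>) x") auto
    have "0 \<le> path \<omega> (real (j s n) * (1 / real (Suc n)))"
      by (intro path_nonneg[OF P]) simp
    then have "0 \<le> l * (real (j s n) * (1 / real (Suc n))) + p * path \<omega> (real (j s n) * (1 / real (Suc n)))"
      using p l_nonneg by (intro add_nonneg_nonneg mult_nonneg_nonneg) auto
    then show "grid_sum p (1 / real (Suc n)) \<omega> x \<le> 1"
      unfolding *[OF x(2,1) s] by (simp add: algebra_simps)
  qed
qed

definition passage_transform :: "real \<Rightarrow> real \<Rightarrow> ennreal" where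
  "passage_transform p x =
     (\<integral>\<^sup>+\<omega>. ennreal (discount l (passage (path \<omega>) x) * exp (- p * undershoot (path \<omega>) x)) \<partial>M)"

lemma measurable_passage_pair[measurable]:
  "(\<lambda>z. passage (path (fst z)) (snd z)) \<in> borel_measurable (M \<Otimes>\<^sub>M lborel)"
  "(\<lambda>z. undershoot (path (fst z)) (snd z)) \<in> borel_measurable (M \<Otimes>\<^sub>M lborel)"
proof -
  have 1: "snd \<in> borel_measurable (M \<Otimes>\<^sub>M lborel)"
    using measurable_snd[of M "lborel :: real measure"] by simp
  have 2: "(\<lambda>z. path (fst z)) \<in> M \<Otimes>\<^sub>M lborel \<rightarrow>\<^sub>M path_space"
    by (rule measurable_compose[OF measurable_fst measurable_path])
  show "(\<lambda>z. passage (path (fst z)) (snd z)) \<in> borel_measurable (M \<Otimes>\<^sub>M lborel)"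
    by (rule measurable_passage[OF 2 1])
  show "(\<lambda>z. undershoot (path (fst z)) (snd z)) \<in> borel_measurable (M \<Otimes>\<^sub>M lborel)"
    by (rule measurable_undershoot[OF 2 1])
qed

text \<open>Limit of the geometric series as the mesh tends to 0. The grid sums are bounded by 1, so
  dominated convergence applies in the level for fixed \<omega> and afterwards in \<omega>.\<close>

lemma laplace_passage_transform:
  assumes p: "0 \<le> p" and q: "0 < q"
  shows "(\<integral>\<^sup>+x. ennreal (exp (- q * x)) * (passage_transform p x * indicator {0<..} x) \<partial>lborel) =
    ennreal (f q / (l + f (p + q)) / q)"
proof -
  interpret P: pair_sigma_finite M "lborel :: real measure" ..
  let ?F = "\<lambda>\<omega> x. ennreal (discount l (passage (path \<omega>) x) * exp (- p * undershoot (path \<omega>) x))"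
  let ?e = "\<lambda>x. indicator {0<..} x * ennreal (exp (- q * x))"
  have snd[measurable]: "snd \<in> borel_measurable (M \<Otimes>\<^sub>M lborel)"
    using measurable_snd[of M "lborel :: real measure"] by simp
  have mF: "(\<lambda>z. ?e (snd z) * ?F (fst z) (snd z)) \<in> borel_measurable (M \<Otimes>\<^sub>M lborel)"
    by measurable
  have mG: "(\<lambda>z. ?e (snd z) * grid_sum p (1 / real (Suc n)) (fst z) (snd z)) \<in> borel_measurable (M \<Otimes>\<^sub>M lborel)" for n
  proof -
    have [measurable]: "(\<lambda>z. S (real i * (1 / real (Suc n))) (fst z)) \<in> borel_measurable (M \<Otimes>\<^sub>M lborel)" for i
      by (rule measurable_compose[OF measurable_fst measurable_S]) simp
    have "(\<lambda>z. ?e (snd z) * (\<Sum>i. ennreal (exp (- l * (real i * (1 / real (Suc n))) - p * S (real i * (1 / real (Suc n))) (fst z))) *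
       (if S (real i * (1 / real (Suc n))) (fst z) \<le> snd z \<and> snd z < S (real (Suc i) * (1 / real (Suc n))) (fst z) then 1 else 0)))
       \<in> borel_measurable (M \<Otimes>\<^sub>M lborel)"
      by measurable
    then show ?thesis by (simp add: grid_sum_def indicator_def of_bool_def del: of_nat_Suc)
  qed
  have sec: "(\<lambda>x. u (\<omega>, x)) \<in> borel_measurable lborel" if "u \<in> borel_measurable (M \<Otimes>\<^sub>M lborel)" "\<omega> \<in> space M" 
    for u :: "'w \<times> real \<Rightarrow> ennreal" and \<omega>
    using that(1) by (rule measurable_compose_Pair1[OF that(2)])
  have e: "(\<integral>\<^sup>+x. ?e x \<partial>lborel) = ennreal (1 / q)"
    by (rule nn_integral_exp_Ioi[OF q])
  have inner: "AE \<omega> in M. (\<lambda>n. \<integral>\<^sup>+x. ?e x * grid_sum p (1 / real (Suc n)) \<omega> x \<partial>lborel) \<longlonglongrightarrow>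
      (\<integral>\<^sup>+x. ?e x * ?F \<omega> x \<partial>lborel)"
    using AE_passage_finite AE_space
  proof eventually_elim
    case (elim \<omega>)
    then have fin: "\<And>y. passage (path \<omega>) y < \<infinity>" by simp
    note g = tendsto_grid_sum[OF elim(2) fin, where p=p]
    show ?case
    proof (rule nn_integral_dominated_convergence[where w="?e"])
      show "(\<lambda>x. ?e x * grid_sum p (1 / real (Suc n)) \<omega> x) \<in> borel_measurable lborel" for n
        using sec[OF mG elim(2)] by simp
      show "(\<lambda>x. ?e x * ?F \<omega> x) \<in> borel_measurable lborel"
        using sec[OF mF elim(2)] by simp
      show "?e \<in> borel_measurable lborel" by simp
      show "(\<integral>\<^sup>+x. ?e x \<partial>lborel) < \<infinity>" using e by simp
      show "AE x in lborel. ?e x * grid_sum p (1 / real (Suc n)) \<omega> x \<le> ?e x" for n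
        using g(2)
      proof eventually_elim
        case (elim x)
        show ?case
        proof (cases "0 < x")
          case True
          then have "grid_sum p (1 / real (Suc n)) \<omega> x \<le> 1" using elim p by simp
          from mult_left_mono[OF this, of "?e x"] show ?thesis by simp
        qed simp
      qed
      show "AE x in lborel. (\<lambda>n. ?e x * grid_sum p (1 / real (Suc n)) \<omega> x) \<longlonglongrightarrow> ?e x * ?F \<omega> x"
        using g(1)
      proof eventually_elim
        case (elim x)
        show ?case
        proof (cases "0 < x")
          case True
          then show ?thesis using elim by (intro ennreal_tendsto_cmult) auto
        qed simp
      qed
    qed
  qed
  have "(\<lambda>n. \<integral>\<^sup>+\<omega>. \<integral>\<^sup>+x. ?e x * grid_sum p (1 / real (Suc n)) \<omega> x \<partial>lborel \<partial>M) \<longlonglongrightarrow>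
      (\<integral>\<^sup>+\<omega>. \<integral>\<^sup>+x. ?e x * ?F \<omega> x \<partial>lborel \<partial>M)"
  proof (rule nn_integral_dominated_convergence[where w="\<lambda>_. ennreal (1 / q)"])
    show "(\<lambda>\<omega>. \<integral>\<^sup>+x. ?e x * grid_sum p (1 / real (Suc n)) \<omega> x \<partial>lborel) \<in> borel_measurable M" for n
      using lborel.borel_measurable_nn_integral_fst[OF mG] by simp
    show "(\<lambda>\<omega>. \<integral>\<^sup>+x. ?e x * ?F \<omega> x \<partial>lborel) \<in> borel_measurable M"
      using lborel.borel_measurable_nn_integral_fst[OF mF] by simp
    show "AE \<omega> in M. (\<integral>\<^sup>+x. ?e x * grid_sum p (1 / real (Suc n)) \<omega> x \<partial>lborel) \<le> ennreal (1 / q)" for n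
      using AE_passage_finite AE_space
    proof eventually_elim
      case (elim \<omega>)
      then have fin: "\<And>y. passage (path \<omega>) y < \<infinity>" by simp
      show ?case unfolding e[symmetric]
      proof (rule nn_integral_mono_AE)
        show "AE x in lborel. ?e x * grid_sum p (1 / real (Suc n)) \<omega> x \<le> ?e x"
          using tendsto_grid_sum(2)[OF elim(2) fin, where p=p]
        proof eventually_elim
          case (elim x)
          show ?case
          proof (cases "0 < x")
            case True
            then have "grid_sum p (1 / real (Suc n)) \<omega> x \<le> 1" using elim p by simp
            from mult_left_mono[OF this, of "?e x"] show ?thesis by simp
          qed simp
        qed
      qed
    qed
    show "(\<integral>\<^sup>+\<omega>. ennreal (1 / q) \<partial>M) < \<infinity>" by (simp add: emeasure_space_1)
  qed (use inner in auto)
  then have 1: "(\<lambda>n. ennreal ((1 - exp (- (1 / real (Suc n)) * f q)) / (1 - exp (- (1 / real (Suc n)) * (l + f (p + q)))) / q)) \<longlonglongrightarrow>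
      (\<integral>\<^sup>+\<omega>. \<integral>\<^sup>+x. ?e x * ?F \<omega> x \<partial>lborel \<partial>M)"
    by (subst (asm) laplace_grid_sum[OF _ p q]) simp_all
  have 2: "(\<lambda>n. ennreal ((1 - exp (- (1 / real (Suc n)) * f q)) / (1 - exp (- (1 / real (Suc n)) * (l + f (p + q)))) / q)) \<longlonglongrightarrow>
      ennreal (f q / (l + f (p + q)) / q)"
    using p q l_nonneg f_pos[OF q] f_pos[of "p + q"]
    by (intro tendsto_ennrealI tendsto_divide tendsto_exp_ratio tendsto_const) auto
  have "(\<integral>\<^sup>+x. ennreal (exp (- q * x)) * (passage_transform p x * indicator {0<..} x) \<partial>lborel) =
      (\<integral>\<^sup>+x. \<integral>\<^sup>+\<omega>. ?e x * ?F \<omega> x \<partial>M \<partial>lborel)"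
  proof (rule nn_integral_cong)
    fix x :: real
    have "(\<integral>\<^sup>+\<omega>. ?e x * ?F \<omega> x \<partial>M) = ?e x * (\<integral>\<^sup>+\<omega>. ?F \<omega> x \<partial>M)"
      by (rule nn_integral_cmult) measurable
    then show "ennreal (exp (- q * x)) * (passage_transform p x * indicator {0<..} x) = (\<integral>\<^sup>+\<omega>. ?e x * ?F \<omega> x \<partial>M)"
      by (simp add: passage_transform_def mult_ac)
  qed
  also have "\<dots> = (\<integral>\<^sup>+\<omega>. \<integral>\<^sup>+x. ?e x * ?F \<omega> x \<partial>lborel \<partial>M)"
    by (rule P.Fubini') (use mF in \<open>simp add: split_beta'\<close>)
  finally show ?thesis using LIMSEQ_unique[OF 1 2] by simp
qed

text \<open>A higher level is passed no earlier and from an undershoot that is no smaller, so both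
  factors decrease pathwise.\<close>

lemma passage_transform_antimono:
  assumes "0 \<le> p" "0 \<le> x" "x \<le> y" shows "passage_transform p y \<le> passage_transform p x"
  unfolding passage_transform_def
proof (rule nn_integral_mono)
  fix \<omega> assume \<omega>: "\<omega> \<in> space M"
  have 1: "discount l (passage (path \<omega>) y) \<le> discount l (passage (path \<omega>) x)"
    using l_nonneg passage_nonneg passage_mono[OF assms(3)] by (rule discount_antimono)
  have "undershoot (path \<omega>) x \<le> undershoot (path \<omega>) y"
    using assms(2,3) by (rule undershoot_mono[OF subordinator_path_path[OF \<omega>]])
  then have 2: "exp (- p * undershoot (path \<omega>) y) \<le> exp (- p * undershoot (path \<omega>) x)"
    using assms(1) by (simp add: mult_left_mono)
  show "ennreal (discount l (passage (path \<omega>) y) * exp (- p * undershoot (path \<omega>) y)) \<le>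
      ennreal (discount l (passage (path \<omega>) x) * exp (- p * undershoot (path \<omega>) x))"
    by (rule ennreal_leI, rule mult_mono[OF 1 2 discount_nonneg exp_ge_zero])
qed

lemma passage_transform_le_1:
  assumes "0 \<le> p" shows "passage_transform p x \<le> 1"
proof -
  have "passage_transform p x \<le> (\<integral>\<^sup>+\<omega>. 1 \<partial>M)"
    unfolding passage_transform_def
  proof (rule nn_integral_mono)
    fix \<omega> assume \<omega>: "\<omega> \<in> space M"
    have "discount l (passage (path \<omega>) x) * exp (- p * undershoot (path \<omega>) x) \<le> 1 * 1"
      using assms undershoot_nonneg[OF subordinator_path_path[OF \<omega>], of x]
      by (intro mult_mono discount_le_1 l_nonneg passage_nonneg) auto
    then show "ennreal (discount l (passage (path \<omega>) x) * exp (- p * undershoot (path \<omega>) x)) \<le> 1"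
      by simp
  qed
  then show ?thesis by (simp add: emeasure_space_1)
qed

text \<open>The identity holds for almost every level by uniqueness of Laplace transforms. To get it at
  every level, split \<open>k\<close> into the kernel and its complement: by monotone convergence the convolution
  of each part with \<open>v\<close> is at most what monotonicity in the level allows, and the two parts add up
  to \<open>1\<close>.\<close>

lemma passage_transform_eq:
  assumes p: "0 \<le> p" and x: "0 < x"
  shows "passage_transform p x = (\<integral>\<^sup>+z. ennreal (exp (- p * z)) * (kl z * v (x - z)) \<partial>lborel)"
proof -
  define h where "h z = ennreal (exp (- p * z)) * kl z" for z
  \<comment> \<open>\<open>h \<le> kl \<le> k\<close> almost everywhere, so the truncated
    subtraction is exact there.\<close>
  define h' where "h' z = k z - h z" for z
  have [measurable]: "h \<in> borel_measurable borel" "h' \<in> borel_measurable borel"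
    unfolding h_def[abs_def] h'_def[abs_def] by measurable
  have h0: "h z = 0" if "z \<le> 0" for z using that kl_nonpos by (simp add: h_def)
  have hk: "AE z in lborel. h z + h' z = k z"
    using kl_le_k
  proof eventually_elim
    case (elim z)
    have "h z \<le> 1 * kl z"
    proof (cases "z \<le> 0")
      case False
      then have "exp (- p * z) \<le> 1" using p by simp
      then have "ennreal (exp (- p * z)) \<le> ennreal 1" by (rule ennreal_leI)
      then show ?thesis unfolding h_def by (intro mult_right_mono) auto
    qed (simp add: h0)
    then have "h z \<le> k z" using elim by simp
    then show ?case by (simp add: h'_def)
  qed
  have sum1: "conv h v y + conv h' v y = 1" if "0 < y" for y
  proof -
    have "conv h v y + conv h' v y = conv (\<lambda>z. h z + h' z) v y"
      by (rule conv_add_left[symmetric]) measurable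
    also have "\<dots> = conv k v y" by (rule conv_cong_AE_left[OF hk])
    also have "\<dots> = 1" using sonine[OF that] by (simp add: conv_commute)
    finally show ?thesis .
  qed
  have AE: "AE y in lborel. passage_transform p y * indicator {0<..} y = conv h v y"
  proof (rule AE_eq_laplace)
    have [measurable]: "passage_transform p \<in> borel_measurable borel"
    proof -
      have "(\<lambda>z. ennreal (discount l (passage (path (snd z)) (fst z)) * exp (- p * undershoot (path (snd z)) (fst z))))
        \<in> borel_measurable (lborel \<Otimes>\<^sub>M M)"
      proof -
        have 1: "fst \<in> borel_measurable (lborel \<Otimes>\<^sub>M M)"
          using measurable_fst[of "lborel :: real measure" M] by simp
        have 2: "(\<lambda>z. path (snd z)) \<in> lborel \<Otimes>\<^sub>M M \<rightarrow>\<^sub>M path_space"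
          by (rule measurable_compose[OF measurable_snd measurable_path])
        note [measurable] = measurable_passage[OF 2 1] measurable_undershoot[OF 2 1]
        show ?thesis by measurable
      qed
      from borel_measurable_nn_integral_fst[OF this]
      show ?thesis by (simp add: passage_transform_def[abs_def])
    qed
    show "(\<lambda>y. passage_transform p y * indicator {0<..} y) \<in> borel_measurable borel" by measurable
    show "conv h v \<in> borel_measurable borel" by measurable
    show "conv h v z = 0" if "z < 0" for z using that by (intro conv_nonpos h0 v_nonpos) auto
    fix q :: real assume q: "0 < q"
    have "(\<integral>\<^sup>+z. ennreal (exp (- q * z)) * conv h v z \<partial>lborel) =
        (\<integral>\<^sup>+z. ennreal (exp (- q * z)) * h z \<partial>lborel) * ennreal (f q / q)"
      unfolding laplace_v[OF q, symmetric] by (rule laplace_conv) measurable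
    also have "(\<integral>\<^sup>+z. ennreal (exp (- q * z)) * h z \<partial>lborel) = (\<integral>\<^sup>+z. ennreal (exp (- (p + q) * z)) * kl z \<partial>lborel)"
    proof (rule nn_integral_cong)
      fix z :: real
      have "exp (- (p + q) * z) = exp (- q * z) * exp (- p * z)"
        by (simp add: exp_add[symmetric] algebra_simps)
      then show "ennreal (exp (- q * z)) * h z = ennreal (exp (- (p + q) * z)) * kl z"
        by (simp add: h_def ennreal_mult mult.assoc)
    qed
    also have "\<dots> = ennreal (1 / (l + f (p + q)))" using p q by (intro laplace_kl) simp
    also have "ennreal (1 / (l + f (p + q))) * ennreal (f q / q) = ennreal (f q / (l + f (p + q)) / q)"
      using p q l_nonneg f_pos[OF q] f_pos[of "p + q"] by (simp add: ennreal_mult[symmetric])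
    finally show "(\<integral>\<^sup>+z. ennreal (exp (- q * z)) * (passage_transform p z * indicator {0<..} z) \<partial>lborel) =
        (\<integral>\<^sup>+z. ennreal (exp (- q * z)) * conv h v z \<partial>lborel)"
      using laplace_passage_transform[OF p q] by simp
    show "(\<integral>\<^sup>+z. ennreal (exp (- q * z)) * (passage_transform p z * indicator {0<..} z) \<partial>lborel) < \<infinity>"
      unfolding laplace_passage_transform[OF p q] by simp
  qed simp
  have le: "conv h v x \<le> passage_transform p x"
  proof -
    \<comment> \<open>Shifted profiles: they increase to \<open>v (x - z)\<close> by
      right-continuity, and they lie below \<open>v (y - z)\<close> whenever
      \<open>x < y < x + 1 / (n + 1)\<close>.\<close>
    define V where "V n z = v (x + 1 / real (Suc n) - z) * indicator {..<x} z" for n z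
    have [measurable]: "V n \<in> borel_measurable borel" for n unfolding V_def[abs_def] by measurable
    have "v (x - z) = (SUP n. V n z)" for z
    proof (cases "z < x")
      case True
      then have "v (x - z) = (SUP n. v (x - z + 1 / real (Suc n)))" by (intro v_SUP) simp
      then show ?thesis using True by (simp add: V_def algebra_simps)
    qed (simp add: V_def v_nonpos)
    then have "conv h v x = (\<integral>\<^sup>+z. (SUP n. h z * V n z) \<partial>lborel)"
      unfolding conv_def by (simp add: SUP_mult_left_ennreal)
    also have "\<dots> = (SUP n. \<integral>\<^sup>+z. h z * V n z \<partial>lborel)"
    proof (rule nn_integral_monotone_convergence_SUP)
      show "incseq (\<lambda>n z. h z * V n z)"
      proof (intro incseq_SucI le_funI mult_left_mono)
        fix n z
        show "V n z \<le> V (Suc n) z"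
        proof (cases "z < x")
          case True
          have 1: "1 / real (Suc (Suc n)) \<le> 1 / real (Suc n)" "0 < 1 / real (Suc (Suc n))"
            by (simp_all add: field_simps)
          have "v (x + 1 / real (Suc n) - z) \<le> v (x + 1 / real (Suc (Suc n)) - z)"
            using True 1 by (intro v_antimono) linarith+
          then show ?thesis unfolding V_def by (rule mult_right_mono) simp
        qed (simp add: V_def)
      qed simp
    qed simp
    also have "\<dots> \<le> passage_transform p x"
    proof (rule SUP_least)
      fix n
      obtain y where y: "x < y" "y < x + 1 / real (Suc n)"
          "passage_transform p y * indicator {0<..} y = conv h v y"
        using AE_lborel_obtain[OF AE, of x "x + 1 / real (Suc n)"] by auto
      have "V n z \<le> v (y - z)" for z
        using y by (auto simp: V_def indicator_def intro!: v_antimono)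
      then have "(\<integral>\<^sup>+z. h z * V n z \<partial>lborel) \<le> conv h v y"
        unfolding conv_def by (intro nn_integral_mono mult_left_mono) auto
      also have "\<dots> = passage_transform p y" using y x by simp
      also have "\<dots> \<le> passage_transform p x" using y x p by (intro passage_transform_antimono) auto
      finally show "(\<integral>\<^sup>+z. h z * V n z \<partial>lborel) \<le> passage_transform p x" .
    qed
    finally show ?thesis .
  qed
  have le': "conv h' v x \<le> 1 - passage_transform p x"
  proof -
    \<comment> \<open>Here the profile is cut off instead of shifted: for good \<open>y\<close>
      between \<open>x - 1 / (n + 1)\<close> and \<open>x\<close>, the argument \<open>y - z\<close>
      stays positive on the support and does not exceed \<open>x - z\<close>.\<close>
    define V where "V n z = v (x - z) * indicator {..x - 1 / real (Suc n)} z" for n z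
    have [measurable]: "V n \<in> borel_measurable borel" for n unfolding V_def[abs_def] by measurable
    have mono: "V n z \<le> V m z" if "n \<le> m" for n m z
    proof -
      have "1 / real (Suc m) \<le> 1 / real (Suc n)" using that by (simp add: field_simps)
      then show ?thesis by (auto simp: V_def indicator_def)
    qed
    have "v (x - z) = (SUP n. V n z)" for z
    proof (cases "z < x")
      case True
      then obtain n where "1 / real (Suc n) < x - z" using nat_approx_posE[of "x - z"] by auto
      then have "V n z = v (x - z)" by (simp add: V_def)
      then show ?thesis
        by (intro antisym SUP_least) (metis SUP_upper UNIV_I, simp add: V_def indicator_def)
    qed (simp add: V_def v_nonpos)
    then have "conv h' v x = (\<integral>\<^sup>+z. (SUP n. h' z * V n z) \<partial>lborel)"
      unfolding conv_def by (simp add: SUP_mult_left_ennreal)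
    also have "\<dots> = (SUP n. \<integral>\<^sup>+z. h' z * V n z \<partial>lborel)"
      by (rule nn_integral_monotone_convergence_SUP)
         (auto intro!: incseq_SucI le_funI mult_left_mono mono)
    also have "\<dots> \<le> 1 - passage_transform p x"
    proof (rule SUP_least)
      fix n
      have "max 0 (x - 1 / real (Suc n)) < x" using x by simp
      from AE_lborel_obtain[OF AE this]
      obtain y where y: "0 < y" "x - 1 / real (Suc n) < y" "y < x"
          "passage_transform p y * indicator {0<..} y = conv h v y"
        by (metis max_less_iff_conj)
      have "V n z \<le> v (y - z)" for z
        using y by (auto simp: V_def indicator_def intro!: v_antimono)
      then have "(\<integral>\<^sup>+z. h' z * V n z \<partial>lborel) \<le> conv h' v y"
        unfolding conv_def by (intro nn_integral_mono mult_left_mono) auto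
      then have "(\<integral>\<^sup>+z. h' z * V n z \<partial>lborel) + passage_transform p x \<le> conv h' v y + passage_transform p y"
        using y p by (intro add_mono passage_transform_antimono) auto
      also have "\<dots> = 1" using sum1[OF y(1)] y by (simp add: add.commute)
      finally show "(\<integral>\<^sup>+z. h' z * V n z \<partial>lborel) \<le> 1 - passage_transform p x"
        by (simp add: ennreal_le_minus_iff)
    qed
    finally show ?thesis .
  qed
  have H1: "passage_transform p x \<le> 1" by (rule passage_transform_le_1[OF p])
  \<comment> \<open>The bound on the complement becomes the missing upper bound on the transform:
    both sums are compared with 1, and the finite summand \<open>conv h' v x\<close> is
    cancelled.\<close>
  have "passage_transform p x + conv h' v x \<le> passage_transform p x + (1 - passage_transform p x)"
    using le' by (rule add_left_mono)
  also have "\<dots> = 1" using H1 by simp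
  also have "\<dots> = conv h v x + conv h' v x" using sum1[OF x] by simp
  finally have "passage_transform p x + conv h' v x \<le> conv h v x + conv h' v x" .
  moreover have "conv h' v x \<noteq> \<infinity>"
  proof -
    have "1 - passage_transform p x \<le> 1" by (rule diff_le_self_ennreal)
    with le' have "conv h' v x \<le> 1" by (rule order_trans)
    then show ?thesis by (auto simp: top_unique)
  qed
  ultimately have "passage_transform p x \<le> conv h v x"
    by (simp add: add.commute[of _ "conv h' v x"] ennreal_add_left_cancel_le)
  with le have "passage_transform p x = conv h v x" by simp
  then show ?thesis by (simp add: conv_def h_def mult.assoc)
qed

text \<open>At a fixed level, the formula for \<open>passage_transform p x\<close> as
  \<open>p\<close> varies equates the Laplace transforms of the discounted law of the undershoot and
  of the measure with density \<open>kl z * v (x - z)\<close>. Uniqueness extends this to all test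
  functions.\<close>

lemma nn_integral_undershoot:
  assumes x: "0 < x" and [measurable]: "\<phi> \<in> borel_measurable borel"
  shows "(\<integral>\<^sup>+\<omega>. ennreal (discount l (passage (path \<omega>) x)) * \<phi> (x - undershoot (path \<omega>) x) \<partial>M) =
    conv kl (\<lambda>z. v z * \<phi> z) x"
proof -
  define D where "D = density M (\<lambda>\<omega>. ennreal (discount l (passage (path \<omega>) x)))"
  define N where "N = distr D borel (\<lambda>\<omega>. undershoot (path \<omega>) x)"
  define N' where "N' = density lborel (\<lambda>z. kl z * v (x - z))"
  have [measurable]: "(\<lambda>\<omega>. undershoot (path \<omega>) x) \<in> borel_measurable M"
    by (rule measurable_undershoot) measurable
  have [measurable]: "(\<lambda>\<omega>. passage (path \<omega>) x) \<in> borel_measurable M"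
    by (rule measurable_passage) measurable
  have N: "(\<integral>\<^sup>+z. \<psi> z \<partial>N) = (\<integral>\<^sup>+\<omega>. ennreal (discount l (passage (path \<omega>) x)) * \<psi> (undershoot (path \<omega>) x) \<partial>M)"
    if [measurable]: "\<psi> \<in> borel_measurable borel" for \<psi>
    unfolding N_def D_def by (simp add: nn_integral_distr nn_integral_density)
  have N': "(\<integral>\<^sup>+z. \<psi> z \<partial>N') = (\<integral>\<^sup>+z. \<psi> z * (kl z * v (x - z)) \<partial>lborel)"
    if [measurable]: "\<psi> \<in> borel_measurable borel" for \<psi>
    unfolding N'_def by (simp add: nn_integral_density mult_ac)
  have "N = N'"
  proof (rule measure_eqI_laplace)
    show "sets N = sets borel" "sets N' = sets borel" by (simp_all add: N_def N'_def)
    have "emeasure N {..<0} = (\<integral>\<^sup>+z. indicator {..<0} z \<partial>N)"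
      by (simp add: N_def)
    also have "\<dots> = (\<integral>\<^sup>+\<omega>. 0 \<partial>M)"
    proof -
      have "indicator {..<0} (undershoot w x) = (0 :: ennreal)" for w
      proof -
        have "\<not> undershoot w x < 0" by (simp add: undershoot_def not_less del: if_image_distrib)
        then show ?thesis by simp
      qed
      then show ?thesis by (subst N) simp_all
    qed
    finally show "emeasure N {..<0} = 0" by simp
    have "emeasure N' {..<0} = (\<integral>\<^sup>+z. indicator {..<0} z * (kl z * v (x - z)) \<partial>lborel)"
      using N'[of "indicator {..<0}"] by (simp add: N'_def)
    also have "\<dots> = (\<integral>\<^sup>+(z::real). 0 \<partial>lborel)"
    proof (rule nn_integral_cong)
      fix z :: real
      show "indicator {..<0} z * (kl z * v (x - z)) = 0" by (cases "z < 0") (simp_all add: kl_nonpos)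
    qed
    finally show "emeasure N' {..<0} = 0" by simp
    fix q :: real assume q: "0 < q"
    have NH: "(\<integral>\<^sup>+z. ennreal (exp (- q * z)) \<partial>N) = passage_transform q x"
      by (subst N) (simp_all add: passage_transform_def ennreal_mult discount_nonneg)
    show "(\<integral>\<^sup>+z. ennreal (exp (- q * z)) \<partial>N) = (\<integral>\<^sup>+z. ennreal (exp (- q * z)) \<partial>N')"
      unfolding NH passage_transform_eq[OF less_imp_le[OF q] x] by (subst N') simp_all
    show "(\<integral>\<^sup>+z. ennreal (exp (- q * z)) \<partial>N) < \<infinity>"
      unfolding NH using passage_transform_le_1[of q x] q by (auto intro: le_less_trans)
  qed
  then have "(\<integral>\<^sup>+z. \<phi> (x - z) \<partial>N) = (\<integral>\<^sup>+z. \<phi> (x - z) \<partial>N')" by simp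
  then show ?thesis by (simp add: N N' conv_def mult_ac)
qed

end

section \<open>The Green operator\<close>

text \<open>Nonnegative counterpart of \<open>riemann_liouville_integral\<close>. The kernel is a
  parameter because both \<open>k\<close> and \<open>kl\<close> are inserted.\<close>

definition integral_op :: "(real \<Rightarrow> ennreal) \<Rightarrow> (real \<Rightarrow> ennreal) \<Rightarrow> real \<Rightarrow> ennreal" where
  "integral_op a \<phi> = conv a (\<lambda>z. \<phi> z * indicator {0<..} z)"

text \<open>Nonnegative counterpart of \<open>sonine_kernel_op\<close> when \<open>a\<close> is
  \<open>k\<close>, with the two factors of the convolution exchanged.\<close>

definition jump_op :: "(real \<Rightarrow> ennreal) \<Rightarrow> (real \<Rightarrow> ennreal) \<Rightarrow> (real \<Rightarrow> ennreal) \<Rightarrow> real \<Rightarrow> ennreal" where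
  "jump_op a v \<phi> = conv a (\<lambda>z. v z * \<phi> z)"

definition green_op :: "(real \<Rightarrow> ennreal) \<Rightarrow> (real \<Rightarrow> ennreal) \<Rightarrow> (real \<Rightarrow> ennreal) \<Rightarrow> real \<Rightarrow> ennreal" where
  "green_op a v \<phi> x = (\<Sum>i. (jump_op a v ^^ i) (integral_op a \<phi>) x)"

locale green_kernels =
  fixes a v :: "real \<Rightarrow> ennreal"
  assumes measurable_a[measurable]: "a \<in> borel_measurable borel"
    and measurable_v[measurable]: "v \<in> borel_measurable borel"
    and a_nonpos: "\<And>z. z \<le> 0 \<Longrightarrow> a z = 0" and v_nonpos: "\<And>z. z \<le> 0 \<Longrightarrow> v z = 0"
begin

lemma measurable_integral_op[measurable]:
  assumes [measurable]: "\<phi> \<in> borel_measurable borel"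
  shows "integral_op a \<phi> \<in> borel_measurable borel"
  unfolding integral_op_def by measurable

lemma measurable_jump_op[measurable]:
  assumes [measurable]: "\<phi> \<in> borel_measurable borel"
  shows "jump_op a v \<phi> \<in> borel_measurable borel"
  unfolding jump_op_def by measurable

lemma measurable_jump_op_pow[measurable]:
  "\<phi> \<in> borel_measurable borel \<Longrightarrow> (jump_op a v ^^ n) \<phi> \<in> borel_measurable borel"
  by (induction n) (auto intro: measurable_jump_op)

lemma measurable_green_op[measurable]:
  assumes [measurable]: "\<phi> \<in> borel_measurable borel"
  shows "green_op a v \<phi> \<in> borel_measurable borel"
  unfolding green_op_def[abs_def] by measurable

lemma measurable_green_op_pow[measurable]:
  "\<phi> \<in> borel_measurable borel \<Longrightarrow> (green_op a v ^^ n) \<phi> \<in> borel_measurable borel"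
  by (induction n) (auto intro: measurable_green_op)

section \<open>Monotonicity, linearity and fixed points of the nonnegative operators\<close>

lemma integral_op_mono:
  assumes "\<And>z. 0 < z \<Longrightarrow> z < x \<Longrightarrow> \<phi> z \<le> \<psi> z"
  shows "integral_op a \<phi> x \<le> integral_op a \<psi> x"
  unfolding integral_op_def
  by (rule conv_mono_right) (use assms a_nonpos in \<open>auto simp: indicator_def\<close>)

lemma jump_op_mono:
  assumes "\<And>z. 0 < z \<Longrightarrow> z < x \<Longrightarrow> \<phi> z \<le> \<psi> z"
  shows "jump_op a v \<phi> x \<le> jump_op a v \<psi> x"
  unfolding jump_op_def
proof (rule conv_mono_right[OF a_nonpos])
  fix z assume "z < x"
  then show "v z * \<phi> z \<le> v z * \<psi> z"
    using assms v_nonpos by (cases "z \<le> 0") (auto intro!: mult_left_mono)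
qed

text \<open>For positive \<open>n\<close> only arguments below \<open>x\<close> enter; the
  assumption at \<open>x\<close> itself covers \<open>n = 0\<close>.\<close>

lemma jump_op_pow_mono:
  assumes "\<And>z. 0 < z \<Longrightarrow> z < x \<Longrightarrow> \<phi> z \<le> \<psi> z" "\<phi> x \<le> \<psi> x"
  shows "(jump_op a v ^^ n) \<phi> x \<le> (jump_op a v ^^ n) \<psi> x"
proof -
  have "(jump_op a v ^^ n) \<phi> y \<le> (jump_op a v ^^ n) \<psi> y" if "0 < y" "y \<le> x" for y
    using that
  proof (induction n arbitrary: y)
    case 0
    then show ?case using assms by (cases "y = x") auto
  next
    case (Suc n)
    then show ?case by (auto intro!: jump_op_mono)
  qed
  moreover have "(jump_op a v ^^ n) \<phi> x \<le> (jump_op a v ^^ n) \<psi> x" if "x \<le> 0"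
  proof (cases n)
    case (Suc m)
    then show ?thesis using that by (auto intro!: jump_op_mono)
  qed (use assms in simp)
  ultimately show ?thesis by (cases "0 < x") auto
qed

lemma green_op_mono:
  assumes "\<And>z. 0 < z \<Longrightarrow> z < x \<Longrightarrow> \<phi> z \<le> \<psi> z"
  shows "green_op a v \<phi> x \<le> green_op a v \<psi> x"
  unfolding green_op_def
  by (intro suminf_le jump_op_pow_mono integral_op_mono) (auto intro: assms)

lemma integral_op_add:
  assumes [measurable]: "\<phi> \<in> borel_measurable borel" "\<psi> \<in> borel_measurable borel"
  shows "integral_op a (\<lambda>z. \<phi> z + \<psi> z) = (\<lambda>x. integral_op a \<phi> x + integral_op a \<psi> x)"
  unfolding integral_op_def by (intro ext) (simp add: distrib_right conv_add_right)

lemma integral_op_cmult: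
  assumes [measurable]: "\<phi> \<in> borel_measurable borel"
  shows "integral_op a (\<lambda>z. c * \<phi> z) = (\<lambda>x. c * integral_op a \<phi> x)"
  unfolding integral_op_def by (intro ext) (simp add: mult.assoc conv_cmult_right)

lemma jump_op_add:
  assumes [measurable]: "\<phi> \<in> borel_measurable borel" "\<psi> \<in> borel_measurable borel"
  shows "jump_op a v (\<lambda>z. \<phi> z + \<psi> z) = (\<lambda>x. jump_op a v \<phi> x + jump_op a v \<psi> x)"
  unfolding jump_op_def by (intro ext) (simp add: distrib_left conv_add_right)

lemma jump_op_cmult:
  assumes [measurable]: "\<phi> \<in> borel_measurable borel"
  shows "jump_op a v (\<lambda>z. c * \<phi> z) = (\<lambda>x. c * jump_op a v \<phi> x)"
  unfolding jump_op_def by (intro ext) (simp add: mult.left_commute[of _ c] conv_cmult_right)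

lemma jump_op_suminf:
  assumes [measurable]: "\<And>i. u i \<in> borel_measurable borel"
  shows "jump_op a v (\<lambda>z. \<Sum>i. u i z) x = (\<Sum>i. jump_op a v (u i) x)"
  unfolding jump_op_def conv_def
  by (subst nn_integral_suminf[symmetric]) simp_all

lemma jump_op_pow_add:
  assumes [measurable]: "\<phi> \<in> borel_measurable borel" "\<psi> \<in> borel_measurable borel"
  shows "(jump_op a v ^^ n) (\<lambda>z. \<phi> z + \<psi> z) = (\<lambda>x. (jump_op a v ^^ n) \<phi> x + (jump_op a v ^^ n) \<psi> x)"
  by (induction n) (auto simp: jump_op_add)

lemma jump_op_pow_cmult:
  assumes [measurable]: "\<phi> \<in> borel_measurable borel"
  shows "(jump_op a v ^^ n) (\<lambda>z. c * \<phi> z) = (\<lambda>x. c * (jump_op a v ^^ n) \<phi> x)"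
  by (induction n) (auto simp: jump_op_cmult)

lemma green_op_add:
  assumes [measurable]: "\<phi> \<in> borel_measurable borel" "\<psi> \<in> borel_measurable borel"
  shows "green_op a v (\<lambda>z. \<phi> z + \<psi> z) = (\<lambda>x. green_op a v \<phi> x + green_op a v \<psi> x)"
  unfolding green_op_def[abs_def] by (intro ext) (simp add: integral_op_add jump_op_pow_add suminf_add)

lemma green_op_cmult:
  assumes [measurable]: "\<phi> \<in> borel_measurable borel"
  shows "green_op a v (\<lambda>z. c * \<phi> z) = (\<lambda>x. c * green_op a v \<phi> x)"
  unfolding green_op_def[abs_def] by (intro ext) (simp add: integral_op_cmult jump_op_pow_cmult)

lemma green_op_pow_cmult:
  assumes [measurable]: "\<phi> \<in> borel_measurable borel"
  shows "(green_op a v ^^ n) (\<lambda>z. c * \<phi> z) = (\<lambda>x. c * (green_op a v ^^ n) \<phi> x)"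
  by (induction n) (auto simp: green_op_cmult)

lemma green_op_pow_mono:
  assumes "\<And>z. 0 < z \<Longrightarrow> z \<le> x \<Longrightarrow> \<phi> z \<le> \<psi> z" "0 < x"
  shows "(green_op a v ^^ n) \<phi> x \<le> (green_op a v ^^ n) \<psi> x"
proof -
  have "(green_op a v ^^ n) \<phi> y \<le> (green_op a v ^^ n) \<psi> y" if "0 < y" "y \<le> x" for y
    using that by (induction n arbitrary: y) (auto intro!: green_op_mono assms)
  then show ?thesis using assms by simp
qed

lemma green_op_unfold:
  assumes [measurable]: "\<phi> \<in> borel_measurable borel"
  shows "green_op a v \<phi> x = integral_op a \<phi> x + jump_op a v (green_op a v \<phi>) x"
proof -
  have "green_op a v \<phi> x = (jump_op a v ^^ 0) (integral_op a \<phi>) x + (\<Sum>i. (jump_op a v ^^ Suc i) (integral_op a \<phi>) x)"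
    unfolding green_op_def
    using suminf_offset[of "\<lambda>i. (jump_op a v ^^ i) (integral_op a \<phi>) x" 1] by (simp add: add.commute)
  also have "(\<Sum>i. (jump_op a v ^^ Suc i) (integral_op a \<phi>) x) = jump_op a v (green_op a v \<phi>) x"
    unfolding green_op_def[abs_def] by (subst jump_op_suminf) simp_all
  finally show ?thesis by simp
qed

text \<open>A solution differs from the partial Neumann sum by an iterate applied to the solution
  itself, so identifying it with the full series amounts to showing that these iterates
  vanish.\<close>

lemma fixpoint_unfold:
  assumes [measurable]: "\<phi> \<in> borel_measurable borel" "u \<in> borel_measurable borel"
    and u: "\<And>x. u x = integral_op a \<phi> x + jump_op a v u x"
  shows "u x = (\<Sum>i<n. (jump_op a v ^^ i) (integral_op a \<phi>) x) + (jump_op a v ^^ n) u x"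
proof (induction n)
  case (Suc n)
  have "(jump_op a v ^^ n) u x = (jump_op a v ^^ n) (\<lambda>x. integral_op a \<phi> x + jump_op a v u x) x"
    by (rule arg_cong[where f="\<lambda>h. (jump_op a v ^^ n) h x"]) (rule ext, rule u)
  also have "\<dots> = (jump_op a v ^^ n) (integral_op a \<phi>) x + (jump_op a v ^^ Suc n) u x"
    by (simp add: jump_op_pow_add funpow_swap1)
  finally show ?case using Suc by (simp add: add.assoc)
qed simp

text \<open>The Green function is the smallest nonnegative solution: its partial sums arise from 0
  by iterating \<open>s \<mapsto> integral_op a \<phi> + jump_op a v s\<close>, and this map
  preserves lying below \<open>w\<close> on \<open>(0,T]\<close> since it only looks at smaller
  arguments.\<close>

lemma green_op_le_supersolution:
  assumes [measurable]: "\<phi> \<in> borel_measurable borel" "w \<in> borel_measurable borel"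
    and w: "\<And>x. 0 < x \<Longrightarrow> x \<le> T \<Longrightarrow> integral_op a \<phi> x + jump_op a v w x \<le> w x"
    and x: "0 < x" "x \<le> T"
  shows "green_op a v \<phi> x \<le> w x"
proof -
  let ?s = "\<lambda>n x. \<Sum>i<n. (jump_op a v ^^ i) (integral_op a \<phi>) x"
  have s: "?s (Suc n) y = integral_op a \<phi> y + jump_op a v (?s n) y" for n y
  proof (induction n arbitrary: y)
    case (Suc n)
    have "jump_op a v (?s (Suc n)) y = jump_op a v (?s n) y + (jump_op a v ^^ Suc n) (integral_op a \<phi>) y"
      by (simp add: jump_op_add)
    then show ?case using Suc[of y] by (simp add: add.assoc)
  qed (simp add: jump_op_def conv_def)
  have "?s n y \<le> w y" if "0 < y" "y \<le> T" for n y
    using that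
  proof (induction n arbitrary: y)
    case (Suc n)
    have "?s (Suc n) y \<le> integral_op a \<phi> y + jump_op a v w y"
      unfolding s using Suc by (intro add_left_mono jump_op_mono) auto
    then show ?case using w[of y] Suc.prems by simp
  qed simp
  then show ?thesis
    unfolding green_op_def suminf_eq_SUP using x by (intro SUP_least) auto
qed

end

lemma conv_op_mono_kernel:
  assumes "AE z in lborel. a z \<le> b z"
  shows "integral_op a \<phi> x \<le> integral_op b \<phi> x" "jump_op a v \<phi> x \<le> jump_op b v \<phi> x"
  unfolding integral_op_def jump_op_def by (intro conv_mono_left_AE assms)+

section \<open>The resolvent equation between rate 0 and rate \<open>l\<close>\<close>

context resolvent_kernel
begin

sublocale K: green_kernels k v
  by unfold_locales (auto simp: k_nonpos v_nonpos)

sublocale L: green_kernels kl v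
  by unfold_locales (auto simp: kl_nonpos v_nonpos)

text \<open>A convolution of two functions that vanish on the nonpositive half-line vanishes there
  too, so the cut-off inside \<open>integral_op\<close> has no effect.\<close>

lemma integral_op_conv_k:
  assumes "\<And>z. z \<le> 0 \<Longrightarrow> \<psi> z = 0"
  shows "integral_op kl (conv k \<psi>) = conv kl (conv k \<psi>)"
proof -
  have "(\<lambda>z. conv k \<psi> z * indicator {0<..} z) = conv k \<psi>"
    using conv_nonpos[OF k_nonpos assms] by (auto simp: indicator_def fun_eq_iff)
  then show ?thesis by (simp add: integral_op_def)
qed

lemma integral_op_resolvent:
  assumes [measurable]: "\<phi> \<in> borel_measurable borel"
  shows "integral_op k \<phi> x = integral_op kl \<phi> x + ennreal l * integral_op kl (integral_op k \<phi>) x"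
  using conv_resolvent[of "\<lambda>z. \<phi> z * indicator {0<..} z" x] integral_op_conv_k[of "\<lambda>z. \<phi> z * indicator {0<..} z"]
  by (simp add: integral_op_def)

lemma jump_op_resolvent:
  assumes [measurable]: "\<phi> \<in> borel_measurable borel"
  shows "jump_op k v \<phi> x = jump_op kl v \<phi> x + ennreal l * integral_op kl (jump_op k v \<phi>) x"
  using conv_resolvent[of "\<lambda>z. v z * \<phi> z" x] integral_op_conv_k[of "\<lambda>z. v z * \<phi> z"] v_nonpos
  by (simp add: jump_op_def)

lemma jump_op_pow_le: "(jump_op kl v ^^ n) u x \<le> (jump_op k v ^^ n) u x"
proof (induction n arbitrary: x)
  case (Suc n)
  have "jump_op kl v ((jump_op kl v ^^ n) u) x \<le> jump_op kl v ((jump_op k v ^^ n) u) x"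
    using Suc by (intro L.jump_op_mono) auto
  also have "\<dots> \<le> jump_op k v ((jump_op k v ^^ n) u) x"
    by (rule conv_op_mono_kernel[OF kl_le_k])
  finally show ?case by simp
qed simp

lemma green_op_le: "green_op kl v \<phi> x \<le> green_op k v \<phi> x"
  unfolding green_op_def
proof (rule suminf_le)
  fix n
  have "(jump_op kl v ^^ n) (integral_op kl \<phi>) x \<le> (jump_op kl v ^^ n) (integral_op k \<phi>) x"
    by (intro L.jump_op_pow_mono conv_op_mono_kernel kl_le_k)
  also have "\<dots> \<le> (jump_op k v ^^ n) (integral_op k \<phi>) x" by (rule jump_op_pow_le)
  finally show "(jump_op kl v ^^ n) (integral_op kl \<phi>) x \<le> (jump_op k v ^^ n) (integral_op k \<phi>) x" .
qed auto

text \<open>\<open>u = green_op k v \<phi>\<close> solves the fixed point equation of rate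
  \<open>l\<close> with source \<open>\<phi> + l * u\<close>. It is the Green function of that
  source once the iterates of \<open>jump_op kl v\<close> on \<open>u\<close> vanish. They are
  dominated by those of \<open>jump_op k v\<close>, which are the tails of the series defining
  \<open>u x\<close>; they tend to 0 because \<open>u x\<close> is finite.\<close>

lemma green_op_resolvent:
  assumes [measurable]: "\<phi> \<in> borel_measurable borel" and fin: "green_op k v \<phi> x < \<infinity>"
  shows "green_op k v \<phi> x = green_op kl v (\<lambda>z. \<phi> z + ennreal l * green_op k v \<phi> z) x"
proof -
  define u where "u = green_op k v \<phi>"
  have [measurable]: "u \<in> borel_measurable borel" by (simp add: u_def)
  define \<psi> where "\<psi> z = \<phi> z + ennreal l * u z" for z
  have [measurable]: "\<psi> \<in> borel_measurable borel" by (simp add: \<psi>_def[abs_def])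
  have u: "u y = integral_op k \<phi> y + jump_op k v u y" for y
    unfolding u_def by (rule K.green_op_unfold) simp
  have u': "u y = integral_op kl \<psi> y + jump_op kl v u y" for y
  proof -
    have uu: "integral_op kl u = (\<lambda>y. integral_op kl (integral_op k \<phi>) y + integral_op kl (jump_op k v u) y)"
      by (subst L.integral_op_add[symmetric]) (simp_all add: u[symmetric])
    have "integral_op kl \<psi> y = integral_op kl \<phi> y + ennreal l * integral_op kl u y"
      unfolding \<psi>_def by (simp add: L.integral_op_add L.integral_op_cmult)
    then have "integral_op kl \<psi> y + jump_op kl v u y =
        (integral_op kl \<phi> y + ennreal l * integral_op kl (integral_op k \<phi>) y) +
        (jump_op kl v u y + ennreal l * integral_op kl (jump_op k v u) y)"
      unfolding uu by (simp add: distrib_left add_ac)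
    also have "\<dots> = integral_op k \<phi> y + jump_op k v u y"
      by (simp add: integral_op_resolvent[symmetric] jump_op_resolvent[symmetric])
    finally show ?thesis using u by simp
  qed
  have tail: "(\<lambda>n. (jump_op k v ^^ n) u x) \<longlonglongrightarrow> 0"
  proof -
    let ?s = "\<lambda>n. \<Sum>i<n. (jump_op k v ^^ i) (integral_op k \<phi>) x"
    have "?s \<longlonglongrightarrow> u x"
      unfolding u_def green_op_def by (rule summable_LIMSEQ) (rule summableI)
    then have "(\<lambda>n. u x - ?s n) \<longlonglongrightarrow> u x - u x"
      using fin by (intro tendsto_diff_ennreal) (auto simp: u_def)
    moreover have "u x - ?s n = (jump_op k v ^^ n) u x" for n
    proof -
      have e: "u x = ?s n + (jump_op k v ^^ n) u x"
        by (rule K.fixpoint_unfold[OF _ _ u]) simp_all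
      have "?s n \<le> u x" unfolding e by simp
      also have "u x < top" using fin by (simp add: u_def)
      finally have "?s n \<noteq> top" by (rule less_imp_neq)
      then have "?s n + (jump_op k v ^^ n) u x - ?s n = (jump_op k v ^^ n) u x"
        by (rule ennreal_add_diff_cancel_left)
      then show ?thesis using e by simp
    qed
    ultimately show ?thesis using fin by (simp add: u_def[symmetric])
  qed
  have "(\<lambda>n. (jump_op kl v ^^ n) u x) \<longlonglongrightarrow> 0"
    by (rule tendsto_sandwich[OF _ _ tendsto_const tail]) (auto simp: jump_op_pow_le)
  moreover have "(\<lambda>n. \<Sum>i<n. (jump_op kl v ^^ i) (integral_op kl \<psi>) x) \<longlonglongrightarrow> green_op kl v \<psi> x"
    unfolding green_op_def by (rule summable_LIMSEQ) (rule summableI)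
  ultimately have "(\<lambda>n. (\<Sum>i<n. (jump_op kl v ^^ i) (integral_op kl \<psi>) x) + (jump_op kl v ^^ n) u x) \<longlonglongrightarrow> green_op kl v \<psi> x + 0"
    by (intro tendsto_add)
  moreover have "(\<lambda>n. (\<Sum>i<n. (jump_op kl v ^^ i) (integral_op kl \<psi>) x) + (jump_op kl v ^^ n) u x) = (\<lambda>n. u x)"
    by (intro ext L.fixpoint_unfold[OF _ _ u', symmetric]) simp_all
  ultimately have "u x = green_op kl v \<psi> x"
    using LIMSEQ_unique[OF tendsto_const] by simp
  then show ?thesis by (simp add: u_def \<psi>_def[abs_def])
qed

end

section \<open>Supersolutions and decay of the iterated Green operators\<close>

context sonine_kernels
begin

definition kint :: "real \<Rightarrow> ennreal" where
  "kint y = (\<integral>\<^sup>+z. k z * indicator {..<y} z \<partial>lborel)"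

lemma kint_mono: "x \<le> y \<Longrightarrow> kint x \<le> kint y"
  unfolding kint_def by (intro nn_integral_mono mult_left_mono) (auto simp: indicator_def)

text \<open>The indicator of \<open>z < y\<close> is at most \<open>exp (y - z)\<close>, which
  bounds the integral by \<open>exp y\<close> times the transform of \<open>k\<close> at 1.\<close>

lemma kint_finite: "kint y < \<infinity>"
proof -
  have "kint y \<le> (\<integral>\<^sup>+z. ennreal (exp y) * (ennreal (exp (- 1 * z)) * k z) \<partial>lborel)"
    unfolding kint_def
  proof (rule nn_integral_mono)
    fix z
    have "k z * indicator {..<y} z \<le> ennreal (exp (y - z)) * k z"
    proof (cases "z < y")
      case True
      then have "ennreal 1 \<le> ennreal (exp (y - z))" by (intro ennreal_leI) simp
      then show ?thesis using True mult_right_mono[of 1 "ennreal (exp (y - z))" "k z"] by simp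
    qed simp
    also have "\<dots> = ennreal (exp y) * (ennreal (exp (- 1 * z)) * k z)"
      by (simp add: mult.assoc[symmetric] ennreal_mult[symmetric] exp_diff exp_minus divide_inverse)
    finally show "k z * indicator {..<y} z \<le> ennreal (exp y) * (ennreal (exp (- 1 * z)) * k z)" .
  qed
  also have "\<dots> = ennreal (exp y) * ennreal (1 / f 1)"
    by (subst nn_integral_cmult) (simp, simp only: laplace_k[OF zero_less_one])
  also have "\<dots> < \<infinity>" by (simp add: ennreal_mult_less_top)
  finally show ?thesis .
qed

lemma measurable_kint[measurable]: "kint \<in> borel_measurable borel"
proof -
  have "kint = conv k (indicator {0<..})"
    unfolding kint_def[abs_def] conv_def[abs_def] by (intro ext nn_integral_cong) (simp add: indicator_def)
  then show ?thesis by simp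
qed

end

text \<open>The condition on \<open>v y * \<integral>\<^sub>0\<^sup>y k\<close> makes \<open>C * (\<integral>\<^sub>0\<^sup>x k) * exp (c * x)\<close> a supersolution for large
  \<open>c\<close>, because the Laplace transform of \<open>k\<close> at \<open>c\<close> tends to \<open>0\<close>.\<close>

locale contracting_kernels = sonine_kernels +
  fixes \<theta> \<delta> T :: real
  assumes \<theta>: "0 \<le> \<theta>" "\<theta> < 1" and \<delta>: "0 < \<delta>" and T: "0 < T"
    and small: "\<And>y. 0 < y \<Longrightarrow> y < \<delta> \<Longrightarrow> v y * (\<integral>\<^sup>+z. k z * indicator {..<y} z \<partial>lborel) \<le> ennreal \<theta>"
    and f_at_top: "filterlim f at_top at_top"
begin

lemma supersolution:
  assumes \<kappa>: "0 \<le> \<kappa>"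
  obtains W B where "W \<in> borel_measurable borel" "\<And>x. x \<le> T \<Longrightarrow> W x \<le> ennreal B"
    "\<And>x. 0 < x \<Longrightarrow> x \<le> T \<Longrightarrow> integral_op k (\<lambda>z. ennreal \<kappa> * (1 + W z)) x + jump_op k v W x \<le> W x"
proof -
  define N where "N = enn2real (v \<delta>)"
  have N: "v \<delta> = ennreal N" "0 \<le> N" using v_finite[of \<delta>] by (simp_all add: N_def)
  \<comment> \<open>With this \<open>c\<close>, the part that \<theta> does not control is
    multiplied by \<open>1 / f c\<close>, the transform of \<open>k\<close> at \<open>c\<close>, and
    then takes at most half of the gap \<open>1 - \<theta>\<close>.\<close>
  have "\<forall>\<^sub>F c in at_top. 2 * (\<kappa> + N) / (1 - \<theta>) < f c"
    using f_at_top by (simp add: filterlim_at_top_dense)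
  then have "\<exists>c. 2 * (\<kappa> + N) / (1 - \<theta>) < f c \<and> 0 < c"
    using eventually_happens[OF eventually_conj[OF _ eventually_gt_at_top[of 0]]] by auto
  then obtain c where c: "2 * (\<kappa> + N) / (1 - \<theta>) < f c" "0 < c" by auto
  \<comment> \<open>The other half of the gap pays for the source:
    \<open>\<kappa> = C * (1 - \<theta>) / 2\<close>.\<close>
  define C where "C = 2 * \<kappa> / (1 - \<theta>)"
  have C: "0 \<le> C" using \<kappa> \<theta> by (simp add: C_def)
  define e where "e = (\<kappa> + N) / f c"
  have e: "0 \<le> e" "e \<le> (1 - \<theta>) / 2"
    using c \<kappa> N f_pos'[of c] \<theta> by (simp_all add: e_def field_simps)
  have CC: "\<kappa> + C * \<theta> + C * e \<le> C"
  proof -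
    have "C * e \<le> C * ((1 - \<theta>) / 2)" using e C by (intro mult_left_mono) auto
    moreover have "\<kappa> = C * (1 - \<theta>) / 2" using \<theta> by (simp add: C_def)
    ultimately show ?thesis by (simp add: algebra_simps)
  qed
  define W where "W x = ennreal C * kint x * ennreal (exp (c * x))" for x
  have Wm[measurable]: "W \<in> borel_measurable borel" unfolding W_def[abs_def] by measurable
  have bound: "W x \<le> ennreal (C * enn2real (kint T) * exp (c * T))" if "x \<le> T" for x
  proof -
    have "W x \<le> ennreal C * kint T * ennreal (exp (c * T))"
      unfolding W_def using that c by (intro mult_mono kint_mono ennreal_leI) auto
    also have "\<dots> = ennreal (C * enn2real (kint T) * exp (c * T))"
      using C kint_finite[of T] by (simp add: ennreal_mult)
    finally show ?thesis .
  qed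
  have super: "integral_op k (\<lambda>z. ennreal \<kappa> * (1 + W z)) x + jump_op k v W x \<le> W x" if x: "0 < x" for x
  proof -
    define H where "H = enn2real (kint x)"
    have H: "kint x = ennreal H" "0 \<le> H" using kint_finite[of x] by (simp_all add: H_def)
    define A where "A = \<kappa> + C * \<theta> * exp (c * x)"
    define D where "D = (\<kappa> + N) * C * H * exp (c * x)"
    have AD: "0 \<le> A" "0 \<le> D" using \<kappa> C \<theta> N H by (simp_all add: A_def D_def)
    \<comment> \<open>\<open>W (x - z)\<close> carries the factor
      \<open>exp (c * x) * exp (- c * z)\<close>. In the part with \<theta> the last factor is
      estimated by 1 and \<open>k\<close> is integrated over \<open>(0,x)\<close>; the remaining
      part keeps it, so that its integral against \<open>k\<close> is the small number
      \<open>1 / f c\<close>.\<close>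
    have pt: "k z * (ennreal \<kappa> * (1 + W (x - z)) * indicator {0<..} (x - z)) + k z * (v (x - z) * W (x - z))
        \<le> ennreal A * (k z * indicator {..<x} z) + ennreal D * (ennreal (exp (- c * z)) * k z)" for z
    proof (cases "0 < z \<and> z < x")
      case False
      then have "k z = 0 \<or> x - z \<le> 0" using k_nonpos[of z] by auto
      then show ?thesis using v_nonpos[of "x - z"] by (auto simp: indicator_def)
    next
      case True
      define r where "r = x - z"
      define h where "h = enn2real (kint r)"
      have h: "kint r = ennreal h" "0 \<le> h" using kint_finite[of r] by (simp_all add: h_def)
      have r: "0 < r" "r < x" using True by (auto simp: r_def)
      have hH: "h \<le> H" using kint_mono[of r x] r h H by simp
      \<comment> \<open>Near 0 the smallness hypothesis gives \<theta>. Beyond \<delta> the tail is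
        at most \<open>N = v \<delta>\<close> by monotonicity, and \<open>kint r\<close> is at most
        its value \<open>H\<close> at \<open>x\<close>.\<close>
      have "v r * kint r \<le> ennreal \<theta> + ennreal N * ennreal H"
      proof (cases "r < \<delta>")
        case True
        then have "v r * kint r \<le> ennreal \<theta>" using small[of r] r by (simp add: kint_def)
        then show ?thesis by (simp add: add_increasing2)
      next
        case False
        then have "v r * kint r \<le> ennreal N * ennreal H"
          using v_antimono[of \<delta> r] \<delta> kint_mono[of r x] r unfolding N(1)[symmetric] H(1)[symmetric] by (intro mult_mono) auto
        then show ?thesis by (simp add: add_increasing)
      qed
      then have "v r * kint r * ennreal (C * exp (c * r)) \<le> (ennreal \<theta> + ennreal N * ennreal H) * ennreal (C * exp (c * r))"
        by (rule mult_right_mono) simp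
      also have "(ennreal \<theta> + ennreal N * ennreal H) * ennreal (C * exp (c * r)) = ennreal ((\<theta> + N * H) * (C * exp (c * r)))"
        using \<theta> N H C by (simp add: ennreal_mult[symmetric] ennreal_plus[symmetric] del: ennreal_plus)
      finally have vW: "v r * W r \<le> ennreal ((\<theta> + N * H) * (C * exp (c * r)))"
        using C by (simp add: W_def ennreal_mult mult_ac)
      have W1: "ennreal \<kappa> * (1 + W r) \<le> ennreal (\<kappa> + \<kappa> * (C * H * exp (c * r)))"
      proof -
        have "W r = ennreal (C * h * exp (c * r))" using C h by (simp add: W_def ennreal_mult)
        then have "ennreal \<kappa> * (1 + W r) = ennreal (\<kappa> * (1 + C * h * exp (c * r)))"
          using C h \<kappa> by (simp add: ennreal_mult)
        also have "\<dots> \<le> ennreal (\<kappa> * (1 + C * H * exp (c * r)))"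
          using \<kappa> C hH by (intro ennreal_leI mult_left_mono add_left_mono mult_right_mono) auto
        finally show ?thesis by (simp add: distrib_left)
      qed
      have er: "exp (c * r) = exp (c * x) * exp (- c * z)" by (simp add: r_def exp_add[symmetric] algebra_simps)
      have ez: "exp (- c * z) \<le> 1" using True c by simp
      have "ennreal \<kappa> * (1 + W r) + v r * W r \<le> ennreal (\<kappa> + \<kappa> * (C * H * exp (c * r)) + (\<theta> + N * H) * (C * exp (c * r)))"
        using add_mono[OF W1 vW] \<kappa> C H \<theta> N by (simp add: ennreal_plus[symmetric] del: ennreal_plus)
      also have "\<dots> \<le> ennreal (A + D * exp (- c * z))"
      proof (rule ennreal_leI)
        have "C * \<theta> * exp (c * x) * exp (- c * z) \<le> C * \<theta> * exp (c * x) * 1"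
          using C \<theta> ez by (intro mult_left_mono) auto
        then show "\<kappa> + \<kappa> * (C * H * exp (c * r)) + (\<theta> + N * H) * (C * exp (c * r)) \<le> A + D * exp (- c * z)"
          unfolding er A_def D_def by (simp add: algebra_simps)
      qed
      finally have "k z * (ennreal \<kappa> * (1 + W r) + v r * W r) \<le> k z * ennreal (A + D * exp (- c * z))"
        by (rule mult_left_mono) simp
      then show ?thesis using True AD
        by (simp add: r_def[symmetric] r distrib_left ennreal_mult mult_ac)
    qed
    have "integral_op k (\<lambda>z. ennreal \<kappa> * (1 + W z)) x + jump_op k v W x =
        (\<integral>\<^sup>+z. k z * (ennreal \<kappa> * (1 + W (x - z)) * indicator {0<..} (x - z)) + k z * (v (x - z) * W (x - z)) \<partial>lborel)"
      unfolding integral_op_def jump_op_def conv_def by (rule nn_integral_add[symmetric]) simp_all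
    also have "\<dots> \<le> (\<integral>\<^sup>+z. ennreal A * (k z * indicator {..<x} z) + ennreal D * (ennreal (exp (- c * z)) * k z) \<partial>lborel)"
      by (rule nn_integral_mono) (rule pt)
    also have "\<dots> = ennreal A * kint x + ennreal D * (\<integral>\<^sup>+z. ennreal (exp (- c * z)) * k z \<partial>lborel)"
      unfolding kint_def by (subst nn_integral_add) (simp_all add: nn_integral_cmult del: mult_minus_left)
    also have "\<dots> = ennreal A * ennreal H + ennreal D * ennreal (1 / f c)"
      by (simp only: laplace_k[OF c(2)] H)
    also have "\<dots> = ennreal (A * H + D * (1 / f c))"
      using AD H f_pos'[OF c(2)] by (simp add: ennreal_mult[symmetric] ennreal_plus[symmetric] del: ennreal_plus)
    also have "\<dots> \<le> ennreal (C * H * exp (c * x))"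
    proof (rule ennreal_leI)
      have "\<kappa> * 1 \<le> \<kappa> * exp (c * x)" using \<kappa> c x by (intro mult_left_mono) auto
      then have "A \<le> (\<kappa> + C * \<theta>) * exp (c * x)" by (simp add: A_def algebra_simps)
      then have "A * H \<le> (\<kappa> + C * \<theta>) * exp (c * x) * H" using H by (intro mult_right_mono) auto
      moreover have "D * (1 / f c) = C * e * exp (c * x) * H" by (simp add: D_def e_def)
      moreover have "(\<kappa> + C * \<theta> + C * e) * (exp (c * x) * H) \<le> C * (exp (c * x) * H)"
        using CC H by (intro mult_right_mono) auto
      ultimately show "A * H + D * (1 / f c) \<le> C * H * exp (c * x)" by (simp add: algebra_simps)
    qed
    also have "\<dots> = W x" using C H by (simp add: W_def ennreal_mult)
    finally show ?thesis .
  qed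
  show thesis by (rule that[OF Wm bound]) (auto intro: super)
qed

sublocale K: green_kernels k v
  by unfold_locales (auto simp: k_nonpos v_nonpos)

text \<open>The source \<open>\<kappa> * (1 + W)\<close> in the supersolution inequality is made for
  this induction: it says that \<kappa> times the Green function of \<open>1 + W\<close> is at most
  \<open>W\<close>, so the bound \<open>1 + W\<close> reproduces itself.\<close>

lemma green_op_pow_bound:
  assumes \<kappa>: "0 \<le> \<kappa>"
  obtains B where "0 \<le> B" "\<And>n x. 0 < x \<Longrightarrow> x \<le> T \<Longrightarrow> ennreal (\<kappa> ^ n) * (green_op k v ^^ n) (\<lambda>_. 1) x \<le> ennreal B"
proof -
  obtain W B where W[measurable]: "W \<in> borel_measurable borel" and B: "\<And>x. x \<le> T \<Longrightarrow> W x \<le> ennreal B"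
    and s: "\<And>x. 0 < x \<Longrightarrow> x \<le> T \<Longrightarrow> integral_op k (\<lambda>z. ennreal \<kappa> * (1 + W z)) x + jump_op k v W x \<le> W x"
    using supersolution[OF \<kappa>] by metis
  have G: "ennreal \<kappa> * green_op k v (\<lambda>z. 1 + W z) x \<le> W x" if "0 < x" "x \<le> T" for x
    using K.green_op_le_supersolution[OF _ W s that] by (simp add: K.green_op_cmult)
  have le: "ennreal (\<kappa> ^ n) * (green_op k v ^^ n) (\<lambda>_. 1) x \<le> 1 + W x" if "0 < x" "x \<le> T" for n x
    using that
  proof (induction n arbitrary: x)
    case (Suc n)
    have "ennreal (\<kappa> ^ Suc n) * (green_op k v ^^ Suc n) (\<lambda>_. 1) x =
        ennreal \<kappa> * green_op k v (\<lambda>z. ennreal (\<kappa> ^ n) * (green_op k v ^^ n) (\<lambda>_. 1) z) x"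
      using \<kappa> by (simp add: K.green_op_cmult ennreal_mult mult.assoc)
    also have "\<dots> \<le> ennreal \<kappa> * green_op k v (\<lambda>z. 1 + W z) x"
      using Suc by (intro mult_left_mono K.green_op_mono) auto
    also have "\<dots> \<le> W x" using Suc.prems by (rule G)
    also have "\<dots> \<le> 1 + W x" by (simp add: add_increasing)
    finally show ?case .
  qed simp
  have "ennreal (\<kappa> ^ n) * (green_op k v ^^ n) (\<lambda>_. 1) x \<le> ennreal (1 + max 0 B)" if "0 < x" "x \<le> T" for n x
  proof -
    have "1 + W x \<le> 1 + ennreal (max 0 B)"
      using B[OF that(2)] by (intro add_left_mono) (metis ennreal_leI max.cobounded2 order_trans)
    also have "\<dots> = ennreal (1 + max 0 B)" by simp
    finally show ?thesis using le[OF that, of n] order_trans by blast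
  qed
  then show thesis by (intro that[of "1 + max 0 B"]) auto
qed

lemma green_op_pow_finite:
  assumes [measurable]: "\<phi> \<in> borel_measurable borel"
    and \<phi>: "\<And>z. 0 < z \<Longrightarrow> z \<le> T \<Longrightarrow> \<phi> z \<le> ennreal C" and C: "0 \<le> C" and \<kappa>: "0 < \<kappa>"
  obtains B where "0 \<le> B" "\<And>n x. 0 < x \<Longrightarrow> x \<le> T \<Longrightarrow> (green_op k v ^^ n) \<phi> x \<le> ennreal (B / \<kappa> ^ n)"
proof -
  obtain B where B: "0 \<le> B" "\<And>n x. 0 < x \<Longrightarrow> x \<le> T \<Longrightarrow> ennreal (\<kappa> ^ n) * (green_op k v ^^ n) (\<lambda>_. 1) x \<le> ennreal B"
    using green_op_pow_bound[of \<kappa>] \<kappa> by (metis less_imp_le)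
  have "(green_op k v ^^ n) \<phi> x \<le> ennreal (C * B / \<kappa> ^ n)" if x: "0 < x" "x \<le> T" for n x
  proof -
    have "(green_op k v ^^ n) \<phi> x \<le> (green_op k v ^^ n) (\<lambda>_. ennreal C * 1) x"
      using x by (intro K.green_op_pow_mono) (auto intro: \<phi>)
    also have "\<dots> = ennreal C * (green_op k v ^^ n) (\<lambda>_. 1) x"
      by (subst K.green_op_pow_cmult) simp_all
    also have "\<dots> = ennreal (C / \<kappa> ^ n) * (ennreal (\<kappa> ^ n) * (green_op k v ^^ n) (\<lambda>_. 1) x)"
      using \<kappa> C by (simp add: mult.assoc[symmetric] ennreal_mult[symmetric])
    also have "\<dots> \<le> ennreal (C / \<kappa> ^ n) * ennreal B"
      using B(2)[OF x] by (intro mult_left_mono) auto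
    also have "\<dots> = ennreal (C * B / \<kappa> ^ n)"
      using \<kappa> C B(1) by (simp add: ennreal_mult[symmetric])
    finally show ?thesis .
  qed
  then show thesis using C B(1) by (intro that[of "C * B"]) auto
qed

lemma green_op_power_series:
  assumes R: "resolvent_kernel f v k l kl"
    and [measurable]: "\<phi> \<in> borel_measurable borel"
    and \<phi>: "\<And>z. 0 < z \<Longrightarrow> z \<le> T \<Longrightarrow> \<phi> z \<le> ennreal C" and C: "0 \<le> C" and x: "0 < x" "x \<le> T"
  shows "(\<lambda>n. (- l) ^ n * enn2real ((green_op k v ^^ (n + 1)) \<phi> x)) sums enn2real (green_op kl v \<phi> x)"
    and "green_op kl v \<phi> x < \<infinity>"
proof -
  interpret R: resolvent_kernel f v k l kl by fact
  \<comment> \<open>Any positive rate above \<open>l\<close> makes \<open>l ^ m * a m\<close> tend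
    to 0; the summand 1 keeps it positive for \<open>l = 0\<close>.\<close>
  define \<kappa> where "\<kappa> = 2 * (l + 1)"
  have \<kappa>: "0 < \<kappa>" "l < \<kappa>" using R.l_nonneg by (auto simp: \<kappa>_def)
  obtain B where B: "0 \<le> B" "\<And>n x. 0 < x \<Longrightarrow> x \<le> T \<Longrightarrow> (green_op k v ^^ n) \<phi> x \<le> ennreal (B / \<kappa> ^ n)"
    using green_op_pow_finite[OF assms(2) \<phi> C \<kappa>(1)] by metis
  define b where "b n = (green_op k v ^^ n) \<phi>" for n
  have [measurable]: "b n \<in> borel_measurable borel" for n unfolding b_def by measurable
  have bS: "b (Suc n) = green_op k v (b n)" for n by (simp add: b_def)
  define a where "a n = enn2real (green_op kl v (b n) x)" for n
  have ab: "green_op kl v (b n) x \<le> b (Suc n) x" for n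
    unfolding bS by (rule R.green_op_le)
  have bfin: "b n x < \<infinity>" for n
    using B(2)[OF x, of n] by (auto simp: b_def intro: le_less_trans)
  have afin: "green_op kl v (b n) x < \<infinity>" for n
    using ab bfin by (rule le_less_trans)
  then show "green_op kl v \<phi> x < \<infinity>" by (metis b_def funpow_0)
  \<comment> \<open>The resolvent equation with source \<open>b n\<close>, split by linearity. In
    the alternating sum the terms \<open>l * a (Suc n)\<close> cancel against those of the next
    index.\<close>
  have rec: "enn2real (b (Suc n) x) = a n + l * a (Suc n)" for n
  proof -
    have "b (Suc n) x = green_op kl v (\<lambda>z. b n z + ennreal l * b (Suc n) z) x"
      unfolding bS by (rule R.green_op_resolvent) (use bfin[of "Suc n"] in \<open>simp_all add: bS\<close>)
    also have "\<dots> = green_op kl v (b n) x + ennreal l * green_op kl v (b (Suc n)) x"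
      by (simp add: R.L.green_op_add R.L.green_op_cmult)
    also have "\<dots> = ennreal (a n + l * a (Suc n))"
      using afin R.l_nonneg by (simp add: a_def ennreal_mult)
    finally show ?thesis using R.l_nonneg by (simp add: a_def del: ennreal_plus)
  qed
  have part: "(\<Sum>n<m. (- l) ^ n * enn2real (b (Suc n) x)) = a 0 - (- l) ^ m * a m" for m
    by (induction m) (simp_all add: rec algebra_simps)
  have "(\<lambda>m. (- l) ^ m * a m) \<longlonglongrightarrow> 0"
  proof (rule Lim_null_comparison)
    have aB: "a m \<le> B / \<kappa> ^ Suc m" for m
    proof -
      have "green_op kl v (b m) x \<le> ennreal (B / \<kappa> ^ Suc m)"
        using ab[of m] B(2)[OF x, of "Suc m"] by (simp add: b_def)
      then show ?thesis unfolding a_def using B(1) \<kappa> by (intro enn2real_leI) auto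
    qed
    have "norm ((- l) ^ m * a m) \<le> l ^ m * (B / \<kappa> ^ Suc m)" for m
    proof -
      have "norm ((- l) ^ m * a m) = l ^ m * a m"
        using R.l_nonneg by (simp add: abs_mult power_abs a_def)
      also have "\<dots> \<le> l ^ m * (B / \<kappa> ^ Suc m)"
        using R.l_nonneg aB[of m] by (intro mult_left_mono) auto
      finally show ?thesis .
    qed
    also have "l ^ m * (B / \<kappa> ^ Suc m) = B / \<kappa> * (l / \<kappa>) ^ m" for m
      by (simp add: power_divide)
    finally show "\<forall>\<^sub>F m in sequentially. norm ((- l) ^ m * a m) \<le> B / \<kappa> * (l / \<kappa>) ^ m" by simp
    have "(\<lambda>m. (l / \<kappa>) ^ m) \<longlonglongrightarrow> 0" using \<kappa> R.l_nonneg by (intro LIMSEQ_power_zero) auto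
    then show "(\<lambda>m. B / \<kappa> * (l / \<kappa>) ^ m) \<longlonglongrightarrow> 0" by (rule tendsto_mult_right_zero)
  qed
  then have "(\<lambda>m. a 0 - (- l) ^ m * a m) \<longlonglongrightarrow> a 0 - 0" by (intro tendsto_diff tendsto_const)
  then show "(\<lambda>n. (- l) ^ n * enn2real ((green_op k v ^^ (n + 1)) \<phi> x)) sums enn2real (green_op kl v \<phi> x)"
    unfolding sums_def using part by (simp add: b_def a_def)
qed

end

section \<open>The censored process\<close>

text \<open>Formulated on path space, so that the state after \<open>n\<close> steps is a measurable
  function of the paths with index below \<open>n\<close>. The condition copies the convention of
  \<open>censoring\<close>: for a finite time \<tau>, a strict increase means a positive waiting
  time.\<close>

definition censoring_step :: "(real \<Rightarrow> real) \<Rightarrow> ereal \<times> real \<Rightarrow> ereal \<times> real" where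
  "censoring_step w u = (fst u + passage w (snd u),
     if 0 < passage w (snd u) \<and> fst u + passage w (snd u) < \<infinity>
     then snd u - undershoot w (snd u) else snd u)"

primrec censoring_chain :: "(nat \<Rightarrow> real \<Rightarrow> real) \<Rightarrow> real \<Rightarrow> nat \<Rightarrow> ereal \<times> real" where
  "censoring_chain p x 0 = (0, x)"
| "censoring_chain p x (Suc n) = censoring_step (p n) (censoring_chain p x n)"

lemma censoring_chain_cong:
  "(\<And>i. i < n \<Longrightarrow> p i = p' i) \<Longrightarrow> censoring_chain p x n = censoring_chain p' x n"
  by (induction n) auto

lemma measurable_censoring_step[measurable (raw)]:
  assumes w: "w \<in> N \<rightarrow>\<^sub>M path_space" and u[measurable]: "u \<in> N \<rightarrow>\<^sub>M borel \<Otimes>\<^sub>M borel"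
  shows "(\<lambda>z. censoring_step (w z) (u z)) \<in> N \<rightarrow>\<^sub>M borel \<Otimes>\<^sub>M borel"
proof -
  have [measurable]: "(\<lambda>z. snd (u z)) \<in> borel_measurable N" "(\<lambda>z. fst (u z)) \<in> borel_measurable N"
    by measurable
  have [measurable]: "(\<lambda>z. passage (w z) (snd (u z))) \<in> borel_measurable N"
    "(\<lambda>z. undershoot (w z) (snd (u z))) \<in> borel_measurable N"
    by (intro measurable_passage measurable_undershoot w; measurable)+
  show ?thesis unfolding censoring_step_def by measurable
qed

lemma measurable_censoring_chain:
  assumes "{..<n} \<subseteq> I"
  shows "(\<lambda>p. censoring_chain p x n) \<in> (\<Pi>\<^sub>M i\<in>I. path_space) \<rightarrow>\<^sub>M borel \<Otimes>\<^sub>M borel"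
  using assms
proof (induction n)
  case (Suc n)
  have "(\<lambda>p. p n) \<in> (\<Pi>\<^sub>M i\<in>I. path_space) \<rightarrow>\<^sub>M path_space"
    by (rule measurable_component_singleton) (use Suc.prems in auto)
  moreover have "{..<n} \<subseteq> I" using Suc.prems by auto
  ultimately show ?case using Suc.IH by (auto intro!: measurable_censoring_step)
qed simp

lemma censoring_chain_nonneg:
  assumes "\<And>i. subordinator_path (p i)" "0 \<le> x"
  shows "0 \<le> fst (censoring_chain p x n)" "0 \<le> snd (censoring_chain p x n)" "snd (censoring_chain p x n) \<le> x"
proof -
  have "0 \<le> fst (censoring_chain p x n) \<and> 0 \<le> snd (censoring_chain p x n) \<and> snd (censoring_chain p x n) \<le> x"
  proof (induction n)
    case (Suc n)
    then show ?case
      using passage_nonneg undershoot_SUP(2)[OF assms(1)[of n]] undershoot_nonneg[OF assms(1)[of n]]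
      by (auto simp: censoring_step_def intro: order_trans[OF _ conjunct2[OF conjunct2[OF Suc]]])
  qed (use assms in auto)
  then show "0 \<le> fst (censoring_chain p x n)" "0 \<le> snd (censoring_chain p x n)" "snd (censoring_chain p x n) \<le> x"
    by auto
qed

text \<open>Moves the left limit at the passage time to absolute time \<open>r + s\<close>.
  Agreement of \<open>S\<close> and \<open>w\<close> at nonnegative times is enough, because
  \<open>t - r\<close> is positive for \<open>t\<close> close to \<open>r + s\<close>.\<close>

lemma Lim_at_left_path:
  assumes w: "subordinator_path w" and y: "0 \<le> y" and s: "passage w y = ereal s" "0 < s"
    and eq: "\<And>t. 0 \<le> t \<Longrightarrow> S t = w t"
  shows "Lim (at_left (r + s)) (\<lambda>t. y - S (t - r)) = y - undershoot w y"
proof (rule tendsto_Lim)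
  have lim: "filterlim (\<lambda>t. t - r) (at_left s) (at_left (r + s))"
    unfolding filterlim_at
  proof
    have "((\<lambda>t. t - r) \<longlongrightarrow> (r + s) - r) (at_left (r + s))" by (intro tendsto_intros)
    then show "((\<lambda>t. t - r) \<longlongrightarrow> s) (at_left (r + s))" by simp
    have "\<forall>\<^sub>F t in at_left (r + s). t < r + s" by (auto simp: eventually_at_filter)
    then show "\<forall>\<^sub>F t in at_left (r + s). t - r \<in> {..<s} \<and> t - r \<noteq> s"
      by eventually_elim auto
  qed
  have "((\<lambda>t. y - w (t - r)) \<longlongrightarrow> y - undershoot w y) (at_left (r + s))"
    by (intro tendsto_diff tendsto_const filterlim_compose[OF tendsto_undershoot[OF w y s] lim])
  moreover have "\<forall>\<^sub>F t in at_left (r + s). y - w (t - r) = y - S (t - r)"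
  proof -
    have "\<forall>\<^sub>F t in at_left (r + s). r < t" using s by (auto simp: eventually_at_left_field intro: exI[of _ r])
    then show ?thesis by eventually_elim (simp add: eq)
  qed
  ultimately show "((\<lambda>t. y - S (t - r)) \<longlongrightarrow> y - undershoot w y) (at_left (r + s))"
    by (rule Lim_transform_eventually)
qed simp

lemma discount_add:
  assumes "0 \<le> \<tau>" "0 \<le> \<sigma>" shows "discount l (\<tau> + \<sigma>) = discount l \<tau> * discount l \<sigma>"
  using assms by (cases \<tau>; cases \<sigma>) (auto simp: discount_def exp_add[symmetric] algebra_simps)

locale censored_resolvent = resolvent_kernel f v k l kl + prob_space M
  for f v k l kl and M :: "'w measure" +
  fixes S :: "nat \<Rightarrow> real \<Rightarrow> 'w \<Rightarrow> real" and x :: real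
  assumes indep: "independent_subordinators M f S" and x_pos: "0 < x"
begin

sublocale P: resolvent_subordinator f v k l kl M "S n" for n
  using indep by unfold_locales (auto simp: independent_subordinators_def f_pos')

definition chain :: "nat \<Rightarrow> 'w \<Rightarrow> ereal \<times> real" where
  "chain n \<omega> = censoring_chain (\<lambda>i. P.path i \<omega>) x n"

lemma chain_Suc: "chain (Suc n) \<omega> = censoring_step (P.path n \<omega>) (chain n \<omega>)"
  by (simp add: chain_def)

lemma chain_nonneg:
  assumes "\<omega> \<in> space M"
  shows "0 \<le> fst (chain n \<omega>)" "0 \<le> snd (chain n \<omega>)" "snd (chain n \<omega>) \<le> x"
  unfolding chain_def
  by (intro censoring_chain_nonneg P.subordinator_path_path assms less_imp_le x_pos)+

lemma measurable_chain[measurable]: "chain n \<in> M \<rightarrow>\<^sub>M borel \<Otimes>\<^sub>M borel"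
proof (induction n)
  case (Suc n)
  then have "(\<lambda>\<omega>. censoring_step (P.path n \<omega>) (chain n \<omega>)) \<in> M \<rightarrow>\<^sub>M borel \<Otimes>\<^sub>M borel"
    by (intro measurable_censoring_step P.measurable_path)
  then show ?case by (simp add: chain_Suc[abs_def])
qed (simp add: chain_def[abs_def])

text \<open>Joins the recursion written with the processes to the one on path space, for every
  \<omega> and not only almost surely.\<close>

lemma censoring_eq_chain:
  assumes \<omega>: "\<omega> \<in> space M"
  shows "censoring S x \<omega> n = chain n \<omega>"
proof (induction n)
  case (Suc n)
  define \<tau> y where "\<tau> = fst (chain n \<omega>)" and "y = snd (chain n \<omega>)"
  note P = P.subordinator_path_path[OF \<omega>, of n]
  have y: "0 \<le> y" "0 \<le> \<tau>" using chain_nonneg[OF \<omega>, of n] by (simp_all add: y_def \<tau>_def)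
  have eq: "P.path n \<omega> t = S n t \<omega>" if "0 \<le> t" for t using that by (simp add: P.path_def)
  have fp: "first_passage (S n) y \<omega> = passage (P.path n \<omega>) y"
    unfolding first_passage_def first_passage_eq_passage[OF P, symmetric]
    by (intro INF_cong) (auto simp: eq)
  have iff: "\<tau> < \<tau> + passage (P.path n \<omega>) y \<and> \<tau> + passage (P.path n \<omega>) y < \<infinity> \<longleftrightarrow>
      0 < passage (P.path n \<omega>) y \<and> \<tau> + passage (P.path n \<omega>) y < \<infinity>"
    using y passage_nonneg[of "P.path n \<omega>" y] by (cases \<tau>; cases "passage (P.path n \<omega>) y") auto
  have lim: "Lim (at_left (real_of_ereal (\<tau> + passage (P.path n \<omega>) y))) (\<lambda>t. y - S n (t - real_of_ereal \<tau>) \<omega>) =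
      y - undershoot (P.path n \<omega>) y"
    if pos: "0 < passage (P.path n \<omega>) y" "\<tau> + passage (P.path n \<omega>) y < \<infinity>"
  proof -
    obtain r s where rs: "\<tau> = ereal r" "passage (P.path n \<omega>) y = ereal s"
      using pos y by (cases \<tau>; cases "passage (P.path n \<omega>) y") auto
    then have "Lim (at_left (r + s)) (\<lambda>t. y - S n (t - r) \<omega>) = y - undershoot (P.path n \<omega>) y"
      using pos by (intro Lim_at_left_path[OF P y(1)]) (auto simp: eq)
    then show ?thesis by (simp add: rs)
  qed
  show ?case
    using lim iff
    by (simp add: Suc Let_def chain_Suc censoring_step_def \<tau>_def[symmetric] y_def[symmetric] fp)
qed (simp add: chain_def)

lemma chain_time_Suc: "fst (chain (Suc n) \<omega>) = fst (chain n \<omega>) + passage (P.path n \<omega>) (snd (chain n \<omega>))"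
  by (simp add: chain_Suc censoring_step_def)

lemma chain_time_mono:
  assumes "\<omega> \<in> space M" "m \<le> n" shows "fst (chain m \<omega>) \<le> fst (chain n \<omega>)"
  using assms(2)
proof (induction n rule: dec_induct)
  case (step n)
  have "fst (chain n \<omega>) \<le> fst (chain (Suc n) \<omega>)"
    unfolding chain_time_Suc using passage_nonneg by (simp add: add_increasing2)
  with step show ?case by simp
qed simp

text \<open>The state after \<open>n\<close> censorings depends on the paths with index below
  \<open>n\<close> only, hence is independent of path \<open>n\<close>, which may be integrated out
  separately. This plays the part of a Markov property at the censoring times.\<close>

lemma nn_integral_chain_path:
  assumes F[measurable]: "case_prod F \<in> borel_measurable ((borel \<Otimes>\<^sub>M borel) \<Otimes>\<^sub>M path_space)"
  shows "(\<integral>\<^sup>+\<omega>. F (chain n \<omega>) (P.path n \<omega>) \<partial>M) =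
    (\<integral>\<^sup>+\<omega>. \<integral>\<^sup>+\<omega>'. F (chain n \<omega>) (P.path n \<omega>') \<partial>M \<partial>M)"
proof -
  have "indep_vars (\<lambda>_. path_space) (\<lambda>n \<omega>. P.path n \<omega>) UNIV"
    using indep unfolding independent_subordinators_def P.path_def by simp
  then have ind: "indep_var (PiM {..<n} (\<lambda>_. path_space)) (\<lambda>\<omega>. restrict (\<lambda>i. P.path i \<omega>) {..<n})
      (PiM {n} (\<lambda>_. path_space)) (\<lambda>\<omega>. restrict (\<lambda>i. P.path i \<omega>) {n})"
    by (rule indep_var_restrict) auto
  define N1 where "N1 = PiM {..<n} (\<lambda>_. path_space)"
  define N2 where "N2 = PiM {n} (\<lambda>_. path_space)"
  define X where "X \<omega> = restrict (\<lambda>i. P.path i \<omega>) {..<n}" for \<omega>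
  define Y where "Y \<omega> = restrict (\<lambda>i. P.path i \<omega>) {n}" for \<omega>
  define F' where "F' p q = F (censoring_chain p x n) (q n)" for p q
  have X[measurable]: "X \<in> M \<rightarrow>\<^sub>M N1" and Y[measurable]: "Y \<in> M \<rightarrow>\<^sub>M N2"
    and d: "distr M N1 X \<Otimes>\<^sub>M distr M N2 Y = distr M (N1 \<Otimes>\<^sub>M N2) (\<lambda>\<omega>. (X \<omega>, Y \<omega>))"
    using ind unfolding indep_var_distribution_eq X_def N1_def Y_def N2_def by simp_all
  have [measurable]: "(\<lambda>p. censoring_chain p x n) \<in> N1 \<rightarrow>\<^sub>M borel \<Otimes>\<^sub>M borel"
    unfolding N1_def by (rule measurable_censoring_chain) simp
  have [measurable]: "(\<lambda>q. q n) \<in> N2 \<rightarrow>\<^sub>M path_space"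
    unfolding N2_def by (rule measurable_component_singleton) simp
  have F'm[measurable]: "case_prod F' \<in> borel_measurable (N1 \<Otimes>\<^sub>M N2)"
    unfolding F'_def by measurable
  have FXY: "F (chain n \<omega>) (P.path n \<omega>') = F' (X \<omega>) (Y \<omega>')" for \<omega> \<omega>'
  proof -
    have "censoring_chain (X \<omega>) x n = chain n \<omega>"
      unfolding chain_def by (rule censoring_chain_cong) (simp add: X_def)
    then show ?thesis by (simp add: F'_def Y_def)
  qed
  interpret D: prob_space "distr M N2 Y" by (rule prob_space_distr[OF Y])
  have "(\<integral>\<^sup>+\<omega>. F (chain n \<omega>) (P.path n \<omega>) \<partial>M) =
      (\<integral>\<^sup>+z. case_prod F' z \<partial>distr M (N1 \<Otimes>\<^sub>M N2) (\<lambda>\<omega>. (X \<omega>, Y \<omega>)))"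
    unfolding FXY by (subst nn_integral_distr) auto
  also have "\<dots> = (\<integral>\<^sup>+p. \<integral>\<^sup>+q. F' p q \<partial>distr M N2 Y \<partial>distr M N1 X)"
    unfolding d[symmetric] by (subst D.nn_integral_fst[symmetric]) auto
  also have "\<dots> = (\<integral>\<^sup>+\<omega>. \<integral>\<^sup>+q. F' (X \<omega>) q \<partial>distr M N2 Y \<partial>M)"
    by (subst nn_integral_distr) (auto intro!: D.borel_measurable_nn_integral)
  also have "\<dots> = (\<integral>\<^sup>+\<omega>. \<integral>\<^sup>+\<omega>'. F' (X \<omega>) (Y \<omega>') \<partial>M \<partial>M)"
  proof (rule nn_integral_cong)
    fix \<omega> assume "\<omega> \<in> space M"
    then have "X \<omega> \<in> space N1" by (rule measurable_space[OF X])
    then have "F' (X \<omega>) \<in> borel_measurable N2"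
      using measurable_compose_Pair1[OF _ F'm] by simp
    then show "(\<integral>\<^sup>+q. F' (X \<omega>) q \<partial>distr M N2 Y) = (\<integral>\<^sup>+\<omega>'. F' (X \<omega>) (Y \<omega>') \<partial>M)"
      by (intro nn_integral_distr[OF Y]) simp
  qed
  finally show ?thesis unfolding FXY .
qed

lemma nn_integral_chain:
  assumes "\<phi> \<in> borel_measurable borel"
  shows "(\<integral>\<^sup>+\<omega>. ennreal (discount l (fst (chain n \<omega>))) * (\<phi> (snd (chain n \<omega>)) * indicator {0<..} (snd (chain n \<omega>))) \<partial>M) =
    (jump_op kl v ^^ n) \<phi> x"
  using assms
proof (induction n arbitrary: \<phi>)
  case 0
  then show ?case using x_pos by (simp add: chain_def discount_def emeasure_space_1)
next
  case (Suc n)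
  note [measurable] = Suc.prems
  define F where "F u w = ennreal (discount l (fst (censoring_step w u))) *
      (\<phi> (snd (censoring_step w u)) * indicator {0<..} (snd (censoring_step w u)))" for u w
  have [measurable]: "(\<lambda>z. censoring_step (snd z) (fst z)) \<in> (borel \<Otimes>\<^sub>M borel) \<Otimes>\<^sub>M path_space \<rightarrow>\<^sub>M borel \<Otimes>\<^sub>M borel"
    by (rule measurable_censoring_step) measurable
  have Fm: "case_prod F \<in> borel_measurable ((borel \<Otimes>\<^sub>M borel) \<Otimes>\<^sub>M path_space)"
    unfolding F_def split_beta' by measurable
  have inner: "(\<integral>\<^sup>+\<omega>'. F (\<tau>, y) (P.path n \<omega>') \<partial>M) =
      ennreal (discount l \<tau>) * (jump_op kl v \<phi> y * indicator {0<..} y)" if \<tau>: "0 \<le> \<tau>" for \<tau> y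
  proof (cases "0 < y")
    case True
    have "F (\<tau>, y) (P.path n \<omega>') = ennreal (discount l \<tau>) * (ennreal (discount l (passage (P.path n \<omega>') y)) *
        (\<phi> (y - undershoot (P.path n \<omega>') y) * indicator {0<..} (y - undershoot (P.path n \<omega>') y)))" if "\<omega>' \<in> space M" for \<omega>'
    proof (cases "\<tau> + passage (P.path n \<omega>') y < \<infinity>")
      case fin: True
      then show ?thesis
        using passage_pos[OF P.subordinator_path_path[OF that] True] \<tau>
        by (simp add: F_def censoring_step_def discount_add passage_nonneg ennreal_mult discount_nonneg mult.assoc)
    next
      case False
      \<comment> \<open>An infinite time is discounted to 0 on both sides; by the convention in
        \<open>discount\<close> this holds for \<open>l = 0\<close> as well.\<close>
      then have "\<tau> = \<infinity> \<or> passage (P.path n \<omega>') y = \<infinity>" by auto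
      then show ?thesis
        using \<tau> passage_nonneg[of "P.path n \<omega>'" y] by (auto simp: F_def censoring_step_def discount_def)
    qed
    then have "(\<integral>\<^sup>+\<omega>'. F (\<tau>, y) (P.path n \<omega>') \<partial>M) = (\<integral>\<^sup>+\<omega>'. ennreal (discount l \<tau>) * (ennreal (discount l (passage (P.path n \<omega>') y)) *
        (\<phi> (y - undershoot (P.path n \<omega>') y) * indicator {0<..} (y - undershoot (P.path n \<omega>') y))) \<partial>M)"
      by (intro nn_integral_cong) simp
    also have "\<dots> = ennreal (discount l \<tau>) * (\<integral>\<^sup>+\<omega>'. (ennreal (discount l (passage (P.path n \<omega>') y)) *
        (\<phi> (y - undershoot (P.path n \<omega>') y) * indicator {0<..} (y - undershoot (P.path n \<omega>') y))) \<partial>M)"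
    proof (rule nn_integral_cmult)
      have [measurable]: "(\<lambda>\<omega>. passage (P.path n \<omega>) y) \<in> borel_measurable M"
        "(\<lambda>\<omega>. undershoot (P.path n \<omega>) y) \<in> borel_measurable M"
        by (intro measurable_passage measurable_undershoot P.measurable_path borel_measurable_const)+
      show "(\<lambda>\<omega>'. ennreal (discount l (passage (P.path n \<omega>') y)) *
        (\<phi> (y - undershoot (P.path n \<omega>') y) * indicator {0<..} (y - undershoot (P.path n \<omega>') y))) \<in> borel_measurable M"
        by measurable
    qed
    also have "\<dots> = ennreal (discount l \<tau>) * conv kl (\<lambda>z. v z * (\<phi> z * indicator {0<..} z)) y"
      by (subst P.nn_integral_undershoot[OF True]) auto
    also have "(\<lambda>z. v z * (\<phi> z * indicator {0<..} z)) = (\<lambda>z. v z * \<phi> z)"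
      using v_nonpos by (auto simp: indicator_def fun_eq_iff)
    finally show ?thesis using True by (simp add: jump_op_def)
  next
    case False
    have "F (\<tau>, y) (P.path n \<omega>') = 0" if "\<omega>' \<in> space M" for \<omega>'
      using False undershoot_nonneg[OF P.subordinator_path_path[OF that], of n y]
      by (simp add: F_def censoring_step_def indicator_def)
    then show ?thesis using False by (simp cong: nn_integral_cong)
  qed
  have "(\<integral>\<^sup>+\<omega>. ennreal (discount l (fst (chain (Suc n) \<omega>))) * (\<phi> (snd (chain (Suc n) \<omega>)) * indicator {0<..} (snd (chain (Suc n) \<omega>))) \<partial>M) =
      (\<integral>\<^sup>+\<omega>. \<integral>\<^sup>+\<omega>'. F (chain n \<omega>) (P.path n \<omega>') \<partial>M \<partial>M)"
    unfolding chain_Suc F_def[symmetric] by (rule nn_integral_chain_path[OF Fm])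
  also have "\<dots> = (\<integral>\<^sup>+\<omega>. ennreal (discount l (fst (chain n \<omega>))) *
      (jump_op kl v \<phi> (snd (chain n \<omega>)) * indicator {0<..} (snd (chain n \<omega>))) \<partial>M)"
  proof (rule nn_integral_cong)
    fix \<omega> assume "\<omega> \<in> space M"
    then show "(\<integral>\<^sup>+\<omega>'. F (chain n \<omega>) (P.path n \<omega>') \<partial>M) = ennreal (discount l (fst (chain n \<omega>))) *
        (jump_op kl v \<phi> (snd (chain n \<omega>)) * indicator {0<..} (snd (chain n \<omega>)))"
      using inner[of "fst (chain n \<omega>)" "snd (chain n \<omega>)"] chain_nonneg(1) by simp
  qed
  also have "\<dots> = (jump_op kl v ^^ n) (jump_op kl v \<phi>) x"
    by (rule Suc.IH) (rule L.measurable_jump_op[OF Suc.prems])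
  finally show ?case by (simp add: funpow_swap1)
qed

text \<open>Integrating out path \<open>n\<close> replaces the occupation by its mean
  \<open>integral_op kl \<phi>\<close>, evaluated at the position reached after \<open>n\<close>
  jumps.\<close>

lemma nn_integral_chain_occupation:
  assumes [measurable]: "\<phi> \<in> borel_measurable borel"
  shows "(\<integral>\<^sup>+\<omega>. ennreal (discount l (fst (chain n \<omega>))) * occupation l \<phi> (P.path n \<omega>) (snd (chain n \<omega>)) \<partial>M) =
    (jump_op kl v ^^ n) (integral_op kl \<phi>) x"
proof -
  define F where "F u w = ennreal (discount l (fst u)) * occupation l \<phi> w (snd u)" for u :: "ereal \<times> real" and w
  have "(\<lambda>z. occupation l \<phi> (snd z) (snd (fst z))) \<in> borel_measurable (((borel :: ereal measure) \<Otimes>\<^sub>M borel) \<Otimes>\<^sub>M path_space)"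
    by (rule measurable_occupation) measurable
  then have Fm: "case_prod F \<in> borel_measurable ((borel \<Otimes>\<^sub>M borel) \<Otimes>\<^sub>M path_space)"
    unfolding F_def split_beta' by measurable
  have "(\<integral>\<^sup>+\<omega>. ennreal (discount l (fst (chain n \<omega>))) * occupation l \<phi> (P.path n \<omega>) (snd (chain n \<omega>)) \<partial>M) =
      (\<integral>\<^sup>+\<omega>. \<integral>\<^sup>+\<omega>'. F (chain n \<omega>) (P.path n \<omega>') \<partial>M \<partial>M)"
    unfolding F_def[symmetric] by (rule nn_integral_chain_path[OF Fm])
  also have "\<dots> = (\<integral>\<^sup>+\<omega>. ennreal (discount l (fst (chain n \<omega>))) *
      (integral_op kl \<phi> (snd (chain n \<omega>)) * indicator {0<..} (snd (chain n \<omega>))) \<partial>M)"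
  proof (rule nn_integral_cong)
    fix \<omega> assume \<omega>: "\<omega> \<in> space M"
    let ?y = "snd (chain n \<omega>)"
    have "(\<integral>\<^sup>+\<omega>'. F (chain n \<omega>) (P.path n \<omega>') \<partial>M) =
        ennreal (discount l (fst (chain n \<omega>))) * (\<integral>\<^sup>+\<omega>'. occupation l \<phi> (P.path n \<omega>') ?y \<partial>M)"
      unfolding F_def
      by (rule nn_integral_cmult) (intro measurable_occupation P.measurable_path borel_measurable_const assms)
    also have "(\<integral>\<^sup>+\<omega>'. occupation l \<phi> (P.path n \<omega>') ?y \<partial>M) = integral_op kl \<phi> ?y"
      by (subst P.nn_integral_occupation) (simp_all add: integral_op_def)
    also have "\<dots> = integral_op kl \<phi> ?y * indicator {0<..} ?y"
    proof (cases "0 < ?y")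
      case False
      then have "integral_op kl \<phi> ?y = 0"
        unfolding integral_op_def by (intro conv_nonpos kl_nonpos) auto
      then show ?thesis by simp
    qed simp
    finally show "(\<integral>\<^sup>+\<omega>'. F (chain n \<omega>) (P.path n \<omega>') \<partial>M) =
        ennreal (discount l (fst (chain n \<omega>))) * (integral_op kl \<phi> ?y * indicator {0<..} ?y)" .
  qed
  also have "\<dots> = (jump_op kl v ^^ n) (integral_op kl \<phi>) x"
    by (rule nn_integral_chain) measurable
  finally show ?thesis .
qed

text \<open>The value of \<phi> at the current state while the process is alive, and 0 otherwise.
  Summing over all segments replaces the definite description in \<open>censored_process\<close> and
  makes joint measurability in \<omega> and time visible. The discount rate does not enter.\<close>

definition alive_sum :: "(real \<Rightarrow> ennreal) \<Rightarrow> 'w \<Rightarrow> real \<Rightarrow> ennreal" where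
  "alive_sum \<phi> \<omega> t = (\<Sum>n. if 0 \<le> t \<and> fst (chain n \<omega>) \<le> ereal t \<and> ereal t < fst (chain (Suc n) \<omega>)
     then \<phi> (snd (chain n \<omega>) - eval_path (t - real_of_ereal (fst (chain n \<omega>))) (P.path n \<omega>)) else 0)"

lemma lifetime_eq: "\<omega> \<in> space M \<Longrightarrow> lifetime S x \<omega> = (SUP n. fst (chain n \<omega>))"
  by (simp add: lifetime_def censoring_time_def censoring_eq_chain)

lemma lifetime_nonneg: "\<omega> \<in> space M \<Longrightarrow> 0 \<le> lifetime S x \<omega>"
  unfolding lifetime_eq by (rule SUP_upper2[of 0]) (auto simp: chain_def)

lemma measurable_lifetime[measurable]: "lifetime S x \<in> borel_measurable M"
proof -
  have "(\<lambda>\<omega>. SUP n. fst (chain n \<omega>)) \<in> borel_measurable M" by measurable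
  then show ?thesis by (subst measurable_cong[OF lifetime_eq]) auto
qed

lemma alive_sum_dead:
  assumes \<omega>: "\<omega> \<in> space M" and t: "t \<notin> lifetime_interval S x \<omega>"
  shows "alive_sum \<phi> \<omega> t = 0"
proof -
  have "\<not> (0 \<le> t \<and> ereal t < fst (chain n \<omega>))" for n
    using t SUP_upper[of n UNIV "\<lambda>n. fst (chain n \<omega>)"]
    by (auto simp: lifetime_interval_def lifetime_eq[OF \<omega>] dest: order.strict_trans2)
  then show ?thesis unfolding alive_sum_def by (intro suminf_eq_zero_iff[THEN iffD2]) (auto intro: summableI)
qed

text \<open>The censoring times are nondecreasing, start at 0 and have the lifetime as supremum, so
  exactly one interval contains \<open>t\<close>. One state serves all \<phi>; it may be 0, whence
  the weak lower bound.\<close>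

lemma alive_sum_alive:
  assumes \<omega>: "\<omega> \<in> space M" and t: "t \<in> lifetime_interval S x \<omega>"
  obtains y where "censored_process S x t \<omega> = Some y" "0 \<le> y" "y \<le> x" "\<And>\<phi>. alive_sum \<phi> \<omega> t = \<phi> y"
proof -
  define \<tau> where "\<tau> n = fst (chain n \<omega>)" for n
  have t0: "0 \<le> t" and tl: "ereal t < lifetime S x \<omega>" using t by (auto simp: lifetime_interval_def)
  have \<tau>0: "\<tau> 0 = 0" by (simp add: \<tau>_def chain_def)
  have mono: "\<tau> m \<le> \<tau> n" if "m \<le> n" for m n using chain_time_mono[OF \<omega> that] by (simp add: \<tau>_def)
  obtain N where N: "ereal t < \<tau> N" using tl by (auto simp: lifetime_eq[OF \<omega>] less_SUP_iff \<tau>_def)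
  \<comment> \<open>\<open>n0\<close> is positive because the initial censoring time is 0; its
    predecessor is the index of the segment that contains \<open>t\<close>.\<close>
  define n0 where "n0 = (LEAST n. ereal t < \<tau> n)"
  have n0: "ereal t < \<tau> n0" unfolding n0_def using N by (rule LeastI)
  have "n0 \<noteq> 0" using n0 t0 \<tau>0 by (metis ereal_less_eq(5) not_le)
  then obtain m where m: "n0 = Suc m" using not0_implies_Suc by blast
  have \<tau>m: "\<tau> m \<le> ereal t" using not_less_Least[of m "\<lambda>n. ereal t < \<tau> n"] m by (simp add: n0_def[symmetric] not_less)
  have uniq: "\<tau> n \<le> ereal t \<and> ereal t < \<tau> (Suc n) \<longleftrightarrow> n = m" for n
  proof
    assume n: "\<tau> n \<le> ereal t \<and> ereal t < \<tau> (Suc n)"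
    have "n < Suc m" using n n0 m mono[of "Suc m" n] by (meson not_le order.strict_trans2)
    moreover have "m < Suc n" using n \<tau>m mono[of "Suc n" m] by (meson not_le order.strict_trans2)
    ultimately show "n = m" by simp
  qed (use \<tau>m n0 m in simp)
  obtain r where r: "\<tau> m = ereal r" "0 \<le> r" "r \<le> t"
    using \<tau>m chain_nonneg(1)[OF \<omega>, of m] by (cases "\<tau> m") (auto simp: \<tau>_def)
  define y where "y = snd (chain m \<omega>) - S m (t - r) \<omega>"
  note P = P.subordinator_path_path[OF \<omega>, of m]
  have pS: "P.path m \<omega> (t - r) = S m (t - r) \<omega>" using r by (simp add: P.path_def)
  have "ereal t < ereal r + passage (P.path m \<omega>) (snd (chain m \<omega>))"
    using n0 m r chain_time_Suc[of m \<omega>] by (simp add: \<tau>_def)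
  then have "ereal (t - r) < passage (P.path m \<omega>) (snd (chain m \<omega>))"
    by (cases "passage (P.path m \<omega>) (snd (chain m \<omega>))") auto
  then have "S m (t - r) \<omega> \<le> snd (chain m \<omega>)"
    using path_le_before_passage[OF P, of "t - r"] r pS by simp
  then have y: "0 \<le> y" "y \<le> x"
    using chain_nonneg(3)[OF \<omega>, of m] P.S_nonneg[OF \<omega>, of "t - r" m] r by (simp_all add: y_def)
  have the: "(THE n. censoring_time S x n \<omega> \<le> ereal t \<and> ereal t < censoring_time S x (Suc n) \<omega>) = m"
    using uniq by (intro the_equality) (simp_all only: censoring_time_def censoring_eq_chain[OF \<omega>] \<tau>_def)
  have 1: "censored_process S x t \<omega> = Some y"
    unfolding censored_process_def the Let_def using tl r
    by (simp add: censoring_position_def censoring_time_def censoring_eq_chain[OF \<omega>] y_def \<tau>_def)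
  have 2: "alive_sum \<phi> \<omega> t = \<phi> y" for \<phi>
  proof -
    have "alive_sum \<phi> \<omega> t = (\<Sum>n. if n = m then \<phi> y else 0)"
      unfolding alive_sum_def
    proof (intro arg_cong[where f=suminf] ext)
      fix n
      show "(if 0 \<le> t \<and> fst (chain n \<omega>) \<le> ereal t \<and> ereal t < fst (chain (Suc n) \<omega>)
          then \<phi> (snd (chain n \<omega>) - eval_path (t - real_of_ereal (fst (chain n \<omega>))) (P.path n \<omega>)) else 0) =
          (if n = m then \<phi> y else 0)"
        using uniq[of n] t0 r P.eval_path_path[OF \<omega>, of "t - r" m] by (auto simp: \<tau>_def y_def)
    qed
    also have "\<dots> = (\<Sum>n\<in>{m}. if n = m then \<phi> y else 0)" by (rule suminf_finite) auto
    finally show ?thesis by simp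
  qed
  show thesis using that[OF 1 y 2] .
qed

lemma measurable_alive_term:
  assumes [measurable]: "\<phi> \<in> borel_measurable borel"
  shows "(\<lambda>z. if 0 \<le> snd z \<and> fst (chain n (fst z)) \<le> ereal (snd z) \<and> ereal (snd z) < fst (chain (Suc n) (fst z))
     then \<phi> (snd (chain n (fst z)) - eval_path (snd z - real_of_ereal (fst (chain n (fst z)))) (P.path n (fst z))) else 0)
    \<in> borel_measurable (M \<Otimes>\<^sub>M lborel)"
proof -
  have snd[measurable]: "snd \<in> borel_measurable (M \<Otimes>\<^sub>M lborel)"
    using measurable_snd[of M "lborel :: real measure"] by simp
  have chain[measurable]: "(\<lambda>z. chain n (fst z)) \<in> M \<Otimes>\<^sub>M lborel \<rightarrow>\<^sub>M borel \<Otimes>\<^sub>M borel" for n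
    by (rule measurable_compose[OF measurable_fst measurable_chain])
  have "(\<lambda>z. P.path n (fst z)) \<in> M \<Otimes>\<^sub>M lborel \<rightarrow>\<^sub>M path_space"
    by (rule measurable_compose[OF measurable_fst P.measurable_path])
  moreover have "(\<lambda>z. snd z - real_of_ereal (fst (chain n (fst z)))) \<in> borel_measurable (M \<Otimes>\<^sub>M lborel)"
    by measurable
  ultimately have [measurable]: "(\<lambda>z. eval_path (snd z - real_of_ereal (fst (chain n (fst z)))) (P.path n (fst z))) \<in> borel_measurable (M \<Otimes>\<^sub>M lborel)"
    by (rule measurable_eval_path)
  show ?thesis by measurable
qed

lemma measurable_alive_sum[measurable]:
  assumes "\<phi> \<in> borel_measurable borel"
  shows "(\<lambda>z. alive_sum \<phi> (fst z) (snd z)) \<in> borel_measurable (M \<Otimes>\<^sub>M lborel)"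
  unfolding alive_sum_def
  by (rule borel_measurable_suminf_order) (rule measurable_alive_term[OF assms])

text \<open>Shifting each interval so that it starts at 0 splits off the discount at the preceding
  censoring time and leaves the occupation of a fresh segment. An interval that starts at infinity
  is empty, in accordance with its discount 0.\<close>

lemma nn_integral_alive_sum:
  assumes \<phi>[measurable]: "\<phi> \<in> borel_measurable borel" and \<omega>: "\<omega> \<in> space M"
  shows "(\<integral>\<^sup>+t. ennreal (exp (- l * t)) * alive_sum \<phi> \<omega> t \<partial>lborel) =
    (\<Sum>n. ennreal (discount l (fst (chain n \<omega>))) * occupation l \<phi> (P.path n \<omega>) (snd (chain n \<omega>)))"
proof -
  define F where "F n t = (if 0 \<le> t \<and> fst (chain n \<omega>) \<le> ereal t \<and> ereal t < fst (chain (Suc n) \<omega>)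
     then \<phi> (snd (chain n \<omega>) - eval_path (t - real_of_ereal (fst (chain n \<omega>))) (P.path n \<omega>)) else 0)" for n t
  have [measurable]: "F n \<in> borel_measurable borel" for n
  proof -
    have "F n \<in> borel_measurable lborel"
      using measurable_compose_Pair1[OF \<omega> measurable_alive_term[OF \<phi>, of n]]
      unfolding F_def[abs_def] by (simp only: fst_conv snd_conv)
    then show ?thesis by simp
  qed
  have "(\<integral>\<^sup>+t. ennreal (exp (- l * t)) * alive_sum \<phi> \<omega> t \<partial>lborel) =
      (\<Sum>n. \<integral>\<^sup>+t. ennreal (exp (- l * t)) * F n t \<partial>lborel)"
    unfolding alive_sum_def F_def[symmetric] ennreal_suminf_cmult[symmetric]
    by (rule nn_integral_suminf) simp
  also have "\<dots> = (\<Sum>n. ennreal (discount l (fst (chain n \<omega>))) * occupation l \<phi> (P.path n \<omega>) (snd (chain n \<omega>)))"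
  proof (intro arg_cong[where f=suminf] ext)
    fix n
    let ?w = "P.path n \<omega>" and ?y = "snd (chain n \<omega>)"
    show "(\<integral>\<^sup>+t. ennreal (exp (- l * t)) * F n t \<partial>lborel) =
        ennreal (discount l (fst (chain n \<omega>))) * occupation l \<phi> ?w ?y"
    proof (cases "fst (chain n \<omega>)")
      case (real r)
      have r: "0 \<le> r" using chain_nonneg(1)[OF \<omega>, of n] real by simp
      define G where "G t = indicator {0..} t * indicator {..<passage ?w ?y} (ereal t) *
          ennreal (exp (- l * t)) * \<phi> (?y - eval_path t ?w)" for t
      have eq: "ennreal (exp (- l * t)) * F n t = ennreal (exp (- l * r)) * G (t - r)" for t
      proof -
        have "ereal t < ereal r + passage ?w ?y \<longleftrightarrow> ereal (t - r) < passage ?w ?y"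
          by (cases "passage ?w ?y") auto
        moreover have "ennreal (exp (- l * t)) = ennreal (exp (- l * r)) * ennreal (exp (- l * (t - r)))"
          by (simp add: ennreal_mult[symmetric] exp_add[symmetric] algebra_simps)
        ultimately show ?thesis
          using r real chain_time_Suc[of n \<omega>] by (auto simp: F_def G_def indicator_def mult.assoc)
      qed
      have Gm[measurable]: "G \<in> borel_measurable borel"
      proof -
        have [measurable]: "(\<lambda>t. eval_path t ?w) \<in> borel_measurable borel"
        proof -
          have w: "?w \<in> space path_space" using \<omega> by (rule measurable_space[OF P.measurable_path])
          show ?thesis by (rule measurable_eval_path) (use w in simp_all)
        qed
        have "(\<lambda>t. indicator {0..} t * (if ereal t < passage ?w ?y then 1 else 0) *
          ennreal (exp (- l * t)) * \<phi> (?y - eval_path t ?w)) \<in> borel_measurable borel" by measurable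
        then show ?thesis by (simp add: G_def[abs_def] indicator_def of_bool_def)
      qed
      have "(\<integral>\<^sup>+t. ennreal (exp (- l * t)) * F n t \<partial>lborel) = ennreal (exp (- l * r)) * (\<integral>\<^sup>+t. G (t - r) \<partial>lborel)"
        unfolding eq by (rule nn_integral_cmult) simp
      also have "(\<integral>\<^sup>+t. G (t - r) \<partial>lborel) = (\<integral>\<^sup>+t. G t \<partial>lborel)"
        by (rule nn_integral_lborel_shift) simp
      finally show ?thesis using real by (simp add: discount_def occupation_def G_def)
    next
      case PInf
      then have "F n t = 0" for t by (simp add: F_def)
      then show ?thesis using PInf by (simp add: discount_def)
    next
      case MInf
      then show ?thesis using chain_nonneg(1)[OF \<omega>, of n] by simp
    qed
  qed
  finally show ?thesis .
qed

text \<open>Term by term, the series over the segments is the one defining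
  \<open>green_op\<close>.\<close>

lemma expectation_alive_sum:
  assumes \<phi>[measurable]: "\<phi> \<in> borel_measurable borel"
  shows "(\<integral>\<^sup>+\<omega>. \<integral>\<^sup>+t. ennreal (exp (- l * t)) * alive_sum \<phi> \<omega> t \<partial>lborel \<partial>M) = green_op kl v \<phi> x"
proof -
  have occ: "(\<lambda>\<omega>. occupation l \<phi> (P.path n \<omega>) (snd (chain n \<omega>))) \<in> borel_measurable M" for n
    by (rule measurable_occupation[OF P.measurable_path _ \<phi>]) measurable
  have "(\<integral>\<^sup>+\<omega>. \<integral>\<^sup>+t. ennreal (exp (- l * t)) * alive_sum \<phi> \<omega> t \<partial>lborel \<partial>M) =
      (\<integral>\<^sup>+\<omega>. (\<Sum>n. ennreal (discount l (fst (chain n \<omega>))) * occupation l \<phi> (P.path n \<omega>) (snd (chain n \<omega>))) \<partial>M)"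
    by (rule nn_integral_cong) (rule nn_integral_alive_sum[OF \<phi>])
  also have "\<dots> = (\<Sum>n. \<integral>\<^sup>+\<omega>. ennreal (discount l (fst (chain n \<omega>))) * occupation l \<phi> (P.path n \<omega>) (snd (chain n \<omega>)) \<partial>M)"
    using occ by (intro nn_integral_suminf borel_measurable_times_ennreal) simp_all
  also have "\<dots> = green_op kl v \<phi> x"
    unfolding green_op_def by (simp add: nn_integral_chain_occupation)
  finally show ?thesis .
qed

end

text \<open>Lagrange's form of the remainder. Since the intermediate point lies in
  \<open>[0,y]\<close>, its factor lies between \<open>exp (- y)\<close> and 1, which is the
  two-sided estimate used for the moments.\<close>

lemma exp_minus_taylor:
  fixes y :: real
  assumes y: "0 \<le> y"
  obtains \<xi> where "0 \<le> \<xi>" "\<xi> \<le> y" "exp (- y) = (\<Sum>j<n. (- y) ^ j / fact j) + exp (- \<xi>) * ((- y) ^ n / fact n)"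
proof (cases "y = 0 \<or> n = 0")
  case True
  then show thesis
  proof
    assume "y = 0"
    then show thesis using that[of 0] by (cases n) (simp_all add: lessThan_Suc_eq_insert_0 sum.reindex)
  next
    assume "n = 0"
    then show thesis using that[of y] y by simp
  qed
next
  case False
  then have "- y < 0" "0 < n" using y by auto
  then obtain t where "- y < t" "t < 0" "exp (- y) = (\<Sum>m<n. exp 0 / fact m * (- y) ^ m) + exp t / fact n * (- y) ^ n"
    using Maclaurin_minus[of "- y" n "\<lambda>_. exp" exp] by (auto simp: DERIV_exp)
  then show thesis using that[of "- t"] by simp
qed

text \<open>The Taylor remainder of \<open>exp (- l * X)\<close>, divided by \<open>(- l) ^ n\<close>, lies between
  \<open>exp (- l * X) * X ^ n / n!\<close> and \<open>X ^ n / n!\<close>; let \<open>l\<close> tend to \<open>0\<close>.\<close>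

lemma moments_of_laplace_power_series:
  fixes m :: "'a measure" and X :: "'a \<Rightarrow> real" and c :: "nat \<Rightarrow> real"
  assumes [measurable]: "X \<in> borel_measurable m" and X: "AE z in m. 0 \<le> X z"
    and L: "\<And>l. 0 < l \<Longrightarrow> (\<integral>\<^sup>+z. ennreal (exp (- l * X z)) \<partial>m) = ennreal (r l)"
    and r: "\<And>l. 0 < l \<Longrightarrow> 0 \<le> r l"
    and s: "\<And>l. 0 < l \<Longrightarrow> (\<lambda>n. (- l) ^ n * c n) sums r l"
  shows "(\<integral>\<^sup>+z. ennreal (X z ^ n / fact n) \<partial>m) = ennreal (c n)" "0 \<le> c n"
proof -
  have "(\<integral>\<^sup>+z. ennreal (X z ^ n / fact n) \<partial>m) = ennreal (c n) \<and> 0 \<le> c n"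
  proof (induction n rule: less_induct)
    case (less n)
    have int: "has_bochner_integral m (\<lambda>z. X z ^ j / fact j) (c j)" if "j < n" for j
      using less[OF that] X
      by (intro has_bochner_integral_nn_integral) (auto elim!: eventually_mono)
    have int0: "has_bochner_integral m (\<lambda>z. exp (- l * X z)) (r l)" if "0 < l" for l
      using L[OF that] r[OF that] by (intro has_bochner_integral_nn_integral) auto
    \<comment> \<open>The integral of this quotient is computable: the moments below
      \<open>n\<close> are finite and known by induction.\<close>
    define R where "R l z = (exp (- l * X z) - (\<Sum>j<n. (- l) ^ j * (X z ^ j / fact j))) / (- l) ^ n" for l z
    define g where "g l = (r l - (\<Sum>j<n. (- l) ^ j * c j)) / (- l) ^ n" for l
    have intR: "has_bochner_integral m (R l) (g l)" if "0 < l" for l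
      unfolding R_def[abs_def] g_def
      by (intro has_bochner_integral_divide has_bochner_integral_diff has_bochner_integral_sum
          has_bochner_integral_mult_right int int0 that) auto
    have R: "AE z in m. exp (- l * X z) * (X z ^ n / fact n) \<le> R l z \<and> R l z \<le> X z ^ n / fact n" if l: "0 < l" for l
      using X
    proof eventually_elim
      case (elim z)
      have "0 \<le> l * X z" using elim l by simp
      then obtain \<xi> where \<xi>: "0 \<le> \<xi>" "\<xi> \<le> l * X z"
          "exp (- (l * X z)) = (\<Sum>j<n. (- (l * X z)) ^ j / fact j) + exp (- \<xi>) * ((- (l * X z)) ^ n / fact n)"
        by (rule exp_minus_taylor)
      have p: "(- (l * X z)) ^ j = (- l) ^ j * X z ^ j" for j
        by (metis mult_minus_left power_mult_distrib)
      have "R l z = exp (- \<xi>) * (X z ^ n / fact n)"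
        using \<xi>(3) l by (simp add: R_def p)
      moreover have "0 \<le> X z ^ n / fact n" using elim by simp
      moreover have "exp (- l * X z) \<le> exp (- \<xi>)" "exp (- \<xi>) \<le> 1" using \<xi>(1,2) by simp_all
      ultimately show ?case
        by (metis mult_right_mono mult_left_le_one_le exp_ge_zero)
    qed
    have nnR: "(\<integral>\<^sup>+z. ennreal (R l z) \<partial>m) = ennreal (g l)" "0 \<le> g l" if l: "0 < l" for l
    proof -
      have "AE z in m. 0 \<le> R l z"
        using R[OF l] X by eventually_elim (auto intro: order_trans[rotated])
      then show "(\<integral>\<^sup>+z. ennreal (R l z) \<partial>m) = ennreal (g l)" "0 \<le> g l"
        using intR[OF l] integral_nonneg_AE[of "R l" m]
        by (auto simp: has_bochner_integral_iff nn_integral_eq_integral)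
    qed
    define L where "L i = 1 / real (Suc i)" for i
    have L0: "0 < L i" for i by (simp add: L_def)
    have Llim: "L \<longlonglongrightarrow> 0" unfolding L_def by (rule LIMSEQ_Suc[OF lim_1_over_n])
    have glim: "(\<lambda>i. g (L i)) \<longlonglongrightarrow> c n"
    proof -
      \<comment> \<open>The same quotient on the side of the series: a shifted power series in
        \<open>- l\<close> with constant term \<open>c n\<close>.\<close>
      have gs: "(\<lambda>i. c (i + n) * (- l) ^ i) sums g l" if l: "0 < l" for l
      proof -
        have "(\<lambda>i. (- l) ^ (i + n) * c (i + n)) sums (r l - (\<Sum>j<n. (- l) ^ j * c j))"
          using s[OF l] by (subst sums_iff_shift) simp
        then have "(\<lambda>i. (- l) ^ (i + n) * c (i + n) / (- l) ^ n) sums g l"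
          unfolding g_def by (rule sums_divide)
        then show ?thesis using l by (simp add: power_add mult_ac)
      qed
      define h where "h y = (\<Sum>i. c (i + n) * y ^ i)" for y
      \<comment> \<open>Convergence of the series at \<open>l = 1\<close> gives radius of
        convergence at least 1, hence continuity at 0.\<close>
      have "(h \<longlongrightarrow> c (0 + n)) (at 0)"
      proof (rule powser_limit_0)
        fix y :: real assume y: "norm y < 1"
        have "summable (\<lambda>i. c (i + n) * y ^ i)"
          by (rule powser_inside[where x="- 1"]) (use sums_summable[OF gs[of 1]] y in auto)
        then show "(\<lambda>i. c (i + n) * y ^ i) sums h y" unfolding h_def by (rule summable_sums)
      qed simp
      moreover have "filterlim (\<lambda>i. - L i) (at 0) sequentially"
        unfolding filterlim_at using L0 tendsto_minus[OF Llim] by (auto simp: L_def)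
      ultimately have "(\<lambda>i. h (- L i)) \<longlonglongrightarrow> c n"
        using filterlim_compose by fastforce
      moreover have "h (- L i) = g (L i)" for i
        unfolding h_def using gs[OF L0] by (rule sums_unique[symmetric])
      ultimately show ?thesis by simp
    qed
    have c0: "0 \<le> c n" by (rule LIMSEQ_le_const[OF glim]) (use nnR(2) L0 in auto)
    \<comment> \<open>Fatou's lemma for the lower bounds of the quotient, which converge pointwise
      to the integrand of the moment.\<close>
    have up: "(\<integral>\<^sup>+z. ennreal (X z ^ n / fact n) \<partial>m) \<le> ennreal (c n)"
    proof -
      have "(\<integral>\<^sup>+z. ennreal (X z ^ n / fact n) \<partial>m) =
          (\<integral>\<^sup>+z. liminf (\<lambda>i. ennreal (exp (- L i * X z) * (X z ^ n / fact n))) \<partial>m)"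
      proof (rule nn_integral_cong)
        fix z
        have "(\<lambda>i. exp (- L i * X z) * (X z ^ n / fact n)) \<longlonglongrightarrow> exp (- 0 * X z) * (X z ^ n / fact n)"
          by (intro tendsto_intros Llim)
        then have "(\<lambda>i. ennreal (exp (- L i * X z) * (X z ^ n / fact n))) \<longlonglongrightarrow> ennreal (X z ^ n / fact n)"
          by (intro tendsto_ennrealI) simp
        then show "ennreal (X z ^ n / fact n) = liminf (\<lambda>i. ennreal (exp (- L i * X z) * (X z ^ n / fact n)))"
          by (simp add: lim_imp_Liminf)
      qed
      also have "\<dots> \<le> liminf (\<lambda>i. \<integral>\<^sup>+z. ennreal (exp (- L i * X z) * (X z ^ n / fact n)) \<partial>m)"
        by (rule nn_integral_liminf) measurable
      also have "\<dots> \<le> liminf (\<lambda>i. ennreal (g (L i)))"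
      proof (rule Liminf_mono, rule always_eventually, rule allI)
        fix i
        show "(\<integral>\<^sup>+z. ennreal (exp (- L i * X z) * (X z ^ n / fact n)) \<partial>m) \<le> ennreal (g (L i))"
          unfolding nnR(1)[OF L0, symmetric]
          by (rule nn_integral_mono_AE) (use R[OF L0] in eventually_elim, auto intro: ennreal_leI)
      qed
      also have "\<dots> = ennreal (c n)"
        by (intro lim_imp_Liminf tendsto_ennrealI glim) simp
      finally show ?thesis .
    qed
    moreover have "ennreal (c n) \<le> (\<integral>\<^sup>+z. ennreal (X z ^ n / fact n) \<partial>m)"
    proof (rule LIMSEQ_le_const2[OF tendsto_ennrealI[OF glim]], intro exI allI impI)
      fix i
      show "ennreal (g (L i)) \<le> (\<integral>\<^sup>+z. ennreal (X z ^ n / fact n) \<partial>m)"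
        unfolding nnR(1)[OF L0, symmetric]
        by (rule nn_integral_mono_AE) (use R[OF L0] in eventually_elim, auto intro: ennreal_leI)
    qed
    ultimately show ?case using c0 by auto
  qed
  then show "(\<integral>\<^sup>+z. ennreal (X z ^ n / fact n) \<partial>m) = ennreal (c n)" "0 \<le> c n" by auto
qed

section \<open>Real-valued censored integrals\<close>

lemma le_ennreal_imp_less_top: "a \<le> ennreal C \<Longrightarrow> a < \<infinity>"
  by (erule le_less_trans) simp

lemma sums_enn2real:
  fixes a :: "nat \<Rightarrow> ennreal"
  assumes "(\<Sum>i. a i) < \<infinity>"
  shows "(\<lambda>i. enn2real (a i)) sums enn2real (\<Sum>i. a i)"
proof -
  have fin: "a i < \<infinity>" for i using ennreal_suminf_lessD[OF assms] .
  have e: "(\<Sum>i. a i) = (\<Sum>i. ennreal (enn2real (a i)))" using fin by simp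
  then have s: "summable (\<lambda>i. enn2real (a i))"
    using assms by (intro summable_suminf_not_top) auto
  then have "(\<Sum>i. a i) = ennreal (\<Sum>i. enn2real (a i))"
    unfolding e by (intro suminf_ennreal2) auto
  then show ?thesis using s by (simp add: suminf_nonneg summable_sums)
qed

text \<open>The passage from nonnegative integrals to signed Bochner integrals, used for the
  operators and for the expectations alike.\<close>

lemma integral_enn2real_diff:
  fixes u u' :: "'a \<Rightarrow> ennreal"
  assumes [measurable]: "u \<in> borel_measurable N" "u' \<in> borel_measurable N"
    and fin: "(\<integral>\<^sup>+z. u z \<partial>N) < \<infinity>" "(\<integral>\<^sup>+z. u' z \<partial>N) < \<infinity>"
    and pt: "\<And>z. z \<in> space N \<Longrightarrow> u z < \<infinity>" "\<And>z. z \<in> space N \<Longrightarrow> u' z < \<infinity>"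
    and h: "\<And>z. z \<in> space N \<Longrightarrow> h z = enn2real (u z) - enn2real (u' z)"
  shows "integrable N h" "(LINT z|N. h z) = enn2real (\<integral>\<^sup>+z. u z \<partial>N) - enn2real (\<integral>\<^sup>+z. u' z \<partial>N)"
proof -
  have *: "integrable N (\<lambda>z. enn2real (w z)) \<and> (LINT z|N. enn2real (w z)) = enn2real (\<integral>\<^sup>+z. w z \<partial>N)"
    if [measurable]: "w \<in> borel_measurable N" and w: "(\<integral>\<^sup>+z. w z \<partial>N) < \<infinity>" "\<And>z. z \<in> space N \<Longrightarrow> w z < \<infinity>" for w
  proof -
    have e: "(\<integral>\<^sup>+z. ennreal (enn2real (w z)) \<partial>N) = (\<integral>\<^sup>+z. w z \<partial>N)"
      using w(2) by (intro nn_integral_cong) simp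
    then show ?thesis using w(1)
      by (auto intro!: integrableI_nonneg simp: integral_eq_nn_integral)
  qed
  note u = *[OF assms(1) fin(1) pt(1)] and u' = *[OF assms(2) fin(2) pt(2)]
  have "integrable N (\<lambda>z. enn2real (u z) - enn2real (u' z))"
    using u u' by auto
  then show "integrable N h" using h by (simp cong: Bochner_Integration.integrable_cong)
  have "(LINT z|N. h z) = (LINT z|N. enn2real (u z) - enn2real (u' z))"
    by (rule Bochner_Integration.integral_cong[OF refl h])
  also have "\<dots> = enn2real (\<integral>\<^sup>+z. u z \<partial>N) - enn2real (\<integral>\<^sup>+z. u' z \<partial>N)"
    using u u' by simp
  finally show "(LINT z|N. h z) = enn2real (\<integral>\<^sup>+z. u z \<partial>N) - enn2real (\<integral>\<^sup>+z. u' z \<partial>N)" .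
qed

text \<open>Signed functions are carried as differences of two bounded nonnegative ones, on which
  the \<open>ennreal\<close> operators act separately. The point 0 is left out because integrals
  over \<open>(0,x)\<close> do not see it.\<close>

definition represents :: "real \<Rightarrow> (real \<Rightarrow> real) \<Rightarrow> (real \<Rightarrow> ennreal) \<Rightarrow> (real \<Rightarrow> ennreal) \<Rightarrow> bool" where
  "represents T \<phi> u u' \<longleftrightarrow>
     u \<in> borel_measurable borel \<and> u' \<in> borel_measurable borel \<and>
     (\<exists>C\<ge>0. \<forall>y\<in>{0<..T}. u y \<le> ennreal C \<and> u' y \<le> ennreal C) \<and>
     (\<forall>y\<in>{0<..T}. \<phi> y = enn2real (u y) - enn2real (u' y))"

locale censored_integral_kernels = contracting_kernels f "halfline \<nu>" "halfline \<kappa>" \<theta> \<delta> T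
  for f \<nu> \<kappa> \<theta> \<delta> T +
  assumes \<nu>_nonneg: "\<And>z. 0 \<le> \<nu> z" and \<kappa>_nonneg: "\<And>z. 0 \<le> \<kappa> z"
begin

abbreviation "J \<equiv> jump_op (halfline \<kappa>) (halfline \<nu>)"
abbreviation "R \<equiv> integral_op (halfline \<kappa>)"
abbreviation "G \<equiv> green_op (halfline \<kappa>) (halfline \<nu>)"

lemma represents_finite:
  assumes "represents T \<phi> u u'" "0 < y" "y \<le> T" shows "u y < \<infinity>" "u' y < \<infinity>"
  using assms unfolding represents_def by (blast intro: le_ennreal_imp_less_top greaterThanAtMost_iff[THEN iffD2])+

text \<open>Commuting the convolution brings the factors into the order of
  \<open>sonine_kernel_op\<close>. All of them are finite on \<open>(0,x)\<close>, so the conversion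
  to real integrands is exact at every point.\<close>

lemma sonine_kernel_op_represents:
  assumes r: "represents T \<phi> u u'" and x: "0 < x" "x \<le> T" and fin: "J u x < \<infinity>" "J u' x < \<infinity>"
  shows "sonine_kernel_op \<nu> \<kappa> \<phi> x = enn2real (J u x) - enn2real (J u' x)"
proof -
  have [measurable]: "u \<in> borel_measurable borel" "u' \<in> borel_measurable borel"
    using r by (auto simp: represents_def)
  define U where "U w z = halfline \<nu> z * w z * halfline \<kappa> (x - z)" for w z
  have Jw: "J w x = (\<integral>\<^sup>+z. U w z \<partial>lborel)" if [measurable]: "w \<in> borel_measurable borel" for w
    unfolding jump_op_def U_def by (subst conv_commute) (simp_all add: conv_def)
  have U: "U w z < \<infinity> \<and> enn2real (U w z) = indicator {0<..<x} z * (\<nu> z * \<kappa> (x - z) * enn2real (w z))"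
    if "\<And>y. 0 < y \<Longrightarrow> y \<le> T \<Longrightarrow> w y < \<infinity>" for w z
  proof (cases "0 < z \<and> z < x")
    case True
    then have "w z < \<infinity>" using that x by auto
    then have "w z = ennreal (enn2real (w z))" by simp
    then have "U w z = ennreal (\<nu> z) * ennreal (enn2real (w z)) * ennreal (\<kappa> (x - z))"
      using True by (simp add: U_def halfline_def)
    then have "U w z = ennreal (\<nu> z * enn2real (w z) * \<kappa> (x - z))"
      using \<nu>_nonneg \<kappa>_nonneg by (simp add: ennreal_mult)
    then show ?thesis using True \<nu>_nonneg \<kappa>_nonneg by (simp add: mult_ac)
  next
    case False
    then have "U w z = 0" by (auto simp: U_def halfline_def)
    then show ?thesis using False by auto
  qed
  note Uu = U[of u, OF represents_finite(1)[OF r]] and Uu' = U[of u', OF represents_finite(2)[OF r]]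
  have "sonine_kernel_op \<nu> \<kappa> \<phi> x = (LINT z|lborel. indicator {0<..<x} z *\<^sub>R (\<nu> z * \<kappa> (x - z) * \<phi> z))"
    using x by (simp add: sonine_kernel_op_def set_lebesgue_integral_def)
  also have "\<dots> = enn2real (\<integral>\<^sup>+z. U u z \<partial>lborel) - enn2real (\<integral>\<^sup>+z. U u' z \<partial>lborel)"
  proof (rule integral_enn2real_diff(2))
    show "U u \<in> borel_measurable lborel" "U u' \<in> borel_measurable lborel"
      unfolding U_def[abs_def] by simp_all
    fix z
    show "U u z < \<infinity>" "U u' z < \<infinity>" using Uu Uu' by auto
    show "indicator {0<..<x} z *\<^sub>R (\<nu> z * \<kappa> (x - z) * \<phi> z) = enn2real (U u z) - enn2real (U u' z)"
    proof (cases "z \<in> {0<..<x}")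
      case True
      then have "\<phi> z = enn2real (u z) - enn2real (u' z)" using r x by (auto simp: represents_def)
      then show ?thesis using True Uu Uu' by (simp add: right_diff_distrib)
    qed (use Uu Uu' in simp)
  qed (use fin in \<open>simp_all add: Jw\<close>)
  finally show ?thesis by (simp add: Jw)
qed

lemma riemann_liouville_represents:
  assumes r: "represents T \<phi> u u'" and x: "0 < x" "x \<le> T" and fin: "R u x < \<infinity>" "R u' x < \<infinity>"
  shows "riemann_liouville_integral \<kappa> \<phi> x = enn2real (R u x) - enn2real (R u' x)"
proof -
  have [measurable]: "u \<in> borel_measurable borel" "u' \<in> borel_measurable borel"
    using r by (auto simp: represents_def)
  define U where "U w z = halfline \<kappa> z * (w (x - z) * indicator {0<..} (x - z))" for w :: "real \<Rightarrow> ennreal" and z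
  have Rw: "R w x = (\<integral>\<^sup>+z. U w z \<partial>lborel)" for w
    unfolding integral_op_def U_def conv_def ..
  have U: "U w z < \<infinity> \<and> enn2real (U w z) = indicator {0<..<x} z * (enn2real (w (x - z)) * \<kappa> z)"
    if "\<And>y. 0 < y \<Longrightarrow> y \<le> T \<Longrightarrow> w y < \<infinity>" for w z
  proof (cases "0 < z \<and> z < x")
    case True
    then have "w (x - z) < \<infinity>" using that x by auto
    then have "w (x - z) = ennreal (enn2real (w (x - z)))" by simp
    then have "U w z = ennreal (\<kappa> z) * ennreal (enn2real (w (x - z)))"
      using True by (simp add: U_def halfline_def)
    then have "U w z = ennreal (enn2real (w (x - z)) * \<kappa> z)"
      using \<kappa>_nonneg by (simp add: ennreal_mult mult.commute)
    then show ?thesis using True \<kappa>_nonneg by simp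
  next
    case False
    then have "U w z = 0" by (auto simp: U_def halfline_def)
    then show ?thesis using False by auto
  qed
  note Uu = U[of u, OF represents_finite(1)[OF r]] and Uu' = U[of u', OF represents_finite(2)[OF r]]
  have "riemann_liouville_integral \<kappa> \<phi> x = (LINT z|lborel. indicator {0<..<x} z *\<^sub>R (\<phi> (x - z) * \<kappa> z))"
    using x by (simp add: riemann_liouville_integral_def set_lebesgue_integral_def)
  also have "\<dots> = enn2real (\<integral>\<^sup>+z. U u z \<partial>lborel) - enn2real (\<integral>\<^sup>+z. U u' z \<partial>lborel)"
  proof (rule integral_enn2real_diff(2))
    show "U u \<in> borel_measurable lborel" "U u' \<in> borel_measurable lborel"
      unfolding U_def[abs_def] by simp_all
    fix z
    show "U u z < \<infinity>" "U u' z < \<infinity>" using Uu Uu' by auto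
    show "indicator {0<..<x} z *\<^sub>R (\<phi> (x - z) * \<kappa> z) = enn2real (U u z) - enn2real (U u' z)"
    proof (cases "z \<in> {0<..<x}")
      case True
      then have "\<phi> (x - z) = enn2real (u (x - z)) - enn2real (u' (x - z))" using r x by (auto simp: represents_def)
      then show ?thesis using True Uu Uu' by (simp add: left_diff_distrib)
    qed (use Uu Uu' in simp)
  qed (use fin in \<open>simp_all add: Rw[symmetric]\<close>)
  finally show ?thesis by (simp add: Rw)
qed

text \<open>The geometric decay estimate with rate 1, at the first power.\<close>

lemma green_op_bounded:
  assumes "represents T \<phi> u u'"
  obtains B where "0 \<le> B" "\<And>y. 0 < y \<Longrightarrow> y \<le> T \<Longrightarrow> G u y \<le> ennreal B" "\<And>y. 0 < y \<Longrightarrow> y \<le> T \<Longrightarrow> G u' y \<le> ennreal B"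
proof -
  obtain C where C: "0 \<le> C" "\<And>y. 0 < y \<Longrightarrow> y \<le> T \<Longrightarrow> u y \<le> ennreal C" "\<And>y. 0 < y \<Longrightarrow> y \<le> T \<Longrightarrow> u' y \<le> ennreal C"
    and m: "u \<in> borel_measurable borel" "u' \<in> borel_measurable borel"
    using assms by (auto simp: represents_def)
  obtain B1 where B1: "0 \<le> B1" "\<And>n y. 0 < y \<Longrightarrow> y \<le> T \<Longrightarrow> (G ^^ n) u y \<le> ennreal (B1 / 1 ^ n)"
    using green_op_pow_finite[OF m(1) C(2) C(1) zero_less_one] by metis
  obtain B2 where B2: "0 \<le> B2" "\<And>n y. 0 < y \<Longrightarrow> y \<le> T \<Longrightarrow> (G ^^ n) u' y \<le> ennreal (B2 / 1 ^ n)"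
    using green_op_pow_finite[OF m(2) C(3) C(1) zero_less_one] by metis
  show thesis
  proof (rule that[of "max B1 B2"])
    fix y :: real assume y: "0 < y" "y \<le> T"
    show "G u y \<le> ennreal (max B1 B2)" "G u' y \<le> ennreal (max B1 B2)"
      using B1(2)[OF y, of 1] B2(2)[OF y, of 1] B1(1) B2(1)
      by (auto intro: order_trans[OF _ ennreal_leI])
  qed (use B1 in simp)
qed

lemma green_term_le: "(J ^^ i) (R u) y \<le> G u y"
  unfolding green_op_def
  using sum_le_suminf[of "\<lambda>i. (J ^^ i) (R u) y" "{i}"] by (simp add: summableI)

text \<open>Each iterate is a term of the series \<open>G u\<close> or \<open>G u'\<close> and is
  dominated by its sum, so one bound serves all \<open>i\<close>. That also supplies the finiteness
  needed to convert the next iterate.\<close>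

lemma represents_iterate:
  assumes r: "represents T \<phi> u u'"
  shows "represents T ((sonine_kernel_op \<nu> \<kappa> ^^ i) (riemann_liouville_integral \<kappa> \<phi>)) ((J ^^ i) (R u)) ((J ^^ i) (R u'))"
proof -
  have [measurable]: "u \<in> borel_measurable borel" "u' \<in> borel_measurable borel"
    using r by (auto simp: represents_def)
  obtain B where B: "0 \<le> B" "\<And>y. 0 < y \<Longrightarrow> y \<le> T \<Longrightarrow> G u y \<le> ennreal B" "\<And>y. 0 < y \<Longrightarrow> y \<le> T \<Longrightarrow> G u' y \<le> ennreal B"
    using green_op_bounded[OF r] by metis
  have b: "(J ^^ i) (R u) y \<le> ennreal B" "(J ^^ i) (R u') y \<le> ennreal B" if "0 < y" "y \<le> T" for y i
    using order_trans[OF green_term_le B(2)[OF that]] order_trans[OF green_term_le B(3)[OF that]] by auto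
  have bf: "(J ^^ i) (R u) y < \<infinity>" "(J ^^ i) (R u') y < \<infinity>" if "0 < y" "y \<le> T" for y i
    using b[OF that, of i] by (blast intro: le_ennreal_imp_less_top)+
  have m: "(J ^^ i) (R w) \<in> borel_measurable borel" if "w \<in> borel_measurable borel" for w i
    using that by (intro K.measurable_jump_op_pow K.measurable_integral_op)
  show ?thesis
  proof (induction i)
    case 0
    show ?case unfolding represents_def
      using b[of _ 0] m[of _ 0] B(1) riemann_liouville_represents[OF r] bf[of _ 0] by auto
  next
    case (Suc i)
    have "(sonine_kernel_op \<nu> \<kappa> ^^ Suc i) (riemann_liouville_integral \<kappa> \<phi>) y =
        enn2real ((J ^^ Suc i) (R u) y) - enn2real ((J ^^ Suc i) (R u') y)" if y: "0 < y" "y \<le> T" for y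
      using sonine_kernel_op_represents[OF Suc y] bf[OF y, of "Suc i"] by simp
    moreover have "\<exists>C\<ge>0. \<forall>y\<in>{0<..T}. (J ^^ Suc i) (R u) y \<le> ennreal C \<and> (J ^^ Suc i) (R u') y \<le> ennreal C"
      using b[of _ "Suc i"] B(1) by (intro exI[of _ B]) auto
    ultimately show ?case unfolding represents_def
      using m[of u "Suc i"] m[of u' "Suc i"] by auto
  qed
qed

lemma represents_censored_integral:
  assumes r: "represents T \<phi> u u'"
  shows "represents T (censored_integral \<nu> \<kappa> \<phi>) (G u) (G u')"
proof -
  have [measurable]: "u \<in> borel_measurable borel" "u' \<in> borel_measurable borel"
    using r by (auto simp: represents_def)
  obtain B where B: "0 \<le> B" "\<And>y. 0 < y \<Longrightarrow> y \<le> T \<Longrightarrow> G u y \<le> ennreal B" "\<And>y. 0 < y \<Longrightarrow> y \<le> T \<Longrightarrow> G u' y \<le> ennreal B"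
    using green_op_bounded[OF r] by metis
  have "censored_integral \<nu> \<kappa> \<phi> y = enn2real (G u y) - enn2real (G u' y)" if y: "0 < y" "y \<le> T" for y
  proof -
    have fin: "G u y < \<infinity>" "G u' y < \<infinity>"
      using B(2,3)[OF y] by (blast intro: le_ennreal_imp_less_top)+
    have "(\<lambda>i. enn2real ((J ^^ i) (R u) y) - enn2real ((J ^^ i) (R u') y)) sums (enn2real (G u y) - enn2real (G u' y))"
      using fin unfolding green_op_def by (intro sums_diff sums_enn2real)
    moreover have "enn2real ((J ^^ i) (R u) y) - enn2real ((J ^^ i) (R u') y) =
        (sonine_kernel_op \<nu> \<kappa> ^^ i) (riemann_liouville_integral \<kappa> \<phi>) y" for i
      using represents_iterate[OF r, of i] y by (auto simp: represents_def)
    ultimately show ?thesis unfolding censored_integral_def by (simp add: sums_iff)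
  qed
  then show ?thesis unfolding represents_def using B by (auto intro!: K.measurable_green_op)
qed

lemma represents_censored_integral_pow:
  "represents T \<phi> u u' \<Longrightarrow> represents T ((censored_integral \<nu> \<kappa> ^^ n) \<phi>) ((G ^^ n) u) ((G ^^ n) u')"
  by (induction n) (auto intro: represents_censored_integral)

end

section \<open>Expansion of the resolvent of the censored process\<close>

locale censored_expansion = censored_integral_kernels f \<nu> \<kappa> \<theta> \<delta> T + prob_space M
  for f \<nu> \<kappa> \<theta> \<delta> T and M :: "'w measure" +
  fixes S :: "nat \<Rightarrow> real \<Rightarrow> 'w \<Rightarrow> real" and x :: real
  assumes indep: "independent_subordinators M f S" and x_pos: "0 < x" and x_le: "x \<le> T"
begin

sublocale Z: censored_resolvent f "halfline \<nu>" "halfline \<kappa>" 0 "halfline \<kappa>" M S x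
  using resolvent_kernel_zero indep x_pos
  by (intro censored_resolvent.intro censored_resolvent_axioms.intro prob_space_axioms)

text \<open>The process is interpreted twice, as \<open>Z\<close> with rate 0 and as
  \<open>L\<close> with rate \<open>l\<close>. Both share \<open>alive_sum\<close>, which depends on
  the paths and the starting point only, whereas \<open>L\<close> brings in the kernel of rate
  \<open>l\<close>.\<close>

lemma laplace_alive_sum:
  assumes u: "u \<in> borel_measurable borel" "\<And>y. 0 < y \<Longrightarrow> y \<le> T \<Longrightarrow> u y \<le> ennreal C" "0 \<le> C" and l: "0 < l"
  obtains r where "0 \<le> r" "(\<lambda>n. (- l) ^ n * enn2real ((G ^^ (n + 1)) u x)) sums r"
    "(\<integral>\<^sup>+\<omega>. \<integral>\<^sup>+t. ennreal (exp (- l * t)) * Z.alive_sum u \<omega> t \<partial>lborel \<partial>M) = ennreal r"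
proof -
  obtain kl where kl: "resolvent_kernel f (halfline \<nu>) (halfline \<kappa>) l kl"
    using resolvent_kernel_exists[OF Z.P.subordinator_process_axioms[of 0], of l] l by auto
  interpret L: censored_resolvent f "halfline \<nu>" "halfline \<kappa>" l kl M S x
    using kl indep x_pos by (intro censored_resolvent.intro censored_resolvent_axioms.intro prob_space_axioms)
  note s = green_op_power_series[OF kl u(1) u(2) u(3) x_pos x_le]
  show thesis
  proof (rule that[OF _ s(1)])
    show "(\<integral>\<^sup>+\<omega>. \<integral>\<^sup>+t. ennreal (exp (- l * t)) * Z.alive_sum u \<omega> t \<partial>lborel \<partial>M) = ennreal (enn2real (green_op kl (halfline \<nu>) u x))"
      using L.expectation_alive_sum[OF u(1)] s(2) by simp
  qed simp
qed

text \<open>Under the measure with density \<open>alive_sum\<close> on the product of the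
  probability space and time, the time coordinate has a Laplace transform given by the power series
  with coefficients \<open>(G ^^ (n + 1)) u x\<close>; its moments are read off from them.\<close>

lemma moments_alive_sum:
  assumes u: "u \<in> borel_measurable borel" "\<And>y. 0 < y \<Longrightarrow> y \<le> T \<Longrightarrow> u y \<le> ennreal C" "0 \<le> C"
  shows "(\<integral>\<^sup>+\<omega>. \<integral>\<^sup>+t. ennreal (t ^ n / fact n) * Z.alive_sum u \<omega> t \<partial>lborel \<partial>M) =
    ennreal (enn2real ((G ^^ (n + 1)) u x))"
proof -
  define N where "N = density (M \<Otimes>\<^sub>M lborel) (\<lambda>z. Z.alive_sum u (fst z) (snd z))"
  \<comment> \<open>Truncation makes the time coordinate nonnegative everywhere; at negative times
    the density vanishes.\<close>
  define X where "X z = max 0 (snd z)" for z :: "'w \<times> real"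
  have A[measurable]: "(\<lambda>z. Z.alive_sum u (fst z) (snd z)) \<in> borel_measurable (M \<Otimes>\<^sub>M lborel)"
    by (rule Z.measurable_alive_sum[OF u(1)])
  have [measurable]: "snd \<in> borel_measurable (M \<Otimes>\<^sub>M lborel)"
    using measurable_snd[of M "lborel :: real measure"] by simp
  have [measurable]: "X \<in> borel_measurable (M \<Otimes>\<^sub>M lborel)" unfolding X_def[abs_def] by measurable
  have N: "(\<integral>\<^sup>+z. h (X z) \<partial>N) = (\<integral>\<^sup>+\<omega>. \<integral>\<^sup>+t. h t * Z.alive_sum u \<omega> t \<partial>lborel \<partial>M)"
    if h[measurable]: "h \<in> borel_measurable borel" for h :: "real \<Rightarrow> ennreal"
  proof -
    have "(\<integral>\<^sup>+z. h (X z) \<partial>N) = (\<integral>\<^sup>+z. Z.alive_sum u (fst z) (snd z) * h (X z) \<partial>(M \<Otimes>\<^sub>M lborel))"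
      unfolding N_def by (rule nn_integral_density[OF A]) measurable
    also have "\<dots> = (\<integral>\<^sup>+\<omega>. \<integral>\<^sup>+t. Z.alive_sum u (fst (\<omega>, t)) (snd (\<omega>, t)) * h (X (\<omega>, t)) \<partial>lborel \<partial>M)"
      by (rule lborel.nn_integral_fst[symmetric]) measurable
    also have "\<dots> = (\<integral>\<^sup>+\<omega>. \<integral>\<^sup>+t. h t * Z.alive_sum u \<omega> t \<partial>lborel \<partial>M)"
    proof (intro nn_integral_cong)
      fix \<omega> t assume \<omega>: "\<omega> \<in> space M"
      show "Z.alive_sum u (fst (\<omega>, t)) (snd (\<omega>, t)) * h (X (\<omega>, t)) = h t * Z.alive_sum u \<omega> t"
        using Z.alive_sum_dead[OF \<omega>, of t u] by (cases "0 \<le> t") (auto simp: X_def lifetime_interval_def mult.commute)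
    qed
    finally show ?thesis .
  qed
  let ?P = "\<lambda>l r. 0 < l \<longrightarrow> 0 \<le> r \<and> (\<lambda>n. (- l) ^ n * enn2real ((G ^^ (n + 1)) u x)) sums r \<and>
      (\<integral>\<^sup>+\<omega>. \<integral>\<^sup>+t. ennreal (exp (- l * t)) * Z.alive_sum u \<omega> t \<partial>lborel \<partial>M) = ennreal r"
  have "\<exists>r. ?P l r" for l
  proof (cases "0 < l")
    case True
    obtain r where "0 \<le> r" "(\<lambda>n. (- l) ^ n * enn2real ((G ^^ (n + 1)) u x)) sums r"
      "(\<integral>\<^sup>+\<omega>. \<integral>\<^sup>+t. ennreal (exp (- l * t)) * Z.alive_sum u \<omega> t \<partial>lborel \<partial>M) = ennreal r"
      by (rule laplace_alive_sum[OF u True])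
    then show ?thesis by blast
  qed blast
  then have "\<forall>l. \<exists>r. ?P l r" by blast
  from choice[OF this] obtain r where P: "\<forall>l. ?P l (r l)" by blast
  have r: "0 \<le> r l" "(\<lambda>n. (- l) ^ n * enn2real ((G ^^ (n + 1)) u x)) sums r l"
      "(\<integral>\<^sup>+\<omega>. \<integral>\<^sup>+t. ennreal (exp (- l * t)) * Z.alive_sum u \<omega> t \<partial>lborel \<partial>M) = ennreal (r l)" if "0 < l" for l
    using P[rule_format, OF that] by blast+
  have "(\<integral>\<^sup>+z. ennreal (X z ^ n / fact n) \<partial>N) = ennreal (enn2real ((G ^^ (n + 1)) u x))"
  proof (rule moments_of_laplace_power_series(1)[where r=r])
    show "X \<in> borel_measurable N" by (simp add: N_def)
    show "(\<integral>\<^sup>+z. ennreal (exp (- l * X z)) \<partial>N) = ennreal (r l)" if "0 < l" for l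
      using N[of "\<lambda>t. ennreal (exp (- l * t))"] r(3)[OF that] by simp
    show "AE z in N. 0 \<le> X z" by (simp add: X_def)
    show "0 \<le> r l" "(\<lambda>n. (- l) ^ n * enn2real ((G ^^ (n + 1)) u x)) sums r l" if "0 < l" for l
      using r(1,2)[OF that] by blast+
  qed
  then show ?thesis using N[of "\<lambda>t. ennreal (t ^ n / fact n)"] by simp
qed

text \<open>Shared by both expansions, with weight \<open>exp (- l * t)\<close> or
  \<open>t ^ n / fact n\<close>. The relation between \<open>g\<close>, \<open>u\<close> and
  \<open>u'\<close> is assumed at 0 as well, since the state 0 is not excluded while the process is
  alive.\<close>

lemma expectation_represents:
  assumes r: "represents T g u u'" and g: "\<And>y. 0 \<le> y \<Longrightarrow> y \<le> T \<Longrightarrow> g y = enn2real (u y) - enn2real (u' y)"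
    and ufin: "\<And>y. u y < \<infinity>" "\<And>y. u' y < \<infinity>"
    and h[measurable]: "h \<in> borel_measurable borel" and h0: "\<And>t. 0 \<le> t \<Longrightarrow> 0 \<le> h t"
    and c: "(\<integral>\<^sup>+\<omega>. \<integral>\<^sup>+t. ennreal (h t) * Z.alive_sum u \<omega> t \<partial>lborel \<partial>M) = ennreal c" "0 \<le> c"
    and c': "(\<integral>\<^sup>+\<omega>. \<integral>\<^sup>+t. ennreal (h t) * Z.alive_sum u' \<omega> t \<partial>lborel \<partial>M) = ennreal c'" "0 \<le> c'"
  shows "AE \<omega> in M. set_integrable lborel (lifetime_interval S x \<omega>) (\<lambda>t. h t * extend_cemetery g (censored_process S x t \<omega>))"
    and "integrable M (\<lambda>\<omega>. LINT t:lifetime_interval S x \<omega>|lborel. h t * extend_cemetery g (censored_process S x t \<omega>))"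
    and "expectation (\<lambda>\<omega>. LINT t:lifetime_interval S x \<omega>|lborel. h t * extend_cemetery g (censored_process S x t \<omega>)) = c - c'"
proof -
  interpret P: pair_sigma_finite M "lborel :: real measure" ..
  have um: "u \<in> borel_measurable borel" "u' \<in> borel_measurable borel" using r by (auto simp: represents_def)
  define F where "F z = indicator (lifetime_interval S x (fst z)) (snd z) *\<^sub>R
      (h (snd z) * extend_cemetery g (censored_process S x (snd z) (fst z)))" for z
  define U where "U w z = ennreal (h (snd z)) * Z.alive_sum w (fst z) (snd z)" for w z
  have [measurable]: "snd \<in> borel_measurable (M \<Otimes>\<^sub>M lborel)"
    using measurable_snd[of M "lborel :: real measure"] by simp
  have Um[measurable]: "U w \<in> borel_measurable (M \<Otimes>\<^sub>M lborel)" if w: "w \<in> borel_measurable borel" for w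
  proof -
    note [measurable] = Z.measurable_alive_sum[OF w]
    show ?thesis unfolding U_def[abs_def] by measurable
  qed
  have Uint: "(\<integral>\<^sup>+z. U w z \<partial>(M \<Otimes>\<^sub>M lborel)) = (\<integral>\<^sup>+\<omega>. \<integral>\<^sup>+t. ennreal (h t) * Z.alive_sum w \<omega> t \<partial>lborel \<partial>M)"
    if w: "w \<in> borel_measurable borel" for w
    by (subst lborel.nn_integral_fst[symmetric, OF Um[OF w]]) (simp add: U_def)
  have Uc: "(\<integral>\<^sup>+z. U u z \<partial>(M \<Otimes>\<^sub>M lborel)) = ennreal c" "(\<integral>\<^sup>+z. U u' z \<partial>(M \<Otimes>\<^sub>M lborel)) = ennreal c'"
    unfolding Uint[OF um(1)] Uint[OF um(2)] by (fact c(1) c'(1))+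
  have pt: "U u z < \<infinity> \<and> U u' z < \<infinity> \<and> F z = enn2real (U u z) - enn2real (U u' z)" if z: "z \<in> space (M \<Otimes>\<^sub>M lborel)" for z
  proof -
    obtain \<omega> t where z: "z = (\<omega>, t)" "\<omega> \<in> space M" using z by (auto simp: space_pair_measure)
    show ?thesis
    proof (cases "t \<in> lifetime_interval S x \<omega>")
      case True
      then have t0: "0 \<le> t" by (simp add: lifetime_interval_def)
      from Z.alive_sum_alive[OF z(2) True] obtain y where y: "censored_process S x t \<omega> = Some y" "0 \<le> y" "y \<le> x"
        "\<And>\<phi>. Z.alive_sum \<phi> \<omega> t = \<phi> y" by blast
      have gy: "g y = enn2real (u y) - enn2real (u' y)" using g y x_le by simp
      have "U w z = ennreal (h t * enn2real (w y))" if "w y < \<infinity>" for w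
        using that h0[OF t0] by (simp add: U_def z y ennreal_mult)
      from this[OF ufin(1)] this[OF ufin(2)] show ?thesis
        using True h0[OF t0] by (simp add: F_def z y extend_cemetery_def gy right_diff_distrib)
    next
      case False
      then show ?thesis by (simp add: F_def U_def z Z.alive_sum_dead)
    qed
  qed
  have iF: "integrable (M \<Otimes>\<^sub>M lborel) F"
    and EF: "(LINT z|(M \<Otimes>\<^sub>M lborel). F z) = enn2real (ennreal c) - enn2real (ennreal c')"
    using integral_enn2real_diff[OF Um[OF um(1)] Um[OF um(2)], of F] pt unfolding Uc by auto
  have eq: "(\<lambda>\<omega>. LINT t:lifetime_interval S x \<omega>|lborel. h t * extend_cemetery g (censored_process S x t \<omega>)) =
      (\<lambda>\<omega>. LINT t|lborel. F (\<omega>, t))"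
    by (simp add: set_lebesgue_integral_def F_def)
  show "AE \<omega> in M. set_integrable lborel (lifetime_interval S x \<omega>) (\<lambda>t. h t * extend_cemetery g (censored_process S x t \<omega>))"
    using P.AE_integrable_fst'[OF iF] by (simp add: set_integrable_def F_def)
  show "integrable M (\<lambda>\<omega>. LINT t:lifetime_interval S x \<omega>|lborel. h t * extend_cemetery g (censored_process S x t \<omega>))"
    unfolding eq by (rule P.integrable_fst'[OF iF])
  show "expectation (\<lambda>\<omega>. LINT t:lifetime_interval S x \<omega>|lborel. h t * extend_cemetery g (censored_process S x t \<omega>)) = c - c'"
    unfolding eq P.integral_fst'[OF iF] EF using c(2) c'(2) by simp
qed

lemma resolvent_expansion:
  assumes r: "represents T g u u'" and g: "\<And>y. 0 \<le> y \<Longrightarrow> y \<le> T \<Longrightarrow> g y = enn2real (u y) - enn2real (u' y)"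
    and ufin: "\<And>y. u y < \<infinity>" "\<And>y. u' y < \<infinity>" and l: "0 < l"
  shows "integrable M (\<lambda>\<omega>. LINT t:lifetime_interval S x \<omega>|lborel. exp (- l * t) * extend_cemetery g (censored_process S x t \<omega>))"
    and "(\<lambda>n. (- l) ^ n * (censored_integral \<nu> \<kappa> ^^ (n + 1)) g x) sums
      expectation (\<lambda>\<omega>. LINT t:lifetime_interval S x \<omega>|lborel. exp (- l * t) * extend_cemetery g (censored_process S x t \<omega>))"
proof -
  obtain C where C: "0 \<le> C" "\<And>y. 0 < y \<Longrightarrow> y \<le> T \<Longrightarrow> u y \<le> ennreal C" "\<And>y. 0 < y \<Longrightarrow> y \<le> T \<Longrightarrow> u' y \<le> ennreal C"
    and m: "u \<in> borel_measurable borel" "u' \<in> borel_measurable borel"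
    using r by (auto simp: represents_def)
  obtain c where c: "0 \<le> c" "(\<lambda>n. (- l) ^ n * enn2real ((G ^^ (n + 1)) u x)) sums c"
    "(\<integral>\<^sup>+\<omega>. \<integral>\<^sup>+t. ennreal (exp (- l * t)) * Z.alive_sum u \<omega> t \<partial>lborel \<partial>M) = ennreal c"
    by (rule laplace_alive_sum[OF m(1) C(2) C(1) l])
  obtain c' where c': "0 \<le> c'" "(\<lambda>n. (- l) ^ n * enn2real ((G ^^ (n + 1)) u' x)) sums c'"
    "(\<integral>\<^sup>+\<omega>. \<integral>\<^sup>+t. ennreal (exp (- l * t)) * Z.alive_sum u' \<omega> t \<partial>lborel \<partial>M) = ennreal c'"
    by (rule laplace_alive_sum[OF m(2) C(3) C(1) l])
  note E = expectation_represents[OF r g ufin _ _ c(3,1) c'(3,1)]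
  show "integrable M (\<lambda>\<omega>. LINT t:lifetime_interval S x \<omega>|lborel. exp (- l * t) * extend_cemetery g (censored_process S x t \<omega>))"
    by (rule E(2)) simp_all
  have "(censored_integral \<nu> \<kappa> ^^ (n + 1)) g x = enn2real ((G ^^ (n + 1)) u x) - enn2real ((G ^^ (n + 1)) u' x)" for n
    using represents_censored_integral_pow[OF r, of "n + 1"] x_pos x_le unfolding represents_def by auto
  then have "(\<lambda>n. (- l) ^ n * (censored_integral \<nu> \<kappa> ^^ (n + 1)) g x) sums (c - c')"
    using sums_diff[OF c(2) c'(2)] by (simp add: right_diff_distrib)
  also have "c - c' = expectation (\<lambda>\<omega>. LINT t:lifetime_interval S x \<omega>|lborel. exp (- l * t) * extend_cemetery g (censored_process S x t \<omega>))"
    by (rule E(3)[symmetric]) simp_all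
  finally show "(\<lambda>n. (- l) ^ n * (censored_integral \<nu> \<kappa> ^^ (n + 1)) g x) sums
      expectation (\<lambda>\<omega>. LINT t:lifetime_interval S x \<omega>|lborel. exp (- l * t) * extend_cemetery g (censored_process S x t \<omega>))" .
qed

lemma moment_expansion:
  fixes n :: nat
  assumes r: "represents T g u u'" and g: "\<And>y. 0 \<le> y \<Longrightarrow> y \<le> T \<Longrightarrow> g y = enn2real (u y) - enn2real (u' y)"
    and ufin: "\<And>y. u y < \<infinity>" "\<And>y. u' y < \<infinity>"
  shows "AE \<omega> in M. set_integrable lborel (lifetime_interval S x \<omega>) (\<lambda>t. t ^ n / fact n * extend_cemetery g (censored_process S x t \<omega>))"
    and "integrable M (\<lambda>\<omega>. LINT t:lifetime_interval S x \<omega>|lborel. t ^ n / fact n * extend_cemetery g (censored_process S x t \<omega>))"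
    and "(censored_integral \<nu> \<kappa> ^^ (n + 1)) g x =
      expectation (\<lambda>\<omega>. LINT t:lifetime_interval S x \<omega>|lborel. t ^ n / fact n * extend_cemetery g (censored_process S x t \<omega>))"
proof -
  obtain C where C: "0 \<le> C" "\<And>y. 0 < y \<Longrightarrow> y \<le> T \<Longrightarrow> u y \<le> ennreal C" "\<And>y. 0 < y \<Longrightarrow> y \<le> T \<Longrightarrow> u' y \<le> ennreal C"
    and m: "u \<in> borel_measurable borel" "u' \<in> borel_measurable borel"
    using r by (auto simp: represents_def)
  note E = expectation_represents[OF r g ufin _ _ moments_alive_sum[OF m(1) C(2) C(1)] enn2real_nonneg
      moments_alive_sum[OF m(2) C(3) C(1)] enn2real_nonneg]
  show "AE \<omega> in M. set_integrable lborel (lifetime_interval S x \<omega>) (\<lambda>t. t ^ n / fact n * extend_cemetery g (censored_process S x t \<omega>))"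
    by (rule E(1)) simp_all
  show "integrable M (\<lambda>\<omega>. LINT t:lifetime_interval S x \<omega>|lborel. t ^ n / fact n * extend_cemetery g (censored_process S x t \<omega>))"
    by (rule E(2)) simp_all
  have "(censored_integral \<nu> \<kappa> ^^ (n + 1)) g x = enn2real ((G ^^ (n + 1)) u x) - enn2real ((G ^^ (n + 1)) u' x)"
    using represents_censored_integral_pow[OF r, of "n + 1"] x_pos x_le unfolding represents_def by auto
  also have "\<dots> = expectation (\<lambda>\<omega>. LINT t:lifetime_interval S x \<omega>|lborel. t ^ n / fact n * extend_cemetery g (censored_process S x t \<omega>))"
    by (rule E(3)[symmetric]) simp_all
  finally show "(censored_integral \<nu> \<kappa> ^^ (n + 1)) g x =
      expectation (\<lambda>\<omega>. LINT t:lifetime_interval S x \<omega>|lborel. t ^ n / fact n * extend_cemetery g (censored_process S x t \<omega>))" .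
qed

end

text \<open>Continuity of the measure from below along half-lines whose left end points decrease to
  \<open>x\<close>.\<close>

lemma levy_tail_right_continuous:
  assumes \<mu>: "levy_measure \<mu>" and x: "0 < x"
  shows "halfline (levy_tail \<mu>) x = (SUP n. halfline (levy_tail \<mu>) (x + 1 / real (Suc n)))"
proof -
  have un: "{x<..} = (\<Union>n. {x + 1 / real (Suc n)<..})"
  proof (intro equalityI subsetI)
    fix y assume "y \<in> {x<..}"
    then obtain n where "1 / real (Suc n) < y - x" using nat_approx_posE[of "y - x"] by auto
    then show "y \<in> (\<Union>n. {x + 1 / real (Suc n)<..})" by (auto intro!: exI[of _ n])
  next
    fix y assume "y \<in> (\<Union>n. {x + 1 / real (Suc n)<..})"
    then obtain n where "x + 1 / real (Suc n) < y" by auto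
    moreover have "0 < 1 / real (Suc n)" by simp
    ultimately show "y \<in> {x<..}" by (simp only: greaterThan_iff)
  qed
  have "emeasure \<mu> {x<..} = (SUP n. emeasure \<mu> {x + 1 / real (Suc n)<..})"
    unfolding un
  proof (rule SUP_emeasure_incseq[symmetric])
    show "range (\<lambda>n. {x + 1 / real (Suc n)<..}) \<subseteq> sets \<mu>" by (auto simp: levy_sets[OF \<mu>])
    show "incseq (\<lambda>n. {x + 1 / real (Suc n)<..})"
    proof (intro incseq_SucI greaterThan_subset_iff[THEN iffD2] add_left_mono)
      fix n show "1 / real (Suc (Suc n)) \<le> 1 / real (Suc n)" by (simp add: field_simps)
    qed
  qed
  moreover have "halfline (levy_tail \<mu>) y = emeasure \<mu> {y<..}" if "0 < y" for y
    using that by (simp add: halfline_def emeasure_levy_tail[OF \<mu>])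
  moreover have "0 < x + 1 / real (Suc n)" for n using x by (intro add_pos_pos) auto
  ultimately show ?thesis using x by (simp del: of_nat_Suc)
qed

text \<open>As \<open>f y / y\<close> tends to infinity at 0, \<open>f\<close> is positive at some
  argument below \<open>q\<close>; and it is nondecreasing.\<close>

lemma bernstein_pos:
  assumes \<mu>: "levy_measure \<mu>" and f: "\<And>q. 0 < q \<Longrightarrow> f q = (LINT t|\<mu>. 1 - exp (- q * t))"
    and inf: "filterlim (\<lambda>y. f y / y) at_top (at_right 0)" and q: "0 < q"
  shows "0 < f q"
proof -
  have "\<forall>\<^sub>F y in at_right 0. 0 < f y / y"
    using inf by (simp add: filterlim_at_top_dense)
  moreover have "\<forall>\<^sub>F y in at_right 0. 0 < y \<and> y < q"
    using q by (auto simp: eventually_at_right_field)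
  ultimately have "\<forall>\<^sub>F y in at_right 0. 0 < f y / y \<and> 0 < y \<and> y < q"
    by (rule eventually_conj)
  then have "\<exists>y. 0 < f y / y \<and> 0 < y \<and> y < q"
    by (rule eventually_happens'[OF trivial_limit_at_right_real])
  then obtain y where y: "0 < f y / y" "0 < y" "y < q" by blast
  have "0 < f y" using y by (simp add: zero_less_divide_iff)
  also have "f y \<le> f q"
    unfolding f[OF y(2)] f[OF q]
  proof (rule integral_mono_AE)
    show "AE t in \<mu>. 1 - exp (- y * t) \<le> 1 - exp (- q * t)"
      using levy_AE_pos[OF \<mu>] by eventually_elim (use y in simp)
  qed (use laplace_levy_tail(1)[OF \<mu>] y q in auto)
  finally show ?thesis .
qed

text \<open>The conjugate has neither a constant nor a linear part either: \<open>y / f y\<close>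
  tends to 0 at 0 because \<open>f y / y\<close> blows up there, and
  \<open>(y / f y) / y = 1 / f y\<close> tends to 0 at infinity. Both functions are thus given by
  their Levy measures alone, whose tails have the required transforms.\<close>

lemma sonine_kernels_bernstein:
  assumes B: "bernstein_triplet f a b \<mu>"
    and "(f \<longlongrightarrow> 0) (at_right 0)" and "filterlim f at_top at_top"
    and inf: "filterlim (\<lambda>y. f y / y) at_top (at_right 0)"
    and "((\<lambda>y. f y / y) \<longlongrightarrow> 0) at_top"
    and B': "bernstein_triplet (\<lambda>y. y / f y) a' b' \<mu>'"
  shows "sonine_kernels f (halfline (levy_tail \<mu>)) (halfline (levy_tail \<mu>'))"
proof -
  have \<mu>: "levy_measure \<mu>" and \<mu>': "levy_measure \<mu>'" using B B' by (auto simp: bernstein_triplet_def)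
  note f = bernstein_drift_zero(3)[OF B assms(2,5)]
  have pos: "0 < f q" if "0 < q" for q using bernstein_pos[OF \<mu> f inf that] .
  have "((\<lambda>y. y / f y) \<longlongrightarrow> 0) (at_right 0)"
    using tendsto_inverse_0_at_top[OF inf] by simp
  moreover have "((\<lambda>y. (y / f y) / y) \<longlongrightarrow> 0) at_top"
  proof (rule Lim_transform_eventually[OF tendsto_inverse_0_at_top[OF assms(3)]])
    show "\<forall>\<^sub>F y in at_top. inverse (f y) = (y / f y) / y"
      using eventually_gt_at_top[of 0] by eventually_elim (simp add: divide_inverse)
  qed
  ultimately have f': "q / f q = (LINT t|\<mu>'. 1 - exp (- q * t))" if "0 < q" for q
    using bernstein_drift_zero(3)[OF B'] that by blast
  have Lv: "(\<integral>\<^sup>+x. ennreal (exp (- q * x)) * halfline (levy_tail \<mu>) x \<partial>lborel) = ennreal (f q / q)" if "0 < q" for q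
    unfolding laplace_levy_tail(2)[OF \<mu> that] f[OF that] ..
  have Lk: "(\<integral>\<^sup>+x. ennreal (exp (- q * x)) * halfline (levy_tail \<mu>') x \<partial>lborel) = ennreal (1 / f q)" if "0 < q" for q
    using laplace_levy_tail(2)[OF \<mu>' that] f'[OF that, symmetric] that by simp
  note mv = borel_measurable_halfline_levy_tail[OF \<mu>] and mk = borel_measurable_halfline_levy_tail[OF \<mu>']
  show ?thesis
  proof (rule sonine_kernels.intro)
    show "conv (halfline (levy_tail \<mu>)) (halfline (levy_tail \<mu>')) x = 1" if "0 < x" for x
    proof (rule sonine_conv[OF mv mk _ _ halfline_levy_tail_antimono[OF \<mu>] halfline_levy_tail_antimono[OF \<mu>'] _ that])
      fix q :: real assume q: "0 < q"
      have "ennreal (f q / q) * ennreal (1 / f q) = ennreal (1 / q)"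
        using pos[OF q] q by (simp add: ennreal_mult[symmetric])
      then show "(\<integral>\<^sup>+x. ennreal (exp (- q * x)) * halfline (levy_tail \<mu>) x \<partial>lborel) *
          (\<integral>\<^sup>+x. ennreal (exp (- q * x)) * halfline (levy_tail \<mu>') x \<partial>lborel) = ennreal (1 / q)"
        unfolding Lv[OF q] Lk[OF q] .
    qed simp_all
    show "halfline (levy_tail \<mu>) x = (SUP n. halfline (levy_tail \<mu>) (x + 1 / real (Suc n)))" if "0 < x" for x
      by (rule levy_tail_right_continuous[OF \<mu> that])
    show "halfline h z < \<infinity>" for h z by (simp add: halfline_def indicator_def)
    then show "halfline h z < \<infinity>" for h z .
    show "(\<integral>\<^sup>+x. ennreal (exp (- q * x)) * halfline (levy_tail \<mu>) x \<partial>lborel) = ennreal (f q / q)" if "0 < q" for q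
      using Lv[OF that] .
    show "(\<integral>\<^sup>+x. ennreal (exp (- q * x)) * halfline (levy_tail \<mu>') x \<partial>lborel) = ennreal (1 / f q)" if "0 < q" for q
      using Lk[OF that] .
    show "halfline (levy_tail \<mu>) y \<le> halfline (levy_tail \<mu>) x" if "0 < x" "x \<le> y" for x y
      using halfline_levy_tail_antimono[OF \<mu> that] .
  qed (use pos mv mk in simp_all)
qed

section \<open>Reduction of the hypotheses of the theorem, and the law of the lifetime\<close>

lemma (in sonine_kernels) kint_halfline:
  assumes k: "k = halfline h" and h: "\<And>z. 0 \<le> h z"
  shows "kint y = ennreal (LINT s:{0<..<y}|lborel. h s)"
proof -
  have e: "ennreal (indicator {0<..<y} s *\<^sub>R h s) = k s * indicator {..<y} s" for s
    using h[of s] by (auto simp: k halfline_def indicator_def)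
  have m: "(\<lambda>s. indicator {0<..<y} s *\<^sub>R h s) \<in> borel_measurable lborel"
  proof -
    have "(\<lambda>s. enn2real (k s * indicator {..<y} s)) \<in> borel_measurable lborel" by simp
    moreover have "enn2real (k s * indicator {..<y} s) = indicator {0<..<y} s *\<^sub>R h s" for s
      unfolding e[symmetric] using h[of s] by simp
    ultimately show ?thesis by simp
  qed
  have "(LINT s:{0<..<y}|lborel. h s) = enn2real (\<integral>\<^sup>+s. ennreal (indicator {0<..<y} s *\<^sub>R h s) \<partial>lborel)"
    unfolding set_lebesgue_integral_def using h by (intro integral_eq_nn_integral m) auto
  also have "\<dots> = enn2real (kint y)" unfolding e kint_def ..
  finally show ?thesis using kint_finite[of y] by simp
qed

text \<open>Any number strictly between the upper limit and 1 bounds the function near 0; taking the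
  maximum with 0 makes it nonnegative.\<close>

lemma Limsup_less_1_imp:
  fixes h :: "real \<Rightarrow> real"
  assumes "Limsup (at_right 0) (\<lambda>y. ereal (h y)) < 1"
  obtains \<theta> \<delta> where "0 \<le> \<theta>" "\<theta> < 1" "0 < \<delta>" "\<And>y. 0 < y \<Longrightarrow> y < \<delta> \<Longrightarrow> h y \<le> \<theta>"
proof -
  obtain c where c: "Limsup (at_right 0) (\<lambda>y. ereal (h y)) < ereal c" "ereal c < 1"
    using ereal_dense2[OF assms] by auto
  have "\<forall>\<^sub>F y in at_right 0. ereal (h y) < ereal c" using c(1) by (rule Limsup_lessD)
  then obtain \<delta> where "0 < \<delta>" "\<And>y. 0 < y \<Longrightarrow> y < \<delta> \<Longrightarrow> h y < c"
    by (auto simp: eventually_at_right_field)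
  then show thesis using c(2) by (intro that[of "max 0 c" \<delta>]) (auto simp: less_imp_le max.coboundedI2)
qed

text \<open>For the constant 1 only being alive matters, so this is the integral of
  \<open>exp (- l * t)\<close> up to the lifetime. For an infinite lifetime the discount is 0 and
  the value is \<open>1 / l\<close>.\<close>

lemma lifetime_integral_exp:
  assumes l: "0 < l" and L: "0 \<le> lifetime S x \<omega>"
  shows "(LINT t:lifetime_interval S x \<omega>|lborel. exp (- l * t) * extend_cemetery (\<lambda>_. 1) (censored_process S x t \<omega>)) =
    (1 - discount l (lifetime S x \<omega>)) / l"
proof -
  let ?I = "lifetime_interval S x \<omega>"
  have "(LINT t:?I|lborel. exp (- l * t) * extend_cemetery (\<lambda>_. 1) (censored_process S x t \<omega>)) =
      (LINT t|lborel. indicator ?I t * exp (- l * t))"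
    unfolding set_lebesgue_integral_def
    by (intro Bochner_Integration.integral_cong refl)
       (auto simp: lifetime_interval_def censored_process_def extend_cemetery_def Let_def indicator_def)
  also have "\<dots> = (1 - discount l (lifetime S x \<omega>)) / l"
  proof (cases "lifetime S x \<omega>")
    case (real r)
    have r: "0 \<le> r" using L real by simp
    have "has_bochner_integral lborel (\<lambda>t. exp (- l * t) * indicator {0..r} t) (- exp (- l * r) / l - - exp (- l * 0) / l)"
      using r l by (intro has_bochner_integral_FTC_Icc_real) (auto intro!: derivative_eq_intros continuous_intros)
    then have "(LINT t|lborel. exp (- l * t) * indicator {0..r} t) = (1 - exp (- l * r)) / l"
      by (simp add: has_bochner_integral_iff diff_divide_distrib)
    moreover have "(LINT t|lborel. indicator ?I t * exp (- l * t)) = (LINT t|lborel. exp (- l * t) * indicator {0..r} t)"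
    proof (rule integral_cong_AE)
      have I: "?I = {0..<r}" using real by (auto simp: lifetime_interval_def)
      show "(\<lambda>t. indicator ?I t * exp (- l * t)) \<in> borel_measurable lborel" unfolding I by simp
      show "AE t in lborel. indicator ?I t * exp (- l * t) = exp (- l * t) * indicator {0..r} t"
        using AE_lborel_singleton[of r] unfolding I by eventually_elim (auto simp: indicator_def)
    qed simp
    ultimately show ?thesis by (simp add: real discount_def)
  next
    case PInf
    have I: "?I = {0..}" using PInf by (auto simp: lifetime_interval_def)
    have "(LINT t|lborel. indicator ?I t * exp (- l * t)) = enn2real (\<integral>\<^sup>+t. ennreal (indicator {0..} t * exp (- l * t)) \<partial>lborel)"
      unfolding I by (rule integral_eq_nn_integral) auto
    also have "(\<integral>\<^sup>+t. ennreal (indicator {0..} t * exp (- l * t)) \<partial>lborel) = (\<integral>\<^sup>+t. indicator {0<..} t * ennreal (exp (- l * t)) \<partial>lborel)"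
      by (intro nn_integral_cong_AE, use AE_lborel_singleton[of 0] in eventually_elim) (auto simp: indicator_def)
    also have "\<dots> = ennreal (1 / l)" by (rule nn_integral_exp_Ioi[OF l])
    finally show ?thesis using l by (simp add: PInf discount_def)
  qed (use L in simp)
  finally show ?thesis .
qed

text \<open>The discount at the lifetime is 1 minus \<open>l\<close> times the integral of
  \<open>exp (- l * t)\<close> up to the lifetime. Multiplying the expansion of that integral by
  \<open>- l\<close> shifts the index by one, and the 1 becomes the term with
  \<open>n = 0\<close>.\<close>

lemma (in censored_expansion) lifetime_expansion:
  assumes l: "0 < l"
  shows "integrable M (\<lambda>\<omega>. discount l (lifetime S x \<omega>))"
    and "(\<lambda>n. (- l) ^ n * (censored_integral \<nu> \<kappa> ^^ n) (\<lambda>_. 1) x) sums expectation (\<lambda>\<omega>. discount l (lifetime S x \<omega>))"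
proof -
  let ?I = "\<lambda>\<omega>. LINT t:lifetime_interval S x \<omega>|lborel. exp (- l * t) * extend_cemetery (\<lambda>_. 1) (censored_process S x t \<omega>)"
  have r: "represents T (\<lambda>_. 1) (\<lambda>_. 1) (\<lambda>_. 0)"
    unfolding represents_def by (auto intro!: exI[of _ 1])
  note E = resolvent_expansion[OF r _ _ _ l, simplified]
  have I: "?I \<omega> = (1 - discount l (lifetime S x \<omega>)) / l" if "\<omega> \<in> space M" for \<omega>
    using Z.lifetime_nonneg[OF that] by (rule lifetime_integral_exp[OF l])
  show int: "integrable M (\<lambda>\<omega>. discount l (lifetime S x \<omega>))"
  proof (rule integrable_const_bound[where B=1])
    show "AE \<omega> in M. norm (discount l (lifetime S x \<omega>)) \<le> 1"
      using discount_le_1[of l] discount_nonneg[of l] Z.lifetime_nonneg l by (intro AE_I2) auto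
    show "(\<lambda>\<omega>. discount l (lifetime S x \<omega>)) \<in> borel_measurable M"
      using Z.measurable_lifetime by measurable
  qed
  have "expectation ?I = expectation (\<lambda>\<omega>. (1 - discount l (lifetime S x \<omega>)) / l)"
    by (rule Bochner_Integration.integral_cong[OF refl I])
  also have "\<dots> = (1 - expectation (\<lambda>\<omega>. discount l (lifetime S x \<omega>))) / l"
    using int by (simp add: prob_space)
  finally have e: "expectation (\<lambda>\<omega>. discount l (lifetime S x \<omega>)) = 1 + (- l) * expectation ?I"
    using l by (simp add: field_simps)
  have s: "(\<lambda>n. (- l) ^ n * (censored_integral \<nu> \<kappa> ^^ (n + 1)) (\<lambda>_. 1) x) sums expectation ?I"
    by (rule resolvent_expansion(2)[OF r _ _ _ l]) simp_all
  have "(\<lambda>n. (- l) * ((- l) ^ n * (censored_integral \<nu> \<kappa> ^^ (n + 1)) (\<lambda>_. 1) x)) sums ((- l) * expectation ?I)"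
    by (rule sums_mult[OF s])
  then have "(\<lambda>n. (- l) ^ Suc n * (censored_integral \<nu> \<kappa> ^^ Suc n) (\<lambda>_. 1) x) sums ((- l) * expectation ?I)"
    by (simp only: power_Suc Suc_eq_plus1[symmetric] mult.assoc)
  then have "(\<lambda>n. (- l) ^ n * (censored_integral \<nu> \<kappa> ^^ n) (\<lambda>_. 1) x) sums ((- l) * expectation ?I + (- l) ^ 0 * (censored_integral \<nu> \<kappa> ^^ 0) (\<lambda>_. 1) x)"
    by (rule sums_Suc)
  then show "(\<lambda>n. (- l) ^ n * (censored_integral \<nu> \<kappa> ^^ n) (\<lambda>_. 1) x) sums expectation (\<lambda>\<omega>. discount l (lifetime S x \<omega>))"
    unfolding e by (simp add: add.commute)
qed

lemma represents_continuous:
  assumes g: "continuous_on {0..T} g" and T: "0 < T"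
  obtains u u' where "represents T g u u'" "\<And>y. 0 \<le> y \<Longrightarrow> y \<le> T \<Longrightarrow> g y = enn2real (u y) - enn2real (u' y)"
    "\<And>y. u y < \<infinity>" "\<And>y. u' y < \<infinity>"
proof -
  \<comment> \<open>Constant continuation beyond both end points keeps the function continuous,
    hence Borel, on the whole line.\<close>
  define g' where "g' y = g (max 0 (min T y))" for y
  have "continuous_on UNIV g'"
    unfolding g'_def[abs_def] by (rule continuous_on_compose2[OF g]) (use T in \<open>auto intro!: continuous_intros\<close>)
  then have [measurable]: "g' \<in> borel_measurable borel" by (rule borel_measurable_continuous_onI)
  have eq: "g y = enn2real (ennreal (max 0 (g' y))) - enn2real (ennreal (max 0 (- g' y)))" if "0 \<le> y" "y \<le> T" for y
    using that by (simp add: g'_def max_def)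
  have "compact (g ` {0..T})" by (intro compact_continuous_image g) auto
  then obtain C where C: "\<And>y. y \<in> {0..T} \<Longrightarrow> \<bar>g y\<bar> \<le> C"
    by (metis bounded_iff compact_imp_bounded image_eqI real_norm_def)
  have "0 \<le> C" using C[of 0] T by (auto intro: order_trans[OF abs_ge_zero])
  moreover have "max 0 (g' y) \<le> C" "max 0 (- g' y) \<le> C" if "y \<in> {0<..T}" for y
    using C[of y] that \<open>0 \<le> C\<close> by (auto simp: g'_def max_def)
  ultimately have "\<exists>C\<ge>0. \<forall>y\<in>{0<..T}. ennreal (max 0 (g' y)) \<le> ennreal C \<and> ennreal (max 0 (- g' y)) \<le> ennreal C"
    by (intro exI[of _ C]) (auto intro!: ennreal_leI)
  then have "represents T g (\<lambda>y. ennreal (max 0 (g' y))) (\<lambda>y. ennreal (max 0 (- g' y)))"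
    unfolding represents_def using eq by auto
  then show thesis by (rule that) (use eq in auto)
qed

theorem theorem6p5:
  fixes f :: "real \<Rightarrow> real" and a b a' b' :: real and \<mu> \<mu>' :: "real measure"
    and M :: "'w measure" and S :: "nat \<Rightarrow> real \<Rightarrow> 'w \<Rightarrow> real"
    and T l x :: real and g :: "real \<Rightarrow> real"
  assumes "bernstein_triplet f a b \<mu>"
    and "(f \<longlongrightarrow> 0) (at_right 0)"
    and "filterlim f at_top at_top"
    and "filterlim (\<lambda>y. f y / y) at_top (at_right 0)"
    and "((\<lambda>y. f y / y) \<longlongrightarrow> 0) at_top"
    and "has_completely_monotone_density \<mu>"
    and "bernstein_triplet (\<lambda>y. y / f y) a' b' \<mu>'"
    and "Limsup (at_right 0)
           (\<lambda>y. ereal (levy_tail \<mu> y * (LINT s:{0<..<y}|lborel. levy_tail \<mu>' s))) < 1"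
    and "independent_subordinators M f S"
    and "0 < T" and "0 < l" and "continuous_on {0..T} g" and "x \<in> {0<..T}"
  shows
    "(integrable M (\<lambda>\<omega>. LINT t:lifetime_interval S x \<omega>|lborel.
         exp (- l * t) * extend_cemetery g (censored_process S x t \<omega>)) \<and>
      (\<lambda>n. (- l) ^ n * (censored_integral (levy_tail \<mu>) (levy_tail \<mu>') ^^ (n + 1)) g x) sums
        prob_space.expectation M (\<lambda>\<omega>. LINT t:lifetime_interval S x \<omega>|lborel.
          exp (- l * t) * extend_cemetery g (censored_process S x t \<omega>)))
     \<and>
     (integrable M (\<lambda>\<omega>. discount l (lifetime S x \<omega>)) \<and>
      (\<lambda>n. (- l) ^ n * (censored_integral (levy_tail \<mu>) (levy_tail \<mu>') ^^ n) (\<lambda>_. 1) x) sums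
        prob_space.expectation M (\<lambda>\<omega>. discount l (lifetime S x \<omega>)))
     \<and>
     (\<forall>n::nat.
        (AE \<omega> in M. set_integrable lborel (lifetime_interval S x \<omega>)
           (\<lambda>t. t ^ n / fact n * extend_cemetery g (censored_process S x t \<omega>))) \<and>
        integrable M (\<lambda>\<omega>. LINT t:lifetime_interval S x \<omega>|lborel.
          t ^ n / fact n * extend_cemetery g (censored_process S x t \<omega>)) \<and>
        (censored_integral (levy_tail \<mu>) (levy_tail \<mu>') ^^ (n + 1)) g x =
          prob_space.expectation M (\<lambda>\<omega>. LINT t:lifetime_interval S x \<omega>|lborel.
            t ^ n / fact n * extend_cemetery g (censored_process S x t \<omega>)))"
proof -
  have tail: "0 \<le> levy_tail \<eta> z" for \<eta> z by (simp add: levy_tail_def)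
  interpret K: sonine_kernels f "halfline (levy_tail \<mu>)" "halfline (levy_tail \<mu>')"
    by (rule sonine_kernels_bernstein[OF assms(1-5,7)])
  obtain \<theta> \<delta> where \<theta>: "0 \<le> \<theta>" "\<theta> < 1" "0 < \<delta>"
      "\<And>y. 0 < y \<Longrightarrow> y < \<delta> \<Longrightarrow> levy_tail \<mu> y * (LINT s:{0<..<y}|lborel. levy_tail \<mu>' s) \<le> \<theta>"
    using Limsup_less_1_imp[OF assms(8)] by metis
  have "contracting_kernels f (halfline (levy_tail \<mu>)) (halfline (levy_tail \<mu>')) \<theta> \<delta> T"
  proof (intro contracting_kernels.intro contracting_kernels_axioms.intro K.sonine_kernels_axioms)
    fix y :: real assume y: "0 < y" "y < \<delta>"
    \<comment> \<open>The limsup condition is stated with real integrals; \<open>kint\<close> is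
      finite, so it carries over to the \<open>ennreal\<close> kernels without loss.\<close>
    have "halfline (levy_tail \<mu>) y * K.kint y =
        ennreal (levy_tail \<mu> y * (LINT s:{0<..<y}|lborel. levy_tail \<mu>' s))"
      using y tail by (simp add: K.kint_halfline[OF refl tail] halfline_def ennreal_mult'[symmetric])
    also have "\<dots> \<le> ennreal \<theta>" using \<theta>(4)[OF y] by (rule ennreal_leI)
    finally show "halfline (levy_tail \<mu>) y * (\<integral>\<^sup>+z. halfline (levy_tail \<mu>') z * indicator {..<y} z \<partial>lborel) \<le> ennreal \<theta>"
      by (simp only: K.kint_def)
  qed (use \<theta> assms in auto)
  then have cik: "censored_integral_kernels f (levy_tail \<mu>) (levy_tail \<mu>') \<theta> \<delta> T"
    using tail by (intro censored_integral_kernels.intro censored_integral_kernels_axioms.intro)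
  have "prob_space M"
    using assms(9) by (simp add: independent_subordinators_def subordinator_def)
  then interpret E: censored_expansion f "levy_tail \<mu>" "levy_tail \<mu>'" \<theta> \<delta> T M S x
    using cik assms(9,13) by (intro censored_expansion.intro censored_expansion_axioms.intro) auto
  obtain u u' where u: "represents T g u u'" "\<And>y. 0 \<le> y \<Longrightarrow> y \<le> T \<Longrightarrow> g y = enn2real (u y) - enn2real (u' y)"
    "\<And>y. u y < \<infinity>" "\<And>y. u' y < \<infinity>"
    using represents_continuous[OF assms(12,10)] by metis
  show ?thesis
    using E.resolvent_expansion[OF u \<open>0 < l\<close>] E.lifetime_expansion[OF \<open>0 < l\<close>] E.moment_expansion[OF u] by blast
qed

end
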